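(* Let $F$ be a $2$-balanced graph containing a cycle, let $f \in E(F)$ be an arbitrary edge of $F$ and let $H = F \otimes_1 (F,f)$. Let $G = G_{n,p}$ for $p = c n^{-1/m_2(H)}$, where $c > 0$ is a sufficiently small constant. Then, with high probability, the following statements hold: (a) There is a $2$-edge-colouring of $G$ with no monochromatic copy of $H$ such that, if $q = o(n^{-v(F) / e(F)})$, the colouring can with high probability be extended to a colouring of $G \cup G_{n,q}$ without monochromatic copies of $H$. (b) There is a $3$-edge-colouring of $G$ with no monochromatic copy of $H$ and $\delta = \delta(H) > 0$ such that, if $q = o(n^{-1/m(H) + \delta})$, the colouring can with high probability be extended to a colouring of $G \cup G_{n,q}$ without monochromatic copies of $H$.
   Context: $G_{n,p}$ is the binomial random graph; $G_{n,q}$ an independent binomial random graph on the same vertex set. For a graph $F$: $d_2(F)=0$ if $F$ has no edges, $d_2(K_2)=1/2$, otherwise $d_2(F)=(e(F)-1)/(v(F)-2)$; $m_2(F)=\max_{F'\subseteq F}d_2(F')$; $F$ is $2$-balanced if $m_2(F')\le m_2(F)$ for all proper subgraphs $F'$. $m(F)=\max_{F'\subseteq F}e(F')/v(F')$. $F\otimes_1(F,f)$ is the graph obtained from a central copy of $F$ by attaching to each edge $g=\{x,y\}$ of it one copy of $F$ in which $\{x,y\}$ plays the role of $f$ and all other vertices are new and distinct.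
   Formalization: "2-balanced" is taken in its standard sense, d_2(F') ≤ d_2(F) for all proper subgraphs F' (so m_2(F) = d_2(F)); the condition m_2(F') ≤ m_2(F) holds for every graph, and (a) then fails, e.g. for K_4 plus a pendant edge f. *)

theory Defs
  imports "HOL-Probability.Probability"
begin

section \<open>Finite simple graphs\<close>

type_synonym 'a ugraph = "'a set \<times> 'a set set"

abbreviation verts :: "'a ugraph \<Rightarrow> 'a set" where "verts \<equiv> fst"
abbreviation edges :: "'a ugraph \<Rightarrow> 'a set set" where "edges \<equiv> snd"

definition is_graph :: "'a ugraph \<Rightarrow> bool" where
  "is_graph G \<longleftrightarrow> finite (verts G) \<and> (\<forall>e\<in>edges G. e \<subseteq> verts G \<and> card e = 2)"

definition subgraphs :: "'a ugraph \<Rightarrow> 'a ugraph set" where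
  "subgraphs G = {K. is_graph K \<and> verts K \<subseteq> verts G \<and> edges K \<subseteq> edges G}"

definition graph_union :: "'a ugraph \<Rightarrow> 'a ugraph \<Rightarrow> 'a ugraph" where
  "graph_union G G' = (verts G \<union> verts G', edges G \<union> edges G')"

definition isomorphic :: "'a ugraph \<Rightarrow> 'b ugraph \<Rightarrow> bool" where
  "isomorphic H K \<longleftrightarrow>
     (\<exists>\<phi>. bij_betw \<phi> (verts H) (verts K) \<and> edges K = (\<lambda>e. \<phi> ` e) ` edges H)"

definition contains_cycle :: "'a ugraph \<Rightarrow> bool" where
  "contains_cycle G \<longleftrightarrow>
     (\<exists>xs. length xs \<ge> 3 \<and> distinct xs \<and> set xs \<subseteq> verts G \<and>
           (\<forall>i<length xs. {xs ! i, xs ! (Suc i mod length xs)} \<in> edges G))"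

section \<open>Densities\<close>

text \<open>A graph with a single edge and additional isolated vertices falls under the last case
  and gets the value 0.\<close>

definition d2 :: "'a ugraph \<Rightarrow> real" where
  "d2 G = (if edges G = {} then 0
           else if card (edges G) = 1 \<and> card (verts G) = 2 then 1 / 2
           else (real (card (edges G)) - 1) / (real (card (verts G)) - 2))"

definition m2 :: "'a ugraph \<Rightarrow> real" where
  "m2 G = Max (d2 ` subgraphs G)"

definition max_density :: "'a ugraph \<Rightarrow> real" where
  "max_density G =
     Max ((\<lambda>K. real (card (edges K)) / real (card (verts K))) ` {K \<in> subgraphs G. verts K \<noteq> {}})"

text \<open>The comparison is between values of \<open>d2\<close>, so that the condition says that the maximum
  defining \<open>m2 G\<close> is attained by \<open>G\<close> itself. With \<open>m2\<close> in place of \<open>d2\<close> it would hold for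
  every graph, by \<open>m2_mono\<close> below.\<close>

definition two_balanced :: "'a ugraph \<Rightarrow> bool" where
  "two_balanced G \<longleftrightarrow> (\<forall>K\<in>subgraphs G. K \<noteq> G \<longrightarrow> d2 K \<le> d2 G)"

lemma finite_subgraphs:
  assumes "is_graph G"
  shows "finite (subgraphs G)"
proof -
  have "edges G \<subseteq> Pow (verts G)" and fin: "finite (verts G)"
    using assms by (auto simp: is_graph_def)
  then have "finite (edges G)"
    by (meson finite_Pow_iff finite_subset)
  then have "finite (Pow (verts G) \<times> Pow (edges G))"
    using fin by simp
  moreover have "subgraphs G \<subseteq> Pow (verts G) \<times> Pow (edges G)"
    by (auto simp: subgraphs_def)
  ultimately show ?thesis
    by (rule rev_finite_subset)
qed

lemma self_in_subgraphs: "is_graph G \<Longrightarrow> G \<in> subgraphs G"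
  by (simp add: subgraphs_def)

lemma m2_mono:
  assumes "is_graph G" "K \<in> subgraphs G"
  shows "m2 K \<le> m2 G"
proof -
  have "subgraphs K \<subseteq> subgraphs G"
    using assms(2) by (auto simp: subgraphs_def)
  moreover have "K \<in> subgraphs K"
    using assms(2) by (auto simp: subgraphs_def)
  ultimately show ?thesis
    unfolding m2_def using finite_subgraphs[OF assms(1)]
    by (intro Max_mono image_mono) auto
qed

lemma two_balanced_iff:
  assumes "is_graph G"
  shows "two_balanced G \<longleftrightarrow> m2 G = d2 G"
proof
  assume "two_balanced G"
  then show "m2 G = d2 G"
    unfolding m2_def using finite_subgraphs[OF assms] self_in_subgraphs[OF assms]
    by (intro Max_eqI) (auto simp: two_balanced_def)
next
  assume "m2 G = d2 G"
  then show "two_balanced G"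
    using finite_subgraphs[OF assms]
    by (metis Max_ge finite_imageI imageI m2_def two_balanced_def)
qed

section \<open>The graph $A \otimes_1 (B,f)$\<close>

text \<open>To every edge \<open>g\<close> of the central copy \<open>A\<close> (vertices \<open>Inl x\<close>) one copy of \<open>B\<close> is attached.
  Its vertices outside \<open>f\<close> become the new vertices \<open>Inr (g, w)\<close>, whereas the ends of \<open>f\<close> are
  identified with the ends of \<open>g\<close> by a bijection \<open>\<tau> g\<close> from \<open>f\<close> to \<open>g\<close>, that is, by one of the
  two orientations. Different \<open>\<tau>\<close> may give non-isomorphic graphs.\<close>

definition attach_map :: "'b set \<Rightarrow> ('a set \<Rightarrow> 'b \<Rightarrow> 'a) \<Rightarrow> 'a set \<Rightarrow> 'b \<Rightarrow> 'a + ('a set \<times> 'b)" where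
  "attach_map f \<tau> g w = (if w \<in> f then Inl (\<tau> g w) else Inr (g, w))"

definition otimes1 ::
  "'a ugraph \<Rightarrow> 'b ugraph \<Rightarrow> 'b set \<Rightarrow> ('a set \<Rightarrow> 'b \<Rightarrow> 'a) \<Rightarrow> ('a + ('a set \<times> 'b)) ugraph" where
  "otimes1 A B f \<tau> =
     (Inl ` verts A \<union> (\<Union>g\<in>edges A. attach_map f \<tau> g ` verts B),
      (\<lambda>e. Inl ` e) ` edges A \<union> (\<Union>g\<in>edges A. (\<lambda>e. attach_map f \<tau> g ` e) ` edges B))"

section \<open>Edge colourings\<close>

definition edge_colouring :: "nat \<Rightarrow> 'a ugraph \<Rightarrow> ('a set \<Rightarrow> nat) \<Rightarrow> bool" where
  "edge_colouring r G \<kappa> \<longleftrightarrow> (\<forall>e\<in>edges G. \<kappa> e < r)"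

definition has_mono_copy :: "'b ugraph \<Rightarrow> 'a ugraph \<Rightarrow> ('a set \<Rightarrow> nat) \<Rightarrow> bool" where
  "has_mono_copy H G \<kappa> \<longleftrightarrow>
     (\<exists>K\<in>subgraphs G. isomorphic H K \<and> (\<exists>k. \<forall>e\<in>edges K. \<kappa> e = k))"

definition good_colouring :: "nat \<Rightarrow> 'b ugraph \<Rightarrow> 'a ugraph \<Rightarrow> ('a set \<Rightarrow> nat) \<Rightarrow> bool" where
  "good_colouring r H G \<kappa> \<longleftrightarrow> edge_colouring r G \<kappa> \<and> \<not> has_mono_copy H G \<kappa>"

definition extendable ::
  "nat \<Rightarrow> 'b ugraph \<Rightarrow> 'a ugraph \<Rightarrow> ('a set \<Rightarrow> nat) \<Rightarrow> 'a ugraph \<Rightarrow> bool" where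
  "extendable r H G \<kappa> G' \<longleftrightarrow>
     (\<exists>\<kappa>'. (\<forall>e\<in>edges G. \<kappa>' e = \<kappa> e) \<and> good_colouring r H (graph_union G G') \<kappa>')"

section \<open>The binomial random graph\<close>

definition all_pairs :: "nat \<Rightarrow> nat set set" where
  "all_pairs n = {e. e \<subseteq> {..<n} \<and> card e = 2}"

text \<open>\<open>bernoulli_pmf p\<close> clamps \<open>p\<close> to the interval from 0 to 1.\<close>

definition binomial_graph :: "nat \<Rightarrow> real \<Rightarrow> nat ugraph pmf" where
  "binomial_graph n p =
     map_pmf (\<lambda>X. ({..<n}, {e \<in> all_pairs n. X e}))
       (Pi_pmf (all_pairs n) False (\<lambda>_. bernoulli_pmf p))"

text \<open>\<open>\<G> n\<close> is a set of possible outcomes of the first random graph on \<open>n\<close> vertices. Each of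
  them gets a colouring \<open>\<kappa> G\<close> that depends on \<open>G\<close> only, not on \<open>q\<close>; the probability is over
  the second random graph, \<open>G\<close> being fixed. Uniformity over \<open>\<G> n\<close> amounts to convergence of
  the probability to 1 along every sequence of graphs \<open>G n \<in> \<G> n\<close>.\<close>

definition whp_extendable_colouring ::
  "nat \<Rightarrow> 'b ugraph \<Rightarrow> (nat \<Rightarrow> nat ugraph set) \<Rightarrow> (nat \<Rightarrow> real) \<Rightarrow> bool" where
  "whp_extendable_colouring r H \<G> q0 \<longleftrightarrow>
     (\<exists>\<kappa>. (\<forall>n. \<forall>G\<in>\<G> n. good_colouring r H G (\<kappa> G)) \<and>
          (\<forall>q. (\<forall>n. 0 \<le> q n \<and> q n \<le> 1) \<and> q \<in> o(q0) \<longrightarrow>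
             (\<forall>\<epsilon>>0. \<forall>\<^sub>F n in sequentially. \<forall>G\<in>\<G> n.
                measure_pmf.prob (binomial_graph n (q n)) {G'. extendable r H G (\<kappa> G) G'} \<ge> 1 - \<epsilon>)))"

end

theory Submission
  imports Defs "HOL-Real_Asymp.Real_Asymp"
begin

text \<open>Put \<open>d = d2 F\<close>; one checks that \<open>m2 H = d\<close>. Let \<open>S\<close> be a minimal part of \<open>F\<close> with
  \<open>d2 S = d\<close>; it is strictly 2-balanced. The 0-statement of the random Ramsey theorem for \<open>S\<close> colours
  \<open>G\<close> with two colours without a monochromatic copy of \<open>S\<close>, hence without one of \<open>F\<close>. Its proof
  explores an edge-minimal non-colourable subgraph copy by copy: a copy attached along a single edge
  costs a small constant factor and every other copy costs a negative power of \<open>n\<close>, so that only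
  subgraphs of bounded size survive. These have at most \<open>d\<close> times as many edges as vertices, and such
  graphs are colourable by induction on a vertex of minimum degree.

  Now give the new edges the colour 1. A monochromatic copy of \<open>H\<close> needs a new edge in each of the
  \<open>e(F)\<close> edge-disjoint copies of \<open>F\<close> that make up \<open>H\<close>, and by the second moment method \<open>G\<close> contains at
  most twice the expected number of copies of the rest, so that the expected number of such copies is
  of order \<open>n ^ v(F) * q ^ e(F)\<close>. With three colours the new edges get the third colour, except that one
  edge of every copy of a minimal densest part of \<open>H\<close> gets the colour 1; these copies are
  vertex-disjoint, and the exceptional edges are as rare as random edges of density about \<open>n ^ - 2\<close>.\<close>

section \<open>Sparse graphs are colourable\<close>

text \<open>Strictness of \<open>S\<close> separates two kinds of attachment. A copy glued along
  just one edge costs a constant factor, because \<open>n ^ (v - 2) * p ^ (e - 1)\<close> does not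
  depend on \<open>n\<close> (with \<open>v\<close> and \<open>e\<close> counted in
  \<open>S\<close>); any larger overlap containing an edge gains a fixed negative power of
  \<open>n\<close>. Constant factors are affordable only if the place of the next copy is not a free
  choice, so it is a function of the explored graph (\<open>pick\<close>). About \<open>ln n\<close>
  cheap steps then beat the \<open>n ^ 2\<close> possible first edges. This bounds the length only
  by a logarithm. Bounded size comes from a second observation: an edge-minimal non-colourable graph
  leaves no edge open, whereas a copy attached along one edge starts out pendant and has open edges,
  and only degenerate steps can lower the number of pendant copies. So the number of steps is linear
  in the number of degenerate ones. In the deterministic part minimum degree at most
  \<open>2 * d\<close> meets copies whose degrees exceed the integer part \<open>k\<close> of
  \<open>d\<close>. The only obstacle is degree \<open>2 * k + 1\<close>, hardest at
  \<open>d = 3 / 2\<close>, and the triangle, whose degrees do not exceed \<open>d\<close>.\<close>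

text \<open>An edge set stands for a graph without isolated vertices. The random graph with edge probability
  \<open>n powr (- 1 / d)\<close> contains about \<open>n powr (excess d T / d)\<close> copies of a graph \<open>T\<close>.\<close>

definition excess :: "real \<Rightarrow> 'b set set \<Rightarrow> real" where
  "excess d T = d * real (card (\<Union>T)) - real (card T)"

lemma excess_Un:
  assumes "finite A" "finite B" "finite (\<Union>A)" "finite (\<Union>B)"
  shows "excess d (A \<union> B) = excess d A + excess d B
           - (d * real (card (\<Union>A \<inter> \<Union>B)) - real (card (A \<inter> B)))"
proof -
  have "card (\<Union>A) + card (\<Union>B) = card (\<Union>A \<union> \<Union>B) + card (\<Union>A \<inter> \<Union>B)"
    using assms by (intro card_Un_Int)
  moreover have "card A + card B = card (A \<union> B) + card (A \<inter> B)"
    using assms by (intro card_Un_Int)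
  ultimately have a: "real (card (\<Union>A \<union> \<Union>B)) = real (card (\<Union>A)) + real (card (\<Union>B)) - real (card (\<Union>A \<inter> \<Union>B))"
    and b: "real (card (A \<union> B)) = real (card A) + real (card B) - real (card (A \<inter> B))"
    by linarith+
  show ?thesis
    unfolding excess_def Union_Un_distrib a b by (simp add: algebra_simps)
qed

text \<open>\<open>C\<close> plays the role of the family of all copies of a strictly 2-balanced graph with \<open>e\<close> edges and
  \<open>v\<close> vertices. That its members are isomorphic is not needed.\<close>

locale sb_family =
  fixes C :: "'b set set set" and d :: real and e v :: nat
  assumes d_gt1: "1 < d" and e_ge3: "3 \<le> e"
    and tight: "real e - 1 = d * (real v - 2)"
    and copy_finite: "P \<in> C \<Longrightarrow> finite P"
    and copy_edge: "P \<in> C \<Longrightarrow> f \<in> P \<Longrightarrow> card f = 2"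
    and copy_card: "P \<in> C \<Longrightarrow> card P = e"
    and copy_verts: "P \<in> C \<Longrightarrow> card (\<Union>P) = v"
    and copy_strict: "P \<in> C \<Longrightarrow> T \<subset> P \<Longrightarrow> 2 \<le> card T
       \<Longrightarrow> real (card T) - 1 < d * (real (card (\<Union>T)) - 2)"
begin

definition colourable :: "'b set set \<Rightarrow> bool" where
  "colourable K \<longleftrightarrow> (\<exists>\<kappa>::'b set \<Rightarrow> bool. \<forall>P\<in>C. P \<subseteq> K \<longrightarrow> \<not> (\<exists>b. \<forall>f\<in>P. \<kappa> f = b))"

lemma not_colourableD:
  "\<not> colourable K \<Longrightarrow> \<exists>P\<in>C. P \<subseteq> K \<and> (\<exists>b. \<forall>f\<in>P. \<kappa> f = (b::bool))"
  unfolding colourable_def by simp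

lemma v_ge3: "3 \<le> v"
proof (rule ccontr)
  assume "\<not> 3 \<le> v"
  then have "d * (real v - 2) \<le> 0" using d_gt1 by (intro mult_nonneg_nonpos) auto
  then show False using tight e_ge3 by simp
qed

lemma copy_Union_finite: "P \<in> C \<Longrightarrow> finite (\<Union>P)"
  using copy_verts v_ge3 by (metis card.infinite not_numeral_le_zero)

text \<open>\<open>2 * d - 1\<close> is the excess of a single edge and, by \<open>tight\<close>,
  also of a whole copy; \<open>copy_strict\<close> puts every part in between strictly higher. By
  \<open>excess_Un\<close>, gluing on a copy along at least one common edge therefore never raises
  the excess.\<close>

lemma sub_copy_excess:
  assumes "P \<in> C" "T \<subseteq> P" "T \<noteq> {}"
  shows "2 * d - 1 \<le> excess d T"
proof -
  have fT: "finite T" using assms copy_finite finite_subset by blast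
  consider "card T = 1" | "T = P" | "T \<subset> P" "2 \<le> card T"
  proof -
    have "card T \<noteq> 0" using fT assms(3) by simp
    then have "card T = 1 \<or> 2 \<le> card T" by linarith
    then show ?thesis using that assms(2) by blast
  qed
  then show ?thesis
  proof cases
    case 1
    then obtain f where "T = {f}" by (meson card_1_singletonE)
    moreover have "card f = 2" using assms calculation copy_edge by auto
    ultimately show ?thesis by (simp add: excess_def)
  next
    case 2
    then show ?thesis using tight copy_card copy_verts assms by (simp add: excess_def algebra_simps)
  next
    case 3
    then show ?thesis using copy_strict[OF assms(1) 3] by (simp add: excess_def algebra_simps)
  qed
qed

lemma sub_copy_excess_eq:
  assumes "P \<in> C" "T \<subseteq> P" "T \<noteq> {}" "excess d T \<le> 2 * d - 1"
  shows "T = P \<or> card T = 1"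
proof (rule ccontr)
  assume n: "\<not> ?thesis"
  have "finite T" using assms copy_finite finite_subset by blast
  then have "card T \<noteq> 0" using assms(3) by simp
  then have "2 \<le> card T" using n by linarith
  then show False using copy_strict[OF assms(1), of T] n assms
    by (auto simp: excess_def algebra_simps)
qed

lemma excess_copy: "P \<in> C \<Longrightarrow> excess d P = 2 * d - 1"
  using tight by (simp add: excess_def copy_card copy_verts algebra_simps)

definition star :: "'b \<Rightarrow> 'b set set \<Rightarrow> 'b set set" where
  "star w K = {f \<in> K. w \<in> f}"

text \<open>Deleting the edges at \<open>x\<close> also deletes the vertex \<open>x\<close>. The
  rest still obeys \<open>copy_strict\<close>, so more than \<open>d\<close> edges must have gone.
  The triangle has degree 2 and \<open>d = 2\<close>, whence \<open>4 \<le> v\<close>.\<close>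

lemma copy_degree_gt:
  assumes P: "P \<in> C" and x: "x \<in> \<Union>P" and v4: "4 \<le> v"
  shows "d < real (card (star x P))"
proof -
  define T where "T = P - star x P"
  have fP: "finite P" "finite (\<Union>P)" using P copy_finite copy_Union_finite by auto
  have sub: "star x P \<subseteq> P" by (auto simp: star_def)
  have cT: "card T + card (star x P) = e"
    using card_mono[OF fP(1) sub] fP sub copy_card[OF P] by (simp add: T_def card_Diff_subset finite_subset[OF sub])
  have UT: "\<Union>T \<subseteq> \<Union>P - {x}" by (auto simp: T_def star_def)
  have cUT: "card (\<Union>T) \<le> v - 1"
    using card_mono[OF _ UT] fP x copy_verts[OF P] by simp
  have "star x P \<noteq> {}" using x by (auto simp: star_def)
  then have TP: "T \<subset> P" using sub by (auto simp: T_def)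
  consider "card T = 0" | "card T = 1" | "2 \<le> card T" by linarith
  then show ?thesis
  proof cases
    case 1
    \<comment> \<open>A copy with all edges through \<open>x\<close> would be a star with at most
      \<open>v - 1\<close> edges, too few for \<open>d > 1\<close>.\<close>
    then have "T = {}" using fP by (simp add: T_def)
    then have all: "star x P = P" using sub by (auto simp: T_def)
    have inj: "inj_on (\<lambda>f. f - {x}) P"
    proof (rule inj_onI)
      fix f g assume "f \<in> P" "g \<in> P" "f - {x} = g - {x}"
      moreover have "x \<in> f" "x \<in> g" using all calculation by (auto simp: star_def)
      ultimately show "f = g" by blast
    qed
    have "(\<lambda>f. f - {x}) ` P \<subseteq> (\<lambda>y. {y}) ` (\<Union>P - {x})"
    proof
      fix a assume "a \<in> (\<lambda>f. f - {x}) ` P"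
      then obtain f where f: "f \<in> P" "a = f - {x}" by auto
      then have "x \<in> f" using all by (auto simp: star_def)
      then have "card a = 1" using copy_edge[OF P f(1)] f by simp
      then obtain y where "a = {y}" by (meson card_1_singletonE)
      then show "a \<in> (\<lambda>y. {y}) ` (\<Union>P - {x})" using f by auto
    qed
    then have "card P \<le> card ((\<lambda>y. {y}) ` (\<Union>P - {x}))"
      using inj fP by (metis card_image card_mono finite_Diff finite_imageI)
    also have "\<dots> \<le> card (\<Union>P - {x})" using fP by (intro card_image_le) auto
    finally have "e \<le> v - 1" using x copy_card[OF P] copy_verts[OF P] fP by simp
    then have "real e - 1 \<le> real v - 2" using v_ge3 by linarith
    moreover have "1 * (real v - 2) < d * (real v - 2)"
      using d_gt1 v_ge3 by (intro mult_strict_right_mono) auto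
    ultimately show ?thesis using tight by simp
  next
    case 2
    then have "real (card (star x P)) = d * (real v - 2)" using cT tight by linarith
    moreover have "d * 2 \<le> d * (real v - 2)" using d_gt1 v4 by (intro mult_left_mono) auto
    ultimately show ?thesis using d_gt1 by linarith
  next
    case 3
    have "real (card T) - 1 < d * (real (card (\<Union>T)) - 2)"
      using copy_strict[OF P TP 3] .
    also have "\<dots> \<le> d * (real v - 3)"
      using d_gt1 cUT v_ge3 by (intro mult_left_mono) auto
    finally have "real (card T) - 1 < d * (real v - 3)" .
    moreover have "d * (real v - 3) = d * (real v - 2) - d" by (simp add: algebra_simps)
    moreover have "real (card T) + real (card (star x P)) = real e" using cT by linarith
    ultimately show ?thesis using tight by linarith
  qed
qed

text \<open>By double counting the average degree is at most \<open>2 * d\<close>. If the minimum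
  reaches this bound, all degrees are equal; the tight cases, degree 3 at \<open>d = 3 / 2\<close>
  and degree 4 for triangles, rest on this regularity.\<close>

lemma exists_low_degree:
  fixes K :: "'b set set"
  assumes "finite K" "\<forall>f\<in>K. card f = 2" "K \<noteq> {}"
    and dens: "real (card K) \<le> d * real (card (\<Union>K))"
  obtains w where "w \<in> \<Union>K" "real (card (star w K)) \<le> 2 * d"
    "\<And>x. x \<in> \<Union>K \<Longrightarrow> card (star w K) \<le> card (star x K)"
    "real (card (star w K)) = 2 * d \<Longrightarrow> \<forall>x\<in>\<Union>K. card (star x K) = card (star w K)"
proof -
  have fU: "finite (\<Union>K)" using assms by (metis card.infinite finite_Union zero_neq_numeral)
  have ne: "\<Union>K \<noteq> {}" using assms by fastforce
  have dc: "(\<Sum>x\<in>\<Union>K. card (star x K)) = 2 * card K"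
  proof -
    have "\<forall>f\<in>K. card {x \<in> \<Union>K. x \<in> f} = 2"
    proof
      fix f assume "f \<in> K"
      then have "{x \<in> \<Union>K. x \<in> f} = f" by auto
      then show "card {x \<in> \<Union>K. x \<in> f} = 2" using assms \<open>f \<in> K\<close> by simp
    qed
    then show ?thesis unfolding star_def by (intro sum_multicount[OF fU assms(1)])
  qed
  obtain w where w: "w \<in> \<Union>K" "\<And>x. x \<in> \<Union>K \<Longrightarrow> card (star w K) \<le> card (star x K)"
    using ex_is_arg_min_if_finite[OF fU ne, of "\<lambda>x. card (star x K)"]
    by (auto simp: is_arg_min_linorder)
  have pos: "0 < card (\<Union>K)" using fU ne by (simp add: card_gt_0_iff)
  have "card (\<Union>K) * card (star w K) \<le> (\<Sum>x\<in>\<Union>K. card (star x K))"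
    using w sum_bounded_below[of "\<Union>K" "card (star w K)" "\<lambda>x. card (star x K)"] by simp
  then have "real (card (\<Union>K)) * real (card (star w K)) \<le> 2 * real (card K)"
    unfolding dc by (metis of_nat_le_iff of_nat_mult of_nat_numeral)
  also have "\<dots> \<le> real (card (\<Union>K)) * (2 * d)" using dens by (simp add: mult.commute)
  finally have le: "real (card (star w K)) \<le> 2 * d" using pos by simp
  have "\<forall>x\<in>\<Union>K. card (star x K) = card (star w K)" if eq: "real (card (star w K)) = 2 * d"
  proof (rule ccontr)
    assume "\<not> ?thesis"
    then obtain y where "y \<in> \<Union>K" "card (star w K) < card (star y K)"
      using w by (metis le_neq_implies_less)
    then have "(\<Sum>x\<in>\<Union>K. card (star w K)) < (\<Sum>x\<in>\<Union>K. card (star x K))"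
      using w fU by (intro sum_strict_mono_ex1) auto
    then have "card (\<Union>K) * card (star w K) < 2 * card K" using dc by simp
    then have "real (card (\<Union>K)) * real (card (star w K)) < 2 * real (card K)"
      by (metis of_nat_less_iff of_nat_mult of_nat_numeral)
    then show False using eq dens by (simp add: algebra_simps)
  qed
  then show ?thesis using that w le by blast
qed

section \<open>Recolouring the edges at one vertex\<close>

text \<open>The equation between truth values gives the edges from \<open>w\<close> to
  \<open>S\<close> the colour \<open>b\<close> and the other edges at \<open>w\<close> the opposite
  colour.\<close>

definition recolour_star :: "'b \<Rightarrow> 'b set \<Rightarrow> bool \<Rightarrow> ('b set \<Rightarrow> bool) \<Rightarrow> 'b set \<Rightarrow> bool" where
  "recolour_star w S b \<kappa> f = (if w \<in> f then ((\<exists>y\<in>S. f = {w, y}) = b) else \<kappa> f)"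

lemma star_edge:
  assumes "\<forall>f\<in>K. card f = 2" "f \<in> star w K"
  obtains y where "y \<noteq> w" "f = {w, y}" "{w, y} \<in> K"
proof -
  have "card f = 2" "w \<in> f" "f \<in> K" using assms by (auto simp: star_def)
  then obtain x z where "f = {x, z}" "x \<noteq> z" by (meson card_2_iff)
  then show ?thesis using \<open>w \<in> f\<close> \<open>f \<in> K\<close> that[of x] that[of z] by (auto simp: insert_commute)
qed

definition nbrs :: "'b \<Rightarrow> 'b set set \<Rightarrow> 'b set" where
  "nbrs w K = {y. {w, y} \<in> K}"

lemma star_nbrs:
  assumes "\<forall>f\<in>K. card f = 2"
  shows "star w K = (\<lambda>y. {w, y}) ` nbrs w K" "w \<notin> nbrs w K" "card (nbrs w K) = card (star w K)"
proof -
  show nw: "w \<notin> nbrs w K" using assms by (fastforce simp: nbrs_def)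
  show st: "star w K = (\<lambda>y. {w, y}) ` nbrs w K"
  proof (intro equalityI subsetI)
    fix f assume "f \<in> star w K"
    then obtain y where "f = {w, y}" "{w, y} \<in> K" using star_edge[OF assms] by metis
    then show "f \<in> (\<lambda>y. {w, y}) ` nbrs w K" by (auto simp: nbrs_def)
  qed (auto simp: star_def nbrs_def)
  have inj: "inj_on (\<lambda>y. {w, y}) S" for S
    by (auto simp: inj_on_def doubleton_eq_iff)
  show "card (nbrs w K) = card (star w K)" unfolding st by (simp add: card_image inj)
qed

text \<open>A monochromatic copy must pass through \<open>w\<close>, as \<open>\<kappa>\<close> is
  good elsewhere, and at \<open>w\<close> it can use edges of one of the two classes only.\<close>

lemma recolour_star_stuck:
  fixes b :: bool
  assumes K2: "\<forall>f\<in>K. card f = 2" and fK: "finite K"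
    and \<kappa>: "\<forall>P\<in>C. P \<subseteq> K - star w K \<longrightarrow> \<not> (\<exists>b::bool. \<forall>f\<in>P. \<kappa> f = b)"
    and nc: "\<not> colourable K"
    and S: "S \<subseteq> nbrs w K"
  obtains P b' where "P \<in> C" "P \<subseteq> K" "w \<in> \<Union>P" "\<And>f. f \<in> P - star w K \<Longrightarrow> \<kappa> f = b'"
    "star w P \<subseteq> (\<lambda>y. {w, y}) ` (if b' = b then S else nbrs w K - S)"
proof -
  obtain P b' where P: "P \<in> C" "P \<subseteq> K" "\<forall>f\<in>P. recolour_star w S b \<kappa> f = b'"
    using not_colourableD[OF nc, of "recolour_star w S b \<kappa>"] by auto
  have "w \<in> \<Union>P"
  proof (rule ccontr)
    assume "w \<notin> \<Union>P"
    then have "P \<subseteq> K - star w K" "\<forall>f\<in>P. recolour_star w S b \<kappa> f = \<kappa> f"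
      using P by (auto simp: star_def recolour_star_def)
    then show False using \<kappa> P(1,3) by metis
  qed
  moreover have "\<kappa> f = b'" if "f \<in> P - star w K" for f
    using that P by (auto simp: star_def recolour_star_def split: if_splits)
  moreover have "star w P \<subseteq> (\<lambda>y. {w, y}) ` (if b' = b then S else nbrs w K - S)"
  proof
    fix f assume f: "f \<in> star w P"
    then have fs: "f \<in> star w K" "w \<in> f" "f \<in> P" using P by (auto simp: star_def)
    then obtain y where y: "f = {w, y}" "y \<in> nbrs w K" using star_nbrs(1)[OF K2] by auto
    have "((\<exists>y\<in>S. f = {w, y}) = b) = b'" using P(3) fs by (auto simp: recolour_star_def split: if_splits)
    then show "f \<in> (\<lambda>y. {w, y}) ` (if b' = b then S else nbrs w K - S)"
      using y by (cases "b' = b") (auto simp: doubleton_eq_iff)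
  qed
  ultimately show ?thesis using that P by blast
qed

text \<open>Split the neighbours of \<open>w\<close> into two classes of at most \<open>k\<close>
  each: a monochromatic copy would have degree at most \<open>k\<close> at \<open>w\<close>.\<close>

lemma colourable_of_low_degree:
  assumes K2: "\<forall>f\<in>K. card f = 2" and fK: "finite K"
    and \<kappa>: "\<forall>P\<in>C. P \<subseteq> K - star w K \<longrightarrow> \<not> (\<exists>b::bool. \<forall>f\<in>P. \<kappa> f = b)"
    and deg: "\<forall>P\<in>C. \<forall>x\<in>\<Union>P. k < card (star x P)"
    and t: "card (star w K) \<le> 2 * k"
  shows "colourable K"
proof (rule ccontr)
  assume nc: "\<not> colourable K"
  have fN: "finite (nbrs w K)"
    using fK finite_imageD[OF _ inj_onI, of "\<lambda>y. {w, y}" "nbrs w K"] star_nbrs(1)[OF K2]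
    by (metis (no_types, lifting) doubleton_eq_iff finite_subset mem_Collect_eq star_def subsetI)
  have cN: "card (nbrs w K) \<le> 2 * k" using star_nbrs(3)[OF K2] t by simp
  obtain S where S: "S \<subseteq> nbrs w K" "card S = min k (card (nbrs w K))"
    by (meson min.cobounded2 obtain_subset_with_card_n)
  have fS: "finite S" using S fN finite_subset by blast
  have c2: "card (nbrs w K - S) \<le> k" using S fS fN cN by (auto simp: card_Diff_subset)
  obtain P b' where P: "P \<in> C" "w \<in> \<Union>P"
    "star w P \<subseteq> (\<lambda>y. {w, y}) ` (if b' = True then S else nbrs w K - S)"
    using recolour_star_stuck[OF K2 fK \<kappa> nc S(1), of True] by metis
  have "card (star w P) \<le> card (if b' = True then S else nbrs w K - S)"
    by (rule surj_card_le[OF _ P(3)]) (use fS fN in auto)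
  also have "\<dots> \<le> k" using S c2 by auto
  finally show False using deg P(1,2) by fastforce
qed

text \<open>If no colouring of the edges at \<open>w\<close> works, then for every choice of \<open>k + 1\<close> neighbours \<open>S\<close> and every
  colour \<open>b\<close> there is a copy through \<open>w\<close> whose edges at \<open>w\<close> lead to \<open>S\<close> and whose remaining edges \<open>A\<close>
  have colour \<open>b\<close>.\<close>

definition half_copy :: "'b \<Rightarrow> 'b set set \<Rightarrow> ('b set \<Rightarrow> bool) \<Rightarrow> nat \<Rightarrow> 'b set \<Rightarrow> bool \<Rightarrow> 'b set set \<Rightarrow> bool" where
  "half_copy w K \<kappa> k S b A \<longleftrightarrow> A \<union> (\<lambda>y. {w, y}) ` S \<in> C \<and> A \<subseteq> K - star w K \<and> (\<forall>f\<in>A. \<kappa> f = b)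
     \<and> S \<subseteq> \<Union>A \<and> w \<notin> \<Union>A \<and> finite A \<and> finite (\<Union>A) \<and> excess d A = d + real k"

text \<open>One class has \<open>k + 1\<close> neighbours and the other only \<open>k\<close>, so a
  copy of degree above \<open>k\<close> at \<open>w\<close> must use the larger class, and all of
  it. Removing \<open>w\<close> and these \<open>k + 1\<close> edges turns the excess
  \<open>2 * d - 1\<close> into \<open>d + k\<close>.\<close>

lemma half_copy_exists:
  assumes K2: "\<forall>f\<in>K. card f = 2" and fK: "finite K"
    and \<kappa>: "\<forall>P\<in>C. P \<subseteq> K - star w K \<longrightarrow> \<not> (\<exists>b::bool. \<forall>f\<in>P. \<kappa> f = b)"
    and nc: "\<not> colourable K"
    and k1: "1 \<le> k"
    and deg: "\<forall>P\<in>C. \<forall>x\<in>\<Union>P. k < card (star x P)"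
    and t: "card (nbrs w K) = 2 * k + 1"
    and S: "S \<subseteq> nbrs w K" "card S = k + 1"
  shows "\<exists>A. half_copy w K \<kappa> k S b A"
proof -
  have fN: "finite (nbrs w K)" using t by (metis add_is_0 card.infinite one_neq_zero)
  have fS: "finite S" using S fN finite_subset by blast
  obtain P b' where P: "P \<in> C" "P \<subseteq> K" "w \<in> \<Union>P" "\<And>f. f \<in> P - star w K \<Longrightarrow> \<kappa> f = b'"
    "star w P \<subseteq> (\<lambda>y. {w, y}) ` (if b' = b then S else nbrs w K - S)"
    using recolour_star_stuck[OF K2 fK \<kappa> nc S(1), of b] by metis
  have fP: "finite P" "finite (\<Union>P)" using P copy_finite copy_Union_finite by auto
  have le: "card (star w P) \<le> card (if b' = b then S else nbrs w K - S)"
    by (rule surj_card_le[OF _ P(5)]) (use fS fN in auto)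
  have "card (nbrs w K - S) = k" using S fS t by (simp add: card_Diff_subset)
  moreover have dw: "k < card (star w P)" using deg P(1,3) by blast
  ultimately have bb: "b' = b" using le by (cases "b' = b") auto
  have inj: "inj_on (\<lambda>y. {w, y}) S" by (auto simp: inj_on_def doubleton_eq_iff)
  have cS: "card ((\<lambda>y. {w, y}) ` S) = k + 1" using card_image[OF inj] S by simp
  have "card (star w P) = k + 1" using le bb S dw by simp
  then have st: "star w P = (\<lambda>y. {w, y}) ` S"
    using P(5) bb cS fS by (intro card_subset_eq) auto
  define A where "A = P - star w P"
  have fA: "finite A" "finite (\<Union>A)" using fP by (auto simp: A_def intro: finite_subset[OF _ fP(2)])
  have PA: "A \<union> (\<lambda>y. {w, y}) ` S = P" using st by (auto simp: A_def star_def)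
  \<comment> \<open>No vertex but \<open>w\<close> is lost: every vertex of the copy has degree at
    least 2, and at most one of its edges leads to \<open>w\<close>.\<close>
  have UA: "\<Union>A = \<Union>P - {w}"
  proof (intro equalityI subsetI)
    fix y assume "y \<in> \<Union>A" then show "y \<in> \<Union>P - {w}" by (auto simp: A_def star_def)
  next
    fix y assume y: "y \<in> \<Union>P - {w}"
    have "k < card (star y P)" using deg P(1) y by blast
    then have "1 < card (star y P)" using k1 by linarith
    moreover have "finite (star y P)" using fP by (simp add: star_def)
    moreover have "card {{w, y}} = 1" by simp
    ultimately have "\<not> star y P \<subseteq> {{w, y}}" by (metis card_mono finite.emptyI finite.insertI not_le)
    then obtain f where f: "f \<in> P" "y \<in> f" "f \<noteq> {w, y}" by (auto simp: star_def)
    have "w \<notin> f"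
    proof
      assume "w \<in> f"
      then have "{w, y} \<subseteq> f" using f by auto
      moreover have "card f = 2" using copy_edge[OF P(1) f(1)] .
      moreover have "card {w, y} = 2" using y by auto
      ultimately show False using f(3) by (metis card.infinite card_subset_eq zero_neq_numeral)
    qed
    then show "y \<in> \<Union>A" using f by (auto simp: A_def star_def)
  qed
  have "card (\<Union>A) = v - 1" using UA P(3) fP copy_verts[OF P(1)] by simp
  then have rA: "real (card (\<Union>A)) = real v - 1" using v_ge3 by simp
  have "star w P \<subseteq> P" by (auto simp: star_def)
  then have "card A = e - (k + 1)" "k + 1 \<le> e"
    using fP copy_card[OF P(1)] cS st card_mono[of P "star w P"] by (auto simp: A_def card_Diff_subset finite_subset)
  then have cA: "real (card A) = real e - real k - 1" by simp
  have ex: "excess d A = d + real k"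
    using tight unfolding excess_def rA cA by (simp add: algebra_simps)
  have "S \<subseteq> \<Union>P - {w}"
  proof
    fix y assume "y \<in> S"
    then have "{w, y} \<in> P" "y \<noteq> w" using PA S star_nbrs(2)[OF K2] by auto
    then show "y \<in> \<Union>P - {w}" by auto
  qed
  moreover have "A \<subseteq> K - star w K" using P(2) by (auto simp: A_def star_def)
  moreover have "\<forall>f\<in>A. \<kappa> f = b" using P(4) bb P(2) by (auto simp: A_def star_def)
  ultimately have "half_copy w K \<kappa> k S b A"
    unfolding half_copy_def using PA P(1) UA fA ex by auto
  then show ?thesis by blast
qed

text \<open>A half copy is a proper part of its copy, so among the overlaps of least excess
  \<open>2 * d - 1\<close> only the single edge remains.\<close>

lemma half_copy_inter:
  assumes A: "half_copy w K \<kappa> k S b A" and k1: "1 \<le> k" and fB: "finite (\<Union>B)" and S: "S \<noteq> {}"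
    and I: "A \<inter> B \<noteq> {}"
  shows "2 * d - 1 \<le> d * real (card (\<Union>A \<inter> \<Union>B)) - real (card (A \<inter> B))"
    and "d * real (card (\<Union>A \<inter> \<Union>B)) - real (card (A \<inter> B)) \<le> 2 * d - 1 \<Longrightarrow>
      card (A \<inter> B) = 1 \<and> \<Union>A \<inter> \<Union>B = \<Union>(A \<inter> B)"
proof -
  define P where "P = A \<union> (\<lambda>y. {w, y}) ` S"
  obtain x where "x \<in> S" using S by blast
  then have "{w, x} \<in> P" by (auto simp: P_def)
  moreover have "{w, x} \<notin> A" using A by (auto simp: half_copy_def)
  ultimately have P: "P \<in> C" "A \<subseteq> P" "A \<noteq> P"
    using A unfolding half_copy_def P_def by blast+
  have fU: "finite (\<Union>A \<inter> \<Union>B)" using fB by simp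
  have sub: "\<Union>(A \<inter> B) \<subseteq> \<Union>A \<inter> \<Union>B" by auto
  have le: "card (\<Union>(A \<inter> B)) \<le> card (\<Union>A \<inter> \<Union>B)" using card_mono[OF fU sub] .
  then have "d * real (card (\<Union>(A \<inter> B))) \<le> d * real (card (\<Union>A \<inter> \<Union>B))"
    using d_gt1 by (intro mult_left_mono) auto
  then have ge: "excess d (A \<inter> B) \<le> d * real (card (\<Union>A \<inter> \<Union>B)) - real (card (A \<inter> B))"
    by (simp add: excess_def)
  have base: "2 * d - 1 \<le> excess d (A \<inter> B)"
    using sub_copy_excess[OF P(1) _ I] P(2) by auto
  show "2 * d - 1 \<le> d * real (card (\<Union>A \<inter> \<Union>B)) - real (card (A \<inter> B))"
    using ge base by linarith
  assume up: "d * real (card (\<Union>A \<inter> \<Union>B)) - real (card (A \<inter> B)) \<le> 2 * d - 1"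
  have "A \<inter> B \<noteq> P" using P by auto
  then have one: "card (A \<inter> B) = 1"
    using sub_copy_excess_eq[OF P(1) _ I] P(2) ge up by auto
  have "excess d (A \<inter> B) = d * real (card (\<Union>A \<inter> \<Union>B)) - real (card (A \<inter> B))"
    using ge base up by linarith
  then have "card (\<Union>(A \<inter> B)) = card (\<Union>A \<inter> \<Union>B)" using d_gt1 by (simp add: excess_def)
  then show "card (A \<inter> B) = 1 \<and> \<Union>A \<inter> \<Union>B = \<Union>(A \<inter> B)"
    using one card_subset_eq[OF fU sub] by auto
qed

text \<open>Two unions of half_copy copies of different colours that both cover the neighbourhood of \<open>w\<close>
  share no edge, and together with the edges at \<open>w\<close> they are too dense.\<close>

lemma two_colours_dense:
  assumes K2: "\<forall>f\<in>K. card f = 2"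
    and sparse: "\<forall>T. T \<subseteq> K \<longrightarrow> 0 \<le> excess d T"
    and R: "R \<subseteq> K - star w K" "finite R" "finite (\<Union>R)" "nbrs w K \<subseteq> \<Union>R" "w \<notin> \<Union>R" "\<forall>f\<in>R. \<kappa> f = b"
    and B: "B \<subseteq> K - star w K" "finite B" "finite (\<Union>B)" "nbrs w K \<subseteq> \<Union>B" "w \<notin> \<Union>B" "\<forall>f\<in>B. \<kappa> f \<noteq> b"
    and ne: "nbrs w K \<noteq> {}"
  shows "real (card (nbrs w K)) * (d + 1) - d \<le> excess d R + excess d B"
proof -
  let ?N = "nbrs w K"
  have fN: "finite ?N" using R finite_subset by blast
  have "R \<inter> B = {}" using R B by auto
  moreover have "card ?N \<le> card (\<Union>R \<inter> \<Union>B)" using R B by (intro card_mono) auto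
  then have "d * real (card ?N) \<le> d * real (card (\<Union>R \<inter> \<Union>B))"
    using d_gt1 by (intro mult_left_mono) auto
  ultimately have 1: "excess d (R \<union> B) \<le> excess d R + excess d B - d * real (card ?N)"
    using excess_Un[of R B d] R B by simp
  have fs: "finite (star w K)" using fN star_nbrs(1)[OF K2] by simp
  have "card (\<Union>(R \<union> B) \<union> {w}) = card (\<Union>(R \<union> B)) + 1"
    using R B by (simp add: Union_Un_distrib)
  moreover have "\<Union>(R \<union> B \<union> star w K) = \<Union>(R \<union> B) \<union> {w}"
  proof -
    have "\<Union>(star w K) = insert w ?N" using ne unfolding star_nbrs(1)[OF K2] by auto
    then show ?thesis using R(4) by auto
  qed
  moreover have "card (R \<union> B \<union> star w K) = card (R \<union> B) + card ?N"
  proof -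
    have "card (R \<union> B \<union> star w K) = card (R \<union> B) + card (star w K)"
      using R B fs by (intro card_Un_disjoint) auto
    then show ?thesis using star_nbrs(3)[OF K2] by simp
  qed
  ultimately have "excess d (R \<union> B \<union> star w K) = excess d (R \<union> B) + d - real (card ?N)"
    by (simp add: excess_def algebra_simps)
  moreover have "0 \<le> excess d (R \<union> B \<union> star w K)"
    using R B by (intro sparse[rule_format]) (auto simp: star_def)
  ultimately show ?thesis using 1 by (simp add: algebra_simps)
qed

text \<open>Two half copies of one colour that share the neighbour \<open>x\<close> cover the
  neighbourhood with excess at most \<open>2 * (d + k) - d\<close>. Having this in both colours,
  \<open>two_colours_dense\<close> demands \<open>2 * d * (k - 1) \<le> 2 * k - 1\<close>, which is
  impossible for \<open>2 * d \<ge> 2 * k + 1\<close> and \<open>k \<ge> 2\<close>. For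
  \<open>k = 1\<close> it is no contradiction.\<close>

lemma no_stuck_vertex_ge2:
  assumes K2: "\<forall>f\<in>K. card f = 2" and fK: "finite K"
    and sparse: "\<forall>T. T \<subseteq> K \<longrightarrow> 0 \<le> excess d T"
    and \<kappa>: "\<forall>P\<in>C. P \<subseteq> K - star w K \<longrightarrow> \<not> (\<exists>b::bool. \<forall>f\<in>P. \<kappa> f = b)"
    and nc: "\<not> colourable K"
    and k2: "2 \<le> k"
    and deg: "\<forall>P\<in>C. \<forall>x\<in>\<Union>P. k < card (star x P)"
    and t: "card (nbrs w K) = 2 * k + 1" and td: "real (2 * k + 1) \<le> 2 * d"
  shows False
proof -
  let ?N = "nbrs w K"
  have fN: "finite ?N" using t by (metis add_is_0 card.infinite one_neq_zero)
  have ne: "?N \<noteq> {}" using t by auto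
  obtain S1 where S1: "S1 \<subseteq> ?N" "card S1 = k + 1"
    by (rule obtain_subset_with_card_n[of "k + 1" ?N]) (use t in auto)
  obtain x where x: "x \<in> S1" using S1 by fastforce
  \<comment> \<open>Two sets of size \<open>k + 1\<close> cover all \<open>2 * k + 1\<close>
    neighbours exactly when they share one vertex.\<close>
  define S2 where "S2 = insert x (?N - S1)"
  have fS1: "finite S1" using S1 fN finite_subset by blast
  have S2: "S2 \<subseteq> ?N" "card S2 = k + 1" "S1 \<union> S2 = ?N"
    using S1 x fN fS1 t by (auto simp: S2_def card_insert_if card_Diff_subset)
  have R: "\<exists>R. R \<subseteq> K - star w K \<and> finite R \<and> finite (\<Union>R) \<and> ?N \<subseteq> \<Union>R \<and> w \<notin> \<Union>R \<and> (\<forall>f\<in>R. \<kappa> f = b)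
      \<and> excess d R \<le> d + 2 * real k" for b
  proof -
    obtain A1 where A1: "half_copy w K \<kappa> k S1 b A1"
      using half_copy_exists[OF K2 fK \<kappa> nc _ deg t S1] k2 by auto
    obtain A2 where A2: "half_copy w K \<kappa> k S2 b A2"
      using half_copy_exists[OF K2 fK \<kappa> nc _ deg t S2(1,2)] k2 by auto
    have xx: "x \<in> \<Union>A1 \<inter> \<Union>A2" using A1 A2 x by (auto simp: half_copy_def S2_def)
    have fin: "finite A1" "finite (\<Union>A1)" "finite A2" "finite (\<Union>A2)" using A1 A2 by (auto simp: half_copy_def)
    have "d \<le> d * real (card (\<Union>A1 \<inter> \<Union>A2)) - real (card (A1 \<inter> A2))"
    proof (cases "A1 \<inter> A2 = {}")
      case True
      have "1 \<le> card (\<Union>A1 \<inter> \<Union>A2)" using xx fin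
        by (metis One_nat_def Suc_leI card_gt_0_iff empty_iff finite_Int)
      then have "d * 1 \<le> d * real (card (\<Union>A1 \<inter> \<Union>A2))"
        using d_gt1 by (intro mult_left_mono) auto
      then show ?thesis using True by simp
    next
      case False
      have "S1 \<noteq> {}" using x by auto
      then show ?thesis using half_copy_inter(1)[OF A1 _ fin(4) _ False] k2 d_gt1 by auto
    qed
    then have "excess d (A1 \<union> A2) \<le> d + 2 * real k"
      using excess_Un[OF fin(1,3,2,4), of d] A1 A2 by (simp add: half_copy_def)
    moreover have "?N \<subseteq> \<Union>(A1 \<union> A2)" using A1 A2 S2(3) unfolding half_copy_def by blast
    ultimately show ?thesis using A1 A2 fin unfolding half_copy_def
      by (intro exI[of _ "A1 \<union> A2"]) auto
  qed
  obtain R where R1: "R \<subseteq> K - star w K" "finite R" "finite (\<Union>R)" "?N \<subseteq> \<Union>R" "w \<notin> \<Union>R" "\<forall>f\<in>R. \<kappa> f = True"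
      "excess d R \<le> d + 2 * real k" using R[of True] by auto
  obtain B where B1: "B \<subseteq> K - star w K" "finite B" "finite (\<Union>B)" "?N \<subseteq> \<Union>B" "w \<notin> \<Union>B" "\<forall>f\<in>B. \<kappa> f = False"
      "excess d B \<le> d + 2 * real k" using R[of False] by auto
  have "real (2 * k + 1) * (d + 1) - d \<le> 2 * d + 4 * real k"
    using two_colours_dense[OF K2 sparse R1(1-6) B1(1-5) _ ne] B1(6,7) R1(7) t by simp
  then have "2 * d * (real k - 1) \<le> 2 * real k - 1" by (simp add: algebra_simps)
  moreover have "(2 * real k + 1) * (real k - 1) \<le> 2 * d * (real k - 1)"
    using td k2 by (intro mult_right_mono) auto
  ultimately have "(2 * real k + 1) * (real k - 1) \<le> 2 * real k - 1" by linarith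
  then have "2 * (real k * real k) \<le> 3 * real k" by (simp add: algebra_simps)
  then have "2 * real k \<le> 3" using k2 by simp
  then show False using k2 by simp
qed

lemma half_copy_union_excess:
  assumes "half_copy w K \<kappa> k S b A" "half_copy w K \<kappa> k S' b' A'"
  shows "excess d (A \<union> A') = 2 * (d + real k) - (d * real (card (\<Union>A \<inter> \<Union>A')) - real (card (A \<inter> A')))"
  using excess_Un[of A A' d] assms by (simp add: half_copy_def)

text \<open>An excess of at least \<open>d + 3 / 2\<close> out of \<open>2 * (d + 1)\<close> leaves
  at most \<open>d + 1 / 2\<close> for the overlap. That is one vertex, worth \<open>d\<close>, or
  one edge, worth \<open>2 * d - 1\<close>, the latter only if \<open>d = 3 / 2\<close>.\<close>

lemma three_halves:
  assumes A1: "half_copy w K \<kappa> 1 {x, y} b A1" and A2: "half_copy w K \<kappa> 1 {y, z} b A2"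
    and d: "3 / 2 \<le> d"
    and none: "\<not> excess d (A1 \<union> A2) < d + 3 / 2"
  shows "(A1 \<inter> A2 = {} \<and> \<Union>A1 \<inter> \<Union>A2 = {y}) \<or>
    (d = 3 / 2 \<and> card (A1 \<inter> A2) = 1 \<and> \<Union>A1 \<inter> \<Union>A2 = \<Union>(A1 \<inter> A2))"
proof -
  let ?L = "d * real (card (\<Union>A1 \<inter> \<Union>A2)) - real (card (A1 \<inter> A2))"
  have fin: "finite (\<Union>A2)" using A2 by (simp add: half_copy_def)
  have yy: "y \<in> \<Union>A1 \<inter> \<Union>A2" using A1 A2 by (auto simp: half_copy_def)
  have L: "?L \<le> d + 1 / 2" using none half_copy_union_excess[OF A1 A2] by simp
  show ?thesis
  proof (cases "A1 \<inter> A2 = {}")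
    case True
    have "card (\<Union>A1 \<inter> \<Union>A2) \<le> 1"
    proof (rule ccontr)
      assume "\<not> ?thesis"
      then have "d * 2 \<le> d * real (card (\<Union>A1 \<inter> \<Union>A2))"
        using d_gt1 by (intro mult_left_mono) auto
      moreover have "d * real (card (\<Union>A1 \<inter> \<Union>A2)) \<le> d + 1 / 2" using L True by simp
      ultimately show False using d by linarith
    qed
    then have "\<Union>A1 \<inter> \<Union>A2 = {y}"
      using yy fin by (metis card_le_Suc0_iff_eq One_nat_def finite_Int insertI1 is_singletonI' is_singleton_the_elem singletonD empty_iff)
    then show ?thesis using True by simp
  next
    case False
    have 1: "2 * d - 1 \<le> ?L" using half_copy_inter(1)[OF A1 _ fin _ False] by simp
    then have d2: "d = 3 / 2" using L d by simp
    then show ?thesis using half_copy_inter(2)[OF A1 _ fin _ False] L by simp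
  qed
qed

text \<open>The third half copy closes a ring: its overlap with the union of the other two is made
  up of two pairwise overlaps, here with \<open>m\<close> vertices and at most \<open>i\<close>
  edges.\<close>

lemma three_disjoint:
  assumes A1: "half_copy w K \<kappa> 1 {x, y} b A1" and A2: "half_copy w K \<kappa> 1 {y, z} b A2" and A3: "half_copy w K \<kappa> 1 {x, z} b A3"
    and U: "\<Union>A1 \<inter> \<Union>A3 = U1" "\<Union>A2 \<inter> \<Union>A3 = U2" "card (U1 \<union> U2) = m"
    and I: "card ((A1 \<union> A2) \<inter> A3) \<le> i"
  shows "excess d (A1 \<union> A2 \<union> A3) \<le> excess d (A1 \<union> A2) + (d + 1) - (d * real m - real i)"
proof -
  have "\<Union>(A1 \<union> A2) \<inter> \<Union>A3 = U1 \<union> U2" using U by auto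
  then show ?thesis
    using excess_Un[of "A1 \<union> A2" A3 d] A1 A2 A3 U(3) I by (simp add: half_copy_def)
qed

text \<open>For \<open>d = 3 / 2\<close> the densities alone give no contradiction, as \<open>K\<^sub>3\<^sub>,\<^sub>3\<close> shows for copies of \<open>C\<^sub>4\<close>.
  In the case of equality some vertex \<open>z\<close> is joined to all three neighbours of \<open>w\<close> in one colour, and
  changing the colour of one of these three edges makes room for the edges at \<open>w\<close>.\<close>

lemma no_stuck_vertex_eq1:
  assumes K2: "\<forall>f\<in>K. card f = 2" and fK: "finite K"
    and sparse: "\<forall>T. T \<subseteq> K \<longrightarrow> 0 \<le> excess d T"
    and \<kappa>: "\<forall>P\<in>C. P \<subseteq> K - star w K \<longrightarrow> \<not> (\<exists>b::bool. \<forall>f\<in>P. \<kappa> f = b)"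
    and nc: "\<not> colourable K"
    and deg: "\<forall>P\<in>C. \<forall>x\<in>\<Union>P. 1 < card (star x P)"
    and t: "card (nbrs w K) = 3" and td: "3 / 2 \<le> d"
    and reg: "d = 3 / 2 \<Longrightarrow> \<forall>x\<in>\<Union>K. card (star x K) = 3"
  shows False
proof -
  let ?N = "nbrs w K"
  have ne: "?N \<noteq> {}" using t by auto
  obtain a b c where N: "?N = {a, b, c}" and abc: "a \<noteq> b" "a \<noteq> c" "b \<noteq> c"
    using t by (metis card_3_iff)
  have half_copy: "\<exists>A. half_copy w K \<kappa> 1 S \<beta> A" if "S \<subseteq> ?N" "card S = 2" for S \<beta>
    using half_copy_exists[OF K2 fK \<kappa> nc _ deg _ that(1), of \<beta>] t that(2) by simp
  \<comment> \<open>With three neighbours \<open>two_colours_dense\<close> demands total excess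
    \<open>2 * d + 3\<close> from the two colours, so a covering set below \<open>d + 3 / 2\<close>
    in each of them is a contradiction.\<close>
  let ?ok = "\<lambda>\<beta> R. R \<subseteq> K - star w K \<and> finite R \<and> finite (\<Union>R) \<and> ?N \<subseteq> \<Union>R \<and> w \<notin> \<Union>R \<and> (\<forall>f\<in>R. \<kappa> f = \<beta>)
      \<and> excess d R < d + 3 / 2"
  have key: "\<exists>R. ?ok \<beta> R" for \<beta>
  proof (rule ccontr)
    assume no: "\<nexists>R. ?ok \<beta> R"
    have pair: "\<not> excess d (A \<union> A') < d + 3 / 2"
      if "half_copy w K \<kappa> 1 S \<beta> A" "half_copy w K \<kappa> 1 S' \<beta> A'" "S \<union> S' = ?N" for A A' S S'
    proof
      assume "excess d (A \<union> A') < d + 3 / 2"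
      moreover have "?N \<subseteq> \<Union>(A \<union> A')" using that unfolding half_copy_def by blast
      ultimately have "?ok \<beta> (A \<union> A')" using that unfolding half_copy_def by auto
      then show False using no by blast
    qed
    have triple: "\<not> excess d (A \<union> A' \<union> A'') < d + 3 / 2"
      if "half_copy w K \<kappa> 1 S \<beta> A" "half_copy w K \<kappa> 1 S' \<beta> A'" "half_copy w K \<kappa> 1 S'' \<beta> A''" "S \<union> S' = ?N" for A A' A'' S S' S''
    proof
      assume "excess d (A \<union> A' \<union> A'') < d + 3 / 2"
      moreover have "?N \<subseteq> \<Union>(A \<union> A' \<union> A'')" using that unfolding half_copy_def by blast
      ultimately have "?ok \<beta> (A \<union> A' \<union> A'')" using that unfolding half_copy_def by auto
      then show False using no by blast
    qed
    obtain A1 where A1: "half_copy w K \<kappa> 1 {a, b} \<beta> A1" using half_copy[of "{a, b}"] N abc by auto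
    obtain A2 where A2: "half_copy w K \<kappa> 1 {b, c} \<beta> A2" using half_copy[of "{b, c}"] N abc by auto
    obtain A3 where A3: "half_copy w K \<kappa> 1 {a, c} \<beta> A3" using half_copy[of "{a, c}"] N abc by auto
    have A1': "half_copy w K \<kappa> 1 {b, a} \<beta> A1" and A2': "half_copy w K \<kappa> 1 {c, b} \<beta> A2" and A3': "half_copy w K \<kappa> 1 {c, a} \<beta> A3"
      using A1 A2 A3 by (simp_all add: insert_commute)
    have p12: "\<not> excess d (A1 \<union> A2) < d + 3 / 2" and p23: "\<not> excess d (A2 \<union> A3) < d + 3 / 2"
      and p31: "\<not> excess d (A3 \<union> A1) < d + 3 / 2"
      using pair[OF A1 A2] pair[OF A2 A3] pair[OF A3 A1] N by auto
    note q12 = three_halves[OF A1 A2 td p12] and q23 = three_halves[OF A2 A3' td p23]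
      and q31 = three_halves[OF A3' A1 td p31]
    show False
    proof (cases "d = 3 / 2")
      \<comment> \<open>The half copies form a ring joined at \<open>a\<close>, \<open>b\<close>,
        \<open>c\<close>. The third shares two vertices with the first two, which brings the excess
        down to 3, below \<open>d + 3 / 2\<close>.\<close>
      case False
      then have u: "A1 \<inter> A2 = {}" "\<Union>A1 \<inter> \<Union>A2 = {b}" "A2 \<inter> A3 = {}" "\<Union>A2 \<inter> \<Union>A3 = {c}"
        "A3 \<inter> A1 = {}" "\<Union>A1 \<inter> \<Union>A3 = {a}" using q12 q23 q31 by auto
      have "(A1 \<union> A2) \<inter> A3 = {}" using u by blast
      then have i: "card ((A1 \<union> A2) \<inter> A3) \<le> 0" by simp
      have "excess d (A1 \<union> A2 \<union> A3) \<le> excess d (A1 \<union> A2) + (d + 1) - (d * real (2::nat) - real (0::nat))"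
        by (rule three_disjoint[OF A1 A2 A3 u(6,4) _ i]) (use abc in auto)
      also have "excess d (A1 \<union> A2) = 2 * (d + 1) - d" using half_copy_union_excess[OF A1 A2] u by simp
      finally have "excess d (A1 \<union> A2 \<union> A3) < d + 3 / 2" using False td by simp
      then show False using triple[OF A1 A2 A3] N by auto
    next
      case True
      note reg3 = reg[OF True]
      have fst: "finite (star x K)" for x using fK by (simp add: star_def)
      obtain B1 where B1: "half_copy w K \<kappa> 1 {a, b} (\<not> \<beta>) B1" using half_copy[of "{a, b}"] N abc by auto
      obtain B2 where B2: "half_copy w K \<kappa> 1 {b, c} (\<not> \<beta>) B2" using half_copy[of "{b, c}"] N abc by auto
      have wN: "w \<notin> ?N" using star_nbrs(2)[OF K2] .
      have wK: "{w, x} \<in> K" if "x \<in> ?N" for x using that by (simp add: nbrs_def)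
      have blue: "\<exists>f. f \<in> K - star w K \<and> x \<in> f \<and> \<kappa> f = (\<not> \<beta>)" if "x \<in> ?N" for x
      proof -
        have "x \<in> \<Union>B1 \<or> x \<in> \<Union>B2" using that B1 B2 unfolding N half_copy_def by blast
        then show ?thesis using B1 B2 unfolding half_copy_def by blast
      qed
      \<comment> \<open>The edges at a neighbour \<open>x\<close> of \<open>w\<close> number three:
        \<open>{w, x}\<close>, one of colour \<open>\<not> \<beta>\<close> from a half copy of that
        colour, and hence at most one of colour \<open>\<beta>\<close>.\<close>
      have uniq: "f = f'" if "x \<in> ?N" "f \<in> K - star w K" "f' \<in> K - star w K" "x \<in> f" "x \<in> f'" "\<kappa> f = \<beta>" "\<kappa> f' = \<beta>" for x f f'
      proof (rule ccontr)
        assume neq: "f \<noteq> f'"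
        obtain g where g: "g \<in> K - star w K" "x \<in> g" "\<kappa> g = (\<not> \<beta>)" using blue[OF \<open>x \<in> ?N\<close>] by blast
        have "{f, f', g, {w, x}} \<subseteq> star x K" using that g wK[OF that(1)] by (auto simp: star_def)
        then have "card {f, f', g, {w, x}} \<le> card (star x K)" using fst card_mono by blast
        moreover have "card {f, f', g, {w, x}} = 4"
          using neq that g by (auto simp: card_insert_if star_def)
        moreover have "x \<in> \<Union>K" using that by auto
        ultimately show False using reg3 by auto
      qed
      \<comment> \<open>The third neighbour would have at most one edge in the copy, but all degrees
        in a copy are at least 2.\<close>
      have avoid: "u \<notin> \<Union>A" if h: "half_copy w K \<kappa> 1 S \<beta> A" and u: "u \<in> ?N" "u \<notin> S" for A S u
      proof
        assume uA: "u \<in> \<Union>A"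
        let ?P = "A \<union> (\<lambda>y. {w, y}) ` S"
        have P: "?P \<in> C" "u \<in> \<Union>?P" using h uA by (auto simp: half_copy_def)
        have "star u ?P \<subseteq> star u A" using u wN by (auto simp: star_def)
        moreover have "f = f'" if "f \<in> star u A" "f' \<in> star u A" for f f'
        proof -
          have "f \<in> A" "f' \<in> A" "u \<in> f" "u \<in> f'" using that by (auto simp: star_def)
          then show ?thesis using h by (intro uniq[OF u(1)]) (auto simp: half_copy_def)
        qed
        ultimately have "card (star u ?P) \<le> 1"
          by (metis (no_types, lifting) One_nat_def card.infinite card_le_Suc0_iff_eq le0 subset_iff)
        then show False using deg P by (metis not_le)
      qed
      have common: "\<exists>f. f \<in> A \<inter> A' \<and> x \<in> f" if "half_copy w K \<kappa> 1 S \<beta> A" "half_copy w K \<kappa> 1 S' \<beta> A'" "x \<in> S" "x \<in> S'" "x \<in> ?N" for A A' S S' x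
      proof -
        have "x \<in> \<Union>A" "x \<in> \<Union>A'" using that unfolding half_copy_def by blast+
        then obtain f f' where ff: "f \<in> A" "x \<in> f" "f' \<in> A'" "x \<in> f'" by blast
        then have "f = f'" using that unfolding half_copy_def by (intro uniq[OF that(5)]) blast+
        then show ?thesis using ff by auto
      qed
      have sing: "\<exists>r. A \<inter> A' = {r} \<and> \<Union>A \<inter> \<Union>A' = r \<and> x \<in> r \<and> r \<inter> ?N = {x} \<and> r \<in> K - star w K \<and> \<kappa> r = \<beta>"
        if h: "half_copy w K \<kappa> 1 {x, y} \<beta> A" "half_copy w K \<kappa> 1 {x, z} \<beta> A'" "?N = {x, y, z}" "y \<noteq> x" "z \<noteq> x" "y \<noteq> z"
          and q: "A \<inter> A' = {} \<and> \<Union>A \<inter> \<Union>A' = {x} \<or>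
            (d = 3 / 2 \<and> card (A \<inter> A') = 1 \<and> \<Union>A \<inter> \<Union>A' = \<Union>(A \<inter> A'))" for x y z A A'
      proof -
        obtain r where r: "r \<in> A \<inter> A'" "x \<in> r" using common[OF h(1,2)] h(3) by auto
        then have c1: "card (A \<inter> A') = 1" and U: "\<Union>A \<inter> \<Union>A' = \<Union>(A \<inter> A')" using q by auto
        obtain r0 where "A \<inter> A' = {r0}" using c1 card_1_singletonE by blast
        then have AA: "A \<inter> A' = {r}" using r(1) by simp
        then have "\<Union>A \<inter> \<Union>A' = r" unfolding U by simp
        moreover note AA
        moreover have "z \<notin> r" using avoid[OF h(1), of z] h(3-6) r by auto
        moreover have "y \<notin> r" using avoid[OF h(2), of y] h(3-6) r by auto
        moreover have "r \<in> K - star w K \<and> \<kappa> r = \<beta>" using r h(1) by (auto simp: half_copy_def)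
        moreover have "r \<inter> ?N = {x}" using r(2) h(3) \<open>y \<notin> r\<close> \<open>z \<notin> r\<close> by auto
        ultimately show ?thesis using r(2) by (intro exI[of _ r]) simp
      qed
      have N': "?N = {b, a, c}" "?N = {c, b, a}" using N by auto
      obtain ra where ra: "A1 \<inter> A3 = {ra}" "\<Union>A1 \<inter> \<Union>A3 = ra" "a \<in> ra" "ra \<inter> ?N = {a}" "ra \<in> K - star w K" "\<kappa> ra = \<beta>"
        using sing[OF A1 A3 N] q31 abc by (metis Int_commute)
      obtain rb where rb: "A1 \<inter> A2 = {rb}" "\<Union>A1 \<inter> \<Union>A2 = rb" "b \<in> rb" "rb \<inter> ?N = {b}" "rb \<in> K - star w K" "\<kappa> rb = \<beta>"
        using sing[OF A1' A2 N'(1)] q12 abc by metis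
      obtain rc where rc: "A2 \<inter> A3 = {rc}" "\<Union>A2 \<inter> \<Union>A3 = rc" "c \<in> rc" "rc \<inter> ?N = {c}" "rc \<in> K - star w K" "\<kappa> rc = \<beta>"
        using sing[OF A2' A3' N'(2)] q23 abc by metis
      have two: "card ra = 2" "card rb = 2" "card rc = 2" using ra rb rc K2 by auto
      \<comment> \<open>If two joining edges were disjoint, the third half copy would share four
        vertices and at most two edges with the others, and the excess would fall to at most
        \<open>6 - 3 * d = 3 / 2\<close>. So the three joining edges will turn out to have a common
        end \<open>z\<close>.\<close>
      have meet: "r \<inter> r' \<noteq> {}"
        if h: "half_copy w K \<kappa> 1 {x, y} \<beta> X1" "half_copy w K \<kappa> 1 {y, z} \<beta> X2" "half_copy w K \<kappa> 1 {x, z} \<beta> X3"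
          and r: "X1 \<inter> X3 = {r}" "\<Union>X1 \<inter> \<Union>X3 = r" and r': "X2 \<inter> X3 = {r'}" "\<Union>X2 \<inter> \<Union>X3 = r'"
          and r'': "X1 \<inter> X2 = {r''}" "\<Union>X1 \<inter> \<Union>X2 = r''" and c2: "card r = 2" "card r' = 2" "card r'' = 2"
          and NN: "{x, y} \<union> {y, z} = ?N"
        for x y z X1 X2 X3 r r' r''
      proof
        assume dis: "r \<inter> r' = {}"
        have "finite r" "finite r'" using c2 by (metis card.infinite zero_neq_numeral)+
        then have m: "card (r \<union> r') = 4" using dis c2 by (simp add: card_Un_disjoint)
        have "(X1 \<union> X2) \<inter> X3 \<subseteq> {r, r'}" 
        proof
          fix f assume "f \<in> (X1 \<union> X2) \<inter> X3"
          then have "f \<in> X1 \<inter> X3 \<or> f \<in> X2 \<inter> X3" by auto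
          then show "f \<in> {r, r'}" unfolding r r' by auto
        qed
        then have "card ((X1 \<union> X2) \<inter> X3) \<le> card {r, r'}" by (intro card_mono) auto
        also have "\<dots> \<le> 2" by (auto simp: card_insert_if)
        finally have i: "card ((X1 \<union> X2) \<inter> X3) \<le> 2" .
        have "excess d (X1 \<union> X2 \<union> X3) \<le> excess d (X1 \<union> X2) + (d + 1) - (d * real (4::nat) - real (2::nat))"
          by (rule three_disjoint[OF h r(2) r'(2) m i])
        also have "excess d (X1 \<union> X2) = 2 * (d + 1) - (d * 2 - 1)"
          using half_copy_union_excess[OF h(1,2)] r'' c2 by simp
        finally have "excess d (X1 \<union> X2 \<union> X3) < d + 3 / 2" unfolding True by simp
        then show False using triple[OF h(1,2,3)] NN by auto
      qed
      have m1: "ra \<inter> rc \<noteq> {}"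
        by (rule meet[OF A1 A2 A3 ra(1,2) rc(1,2) rb(1,2) two(1,3,2)]) (use N in auto)
      have m2: "rb \<inter> ra \<noteq> {}"
        by (rule meet[OF A2 A3' A1' _ _ _ _ _ _ two(2,1,3)]) (use N ra rb rc in \<open>auto simp: Int_commute\<close>)
      obtain z where z: "z \<in> ra" "z \<in> rc" using m1 by auto
      have za: "z \<noteq> a" "z \<noteq> b" "z \<noteq> c" using z ra(4) rc(4) N abc by auto
      have raE: "ra = {z, a}" using two(1) z(1) ra(3) za by (metis card_2_iff insertE insert_commute singletonD)
      have rcE: "rc = {z, c}" using two(3) z(2) rc(3) za by (metis card_2_iff insertE insert_commute singletonD)
      have "z \<in> rb" using m2 raE rb(4) abc N by auto
      then have rbE: "rb = {z, b}" using two(2) rb(3) za by (metis card_2_iff insertE insert_commute singletonD)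
      have zw: "z \<noteq> w" using raE ra(5) by (auto simp: star_def)
      have cz: "star z K = {{z, a}, {z, b}, {z, c}}"
      proof -
        have "{{z, a}, {z, b}, {z, c}} \<subseteq> star z K" using raE rbE rcE ra(5) rb(5) rc(5) by (auto simp: star_def)
        moreover have "card {{z, a}, {z, b}, {z, c}} = 3" using abc za by (auto simp: card_insert_if doubleton_eq_iff)
        moreover have "card (star z K) = 3" using reg3 raE ra(5) by auto
        ultimately show ?thesis using card_subset_eq[OF fst] by metis
      qed
      obtain fa where fa: "fa \<in> K - star w K" "a \<in> fa" "\<kappa> fa = (\<not> \<beta>)" using blue[of a] N by auto
      have ca: "star a K = {{w, a}, {z, a}, fa}"
      proof -
        have "{{w, a}, {z, a}, fa} \<subseteq> star a K" using raE ra(5) fa wK[of a] N by (auto simp: star_def)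
        moreover have "card {{w, a}, {z, a}, fa} = 3" using fa raE ra(5,6) zw za
          by (auto simp: card_insert_if doubleton_eq_iff star_def)
        moreover have "card (star a K) = 3" using reg3 raE ra(5) by auto
        ultimately show ?thesis using card_subset_eq[OF fst] by metis
      qed
      have cw: "star w K = {{w, a}, {w, b}, {w, c}}" using star_nbrs(1)[OF K2] N by simp
      \<comment> \<open>Every relevant vertex is left with at most one usable edge of the colour in
        question and so lies in no monochromatic copy: in colour \<open>\<beta>\<close> this
        excludes \<open>a\<close> and then \<open>w\<close>, in the other colour \<open>w\<close>
        and \<open>z\<close>. The copy would then be monochromatic under \<open>\<kappa>\<close>
        already.\<close>
      define \<kappa>' where "\<kappa>' f = (if f = {w, c} \<or> f = {z, a} then \<not> \<beta> else if w \<in> f then \<beta> else \<kappa> f)" for f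
      obtain P g where P: "P \<in> C" "P \<subseteq> K" "\<forall>f\<in>P. \<kappa>' f = g" using not_colourableD[OF nc, of \<kappa>'] by auto
      have out: "x \<notin> \<Union>P" if "star x P \<subseteq> {f}" for x f
      proof
        assume "x \<in> \<Union>P"
        then have "1 < card (star x P)" using deg P by blast
        moreover have "card (star x P) \<le> 1" using card_mono[OF _ that] by simp
        ultimately show False by simp
      qed
      have sub: "star x P \<subseteq> star x K" for x using P by (auto simp: star_def)
      have old: "\<kappa> f = g" if "f \<in> P" "w \<notin> \<Union>P" "{z, a} \<notin> P" for f
      proof -
        have "f \<noteq> {w, c}" "f \<noteq> {z, a}" "w \<notin> f" using that by auto
        then have "\<kappa>' f = \<kappa> f" unfolding \<kappa>'_def by presburger
        then show ?thesis using P(3) that(1) by metis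
      qed
      have fin: False if "w \<notin> \<Union>P" "{z, a} \<notin> P"
      proof -
        have "P \<subseteq> K - star w K" using P that by (auto simp: star_def)
        moreover have "\<exists>b. \<forall>f\<in>P. \<kappa> f = b" using old that by metis
        ultimately show False using \<kappa> P(1) by simp
      qed
      have inP: "\<kappa>' f = g" if "f \<in> star x P" for f x using that P by (auto simp: star_def)
      have vals: "\<kappa>' {w, a} = \<beta>" "\<kappa>' {w, b} = \<beta>" "\<kappa>' {w, c} = (\<not> \<beta>)" "\<kappa>' {z, a} = (\<not> \<beta>)" "\<kappa>' fa = (\<not> \<beta>)"
        "\<kappa>' {z, b} = \<beta>" "\<kappa>' {z, c} = \<beta>"
        using abc za zw fa raE rbE rcE ra(6) rb(6) rc(6) wN N by (auto simp: \<kappa>'_def doubleton_eq_iff star_def)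
      show False
      proof (cases "g = \<beta>")
        case g: True
        have "star a P \<subseteq> {{w, a}}" using sub[of a] inP[of _ a] ca vals g by auto
        then have aP: "a \<notin> \<Union>P" by (rule out)
        then have "star w P \<subseteq> {{w, b}}" using sub[of w] inP[of _ w] cw vals g by (auto simp: star_def)
        then have "w \<notin> \<Union>P" by (rule out)
        then show False using fin aP by blast
      next
        case g: False
        have "star w P \<subseteq> {{w, c}}" using sub[of w] inP[of _ w] cw vals g by auto
        then have wP: "w \<notin> \<Union>P" by (rule out)
        have "star z P \<subseteq> {{z, a}}" using sub[of z] inP[of _ z] cz vals g by auto
        then have "z \<notin> \<Union>P" by (rule out)
        then show False using fin wP by blast
      qed
    qed
  qed
  obtain R where R: "?ok True R" using key[of True] by (elim exE)
  obtain B where B: "?ok False B" using key[of False] by (elim exE)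
  have "real 3 * (d + 1) - d \<le> excess d R + excess d B"
    using two_colours_dense[OF K2 sparse, of R w \<kappa> True B] R B ne t by simp
  then show False using R B by simp
qed

section \<open>The triangle\<close>

lemma triangle_param:
  assumes "v = 3" "C \<noteq> {}"
  shows "e = 3" "d = 2"
proof -
  obtain P where P: "P \<in> C" using assms by blast
  have fU: "finite (\<Union>P)" using copy_Union_finite[OF P] .
  have "P \<subseteq> {T. T \<subseteq> \<Union>P \<and> card T = 2}" using copy_edge[OF P] by auto
  then have "card P \<le> card {T. T \<subseteq> \<Union>P \<and> card T = 2}" using fU by (intro card_mono) auto
  also have "\<dots> = 3 choose 2" using n_subsets[OF fU, of 2] copy_verts[OF P] assms by simp
  finally have "e \<le> 3" using copy_card[OF P] by (simp add: choose_two)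
  then show e: "e = 3" using e_ge3 by simp
  show "d = 2" using tight assms e by simp
qed

lemma triangle_copy:
  assumes v: "v = 3" and P: "P \<in> C" and x: "x \<in> \<Union>P"
  obtains y z where "x \<noteq> y" "x \<noteq> z" "y \<noteq> z" "P = {{x, y}, {x, z}, {y, z}}"
proof -
  have e: "e = 3" using triangle_param(1)[OF v] P by auto
  have fU: "finite (\<Union>P)" using copy_Union_finite[OF P] .
  have "card (\<Union>P - {x}) = 2" using x v copy_verts[OF P] fU by simp
  then obtain y z where yz: "\<Union>P - {x} = {y, z}" "y \<noteq> z" by (meson card_2_iff)
  then have U: "\<Union>P = {x, y, z}" and ne: "x \<noteq> y" "x \<noteq> z" using x by auto
  have "P \<subseteq> {{x, y}, {x, z}, {y, z}}"
  proof
    fix f assume f: "f \<in> P"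
    then have "f \<subseteq> {x, y, z}" "card f = 2" using U copy_edge[OF P] by auto
    then obtain s t where "f = {s, t}" "s \<noteq> t" by (meson card_2_iff)
    then show "f \<in> {{x, y}, {x, z}, {y, z}}" using \<open>f \<subseteq> {x, y, z}\<close> by auto
  qed
  moreover have "card {{x, y}, {x, z}, {y, z}} = 3" using ne yz by (auto simp: card_insert_if doubleton_eq_iff)
  ultimately have "P = {{x, y}, {x, z}, {y, z}}"
    using copy_card[OF P] e by (intro card_subset_eq) auto
  then show ?thesis using that ne yz by blast
qed

lemma triangle_deg:
  assumes "v = 3" "P \<in> C" "x \<in> \<Union>P"
  shows "1 < card (star x P)"
proof -
  obtain y z where yz: "x \<noteq> y" "x \<noteq> z" "y \<noteq> z" "P = {{x, y}, {x, z}, {y, z}}"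
    using triangle_copy[OF assms] .
  then have "star x P = {{x, y}, {x, z}}" by (auto simp: star_def)
  then show ?thesis using yz by (simp add: card_insert_if doubleton_eq_iff)
qed

text \<open>A triangle through \<open>w\<close> is an edge between two neighbours together with
  their edges to \<open>w\<close>, so each bipartition of the neighbourhood must be blocked by an
  edge of the right colour inside one class.\<close>

lemma triangle_stuck:
  assumes v: "v = 3" and K2: "\<forall>f\<in>K. card f = 2" and fK: "finite K"
    and \<kappa>: "\<forall>P\<in>C. P \<subseteq> K - star w K \<longrightarrow> \<not> (\<exists>b::bool. \<forall>f\<in>P. \<kappa> f = b)"
    and nc: "\<not> colourable K" and S: "S \<subseteq> nbrs w K"
  shows "(\<exists>x\<in>S. \<exists>y\<in>S. x \<noteq> y \<and> {x, y} \<in> K \<and> \<kappa> {x, y}) \<or>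
    (\<exists>x\<in>nbrs w K - S. \<exists>y\<in>nbrs w K - S. x \<noteq> y \<and> {x, y} \<in> K \<and> \<not> \<kappa> {x, y})"
proof -
  obtain P b' where P: "P \<in> C" "P \<subseteq> K" "w \<in> \<Union>P" "\<And>f. f \<in> P - star w K \<Longrightarrow> \<kappa> f = b'"
    "star w P \<subseteq> (\<lambda>y. {w, y}) ` (if b' = True then S else nbrs w K - S)"
    using recolour_star_stuck[OF K2 fK \<kappa> nc S, of True] by metis
  obtain x y where xy: "w \<noteq> x" "w \<noteq> y" "x \<noteq> y" "P = {{w, x}, {w, y}, {x, y}}"
    using triangle_copy[OF v P(1,3)] .
  have "{w, x} \<in> star w P" "{w, y} \<in> star w P" using xy by (auto simp: star_def)
  then have "{w, x} \<in> (\<lambda>y. {w, y}) ` (if b' = True then S else nbrs w K - S)"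
    "{w, y} \<in> (\<lambda>y. {w, y}) ` (if b' = True then S else nbrs w K - S)" using P(5) by blast+
  then have "x \<in> (if b' = True then S else nbrs w K - S)" "y \<in> (if b' = True then S else nbrs w K - S)"
    using xy(1,2) by (auto simp: doubleton_eq_iff)
  moreover have "{x, y} \<in> K" "\<kappa> {x, y} = b'" using P(2,4) xy by (auto simp: star_def)
  ultimately show ?thesis using xy(3) by (cases b') auto
qed

text \<open>On the complete graph with vertices \<open>w, a, b, c, u\<close> the new colouring is the decomposition into two
  5-cycles.\<close>

lemma triangle_flip:
  assumes v: "v = 3" and K2: "\<forall>f\<in>K. card f = 2"
    and \<kappa>: "\<forall>P\<in>C. P \<subseteq> K - star w K \<longrightarrow> \<not> (\<exists>b::bool. \<forall>f\<in>P. \<kappa> f = b)"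
    and N: "nbrs w K = {a, b, c, u}" and Na: "nbrs a K \<subseteq> {w, b, c, u}"
    and ne: "a \<noteq> b" "a \<noteq> c" "a \<noteq> u" "b \<noteq> c" "b \<noteq> u" "c \<noteq> u"
    and col: "\<kappa> {c, u} = \<beta>" "\<kappa> {a, c} = \<beta>" "\<kappa> {b, u} = \<beta>"
  shows "colourable K"
proof -
  have wN: "w \<noteq> a" "w \<noteq> b" "w \<noteq> c" "w \<noteq> u" using star_nbrs(2)[OF K2, of w] N by auto
  define \<kappa>' where "\<kappa>' f = (if f = {w, c} \<or> f = {w, u} \<or> f = {a, b} then \<not> \<beta> else if w \<in> f then \<beta> else \<kappa> f)" for f
  have "\<not> (\<exists>g. \<forall>f\<in>P. \<kappa>' f = g)" if P: "P \<in> C" "P \<subseteq> K" for P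
  proof
    assume "\<exists>g. \<forall>f\<in>P. \<kappa>' f = g"
    then obtain g where g: "\<forall>f\<in>P. \<kappa>' f = g" by blast
    consider "w \<in> \<Union>P" | "{a, b} \<in> P" "w \<notin> \<Union>P" | "{a, b} \<notin> P" "w \<notin> \<Union>P" by blast
    then show False
    proof cases
      case 1
      obtain x y where xy: "w \<noteq> x" "w \<noteq> y" "x \<noteq> y" "P = {{w, x}, {w, y}, {x, y}}"
        using triangle_copy[OF v P(1) 1] .
      then have "x \<in> nbrs w K" "y \<in> nbrs w K" using P(2) by (auto simp: nbrs_def)
      then have mem: "x = a \<or> x = b \<or> x = c \<or> x = u" "y = a \<or> y = b \<or> y = c \<or> y = u" using N by auto
      have "\<kappa>' {w, x} = g" "\<kappa>' {w, y} = g" "\<kappa>' {x, y} = g" using xy(4) g by auto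
      then show False using mem xy(3) wN ne col
        by (elim disjE) (simp_all add: \<kappa>'_def doubleton_eq_iff insert_commute)
    next
      case 2
      then have aP: "a \<in> \<Union>P" by blast
      obtain x y where xy: "a \<noteq> x" "a \<noteq> y" "x \<noteq> y" "P = {{a, x}, {a, y}, {x, y}}"
        using triangle_copy[OF v P(1) aP] .
      then have "x \<in> nbrs a K" "y \<in> nbrs a K" using P(2) by (auto simp: nbrs_def)
      then have mem: "x = b \<or> x = c \<or> x = u" "y = b \<or> y = c \<or> y = u" using Na 2(2) xy(4) by auto
      have bb: "x = b \<or> y = b" using 2(1) xy ne by (auto simp: doubleton_eq_iff)
      have "\<kappa>' {a, x} = g" "\<kappa>' {a, y} = g" "\<kappa>' {x, y} = g" using xy(4) g by auto
      then show False using mem bb xy(3) wN ne col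
        by (elim disjE) (simp_all add: \<kappa>'_def doubleton_eq_iff insert_commute)
    next
      case 3
      then have "P \<subseteq> K - star w K" using P by (auto simp: star_def)
      moreover have old: "\<kappa> f = g" if "f \<in> P" for f
      proof -
        have "f \<noteq> {w, c}" "f \<noteq> {w, u}" "f \<noteq> {a, b}" "w \<notin> f" using 3 that by auto
        then have "\<kappa>' f = \<kappa> f" unfolding \<kappa>'_def by presburger
        then show ?thesis using g that by metis
      qed
      moreover have "\<exists>b. \<forall>f\<in>P. \<kappa> f = b" using old by (intro exI[of _ g]) simp
      ultimately show False using \<kappa> P(1) by (metis (no_types))
    qed
  qed
  then have "\<forall>P\<in>C. P \<subseteq> K \<longrightarrow> \<not> (\<exists>b. \<forall>f\<in>P. \<kappa>' f = b)" by simp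
  then show ?thesis unfolding colourable_def by (rule exI[of _ "\<kappa>'"])
qed

text \<open>Splitting the four neighbours into two pairs, with either pair in the role of
  \<open>S\<close>, forces both edges of each perfect matching to be present and equally coloured.
  So \<open>w\<close> and its neighbours span a complete graph on five vertices; two of the three
  matchings agree in colour, and \<open>triangle_flip\<close> applies.\<close>

lemma triangle_four_regular:
  assumes v: "v = 3" and K2: "\<forall>f\<in>K. card f = 2" and fK: "finite K"
    and \<kappa>: "\<forall>P\<in>C. P \<subseteq> K - star w K \<longrightarrow> \<not> (\<exists>b::bool. \<forall>f\<in>P. \<kappa> f = b)"
    and t: "card (nbrs w K) = 4" and reg: "\<forall>x\<in>\<Union>K. card (star x K) = 4"
  shows "colourable K"
proof (rule ccontr)
  assume nc: "\<not> colourable K"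
  let ?N = "nbrs w K"
  obtain a b c u where N: "?N = {a, b, c, u}" and ne: "a \<noteq> b" "a \<noteq> c" "a \<noteq> u" "b \<noteq> c" "b \<noteq> u" "c \<noteq> u"
  proof -
    obtain a N1 where a: "?N = insert a N1" "a \<notin> N1" "card N1 = 3"
      using t by (metis card_eq_SucD numeral_eq_Suc pred_numeral_simps(2) pred_numeral_simps(3) semiring_norm(26) semiring_norm(27))
    then obtain b c u where "N1 = {b, c, u}" "b \<noteq> c" "b \<noteq> u" "c \<noteq> u" by (metis card_3_iff)
    then show ?thesis using that[of a b c u] a by auto
  qed
  note st = triangle_stuck[OF v K2 fK \<kappa> nc]
  have pr: "({x, y} \<in> K \<and> \<kappa> {x, y}) \<or> ({z, z'} \<in> K \<and> \<not> \<kappa> {z, z'})"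
    if "{x, y} \<union> {z, z'} = ?N" "{x, y} \<inter> {z, z'} = {}" for x y z z'
  proof -
    have "?N - {x, y} = {z, z'}" using that by blast
    then show ?thesis using st[of "{x, y}"] that by (auto simp: insert_commute)
  qed
  have mt: "{x, y} \<in> K \<and> {z, z'} \<in> K \<and> \<kappa> {x, y} = \<kappa> {z, z'}"
    if "{x, y} \<union> {z, z'} = ?N" "{x, y} \<inter> {z, z'} = {}" for x y z z'
    using pr[OF that] pr[of z z' x y] that by (auto simp: Un_commute Int_commute)
  have m1: "{a, b} \<in> K \<and> {c, u} \<in> K \<and> \<kappa> {a, b} = \<kappa> {c, u}" by (rule mt) (use N ne in auto)
  have m2: "{a, c} \<in> K \<and> {b, u} \<in> K \<and> \<kappa> {a, c} = \<kappa> {b, u}" by (rule mt) (use N ne in auto)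
  have m3: "{a, u} \<in> K \<and> {b, c} \<in> K \<and> \<kappa> {a, u} = \<kappa> {b, c}" by (rule mt) (use N ne in auto)
  have "?N - {a, b, c} = {u}" using N ne by auto
  then have s1: "\<kappa> {a, b} \<or> \<kappa> {b, c} \<or> \<kappa> {a, c}" using st[of "{a, b, c}"] N by (auto simp: insert_commute)
  have "?N - {u} = {a, b, c}" using N ne by auto
  then have s2: "\<not> \<kappa> {a, b} \<or> \<not> \<kappa> {b, c} \<or> \<not> \<kappa> {a, c}" using st[of "{u}"] N by (auto simp: insert_commute)
  \<comment> \<open>By 4-regularity \<open>a\<close> has no further neighbours, so a new colour on
    \<open>{a, b}\<close> affects only triangles within these five vertices.\<close>
  have Na: "nbrs a K = {w, b, c, u}"
  proof -
    have wN: "w \<notin> ?N" by (rule star_nbrs(2)[OF K2])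
    have "{w, a} \<in> K" using N by (auto simp: nbrs_def)
    then have "{w, b, c, u} \<subseteq> nbrs a K" using m1 m2 m3 by (auto simp: nbrs_def insert_commute)
    moreover have "card {w, b, c, u} = 4" using wN N ne by auto
    moreover have "card (nbrs a K) = 4"
      using star_nbrs(3)[OF K2] reg m1 by (metis UnionI insertI1)
    ultimately show ?thesis by (metis card.infinite card_subset_eq zero_neq_numeral)
  qed
  consider "\<kappa> {a, b} = \<kappa> {a, c}" | "\<kappa> {a, b} = \<kappa> {a, u}" | "\<kappa> {a, c} = \<kappa> {a, u}" using s1 s2 m3 by auto
  then show False
  proof cases
    case 1
    have "colourable K"
      by (rule triangle_flip[OF v K2 \<kappa> N _ ne, of "\<kappa> {a, b}"]) (use Na 1 m1 m2 in auto)
    then show False using nc by simp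
  next
    case 2
    have "colourable K"
      by (rule triangle_flip[OF v K2 \<kappa>, of a b u c "\<kappa> {a, b}"]) (use N Na ne 2 m1 m3 in \<open>auto simp: insert_commute\<close>)
    then show False using nc by simp
  next
    case 3
    have "colourable K"
      by (rule triangle_flip[OF v K2 \<kappa>, of a c u b "\<kappa> {a, c}"]) (use N Na ne 3 m2 m3 in \<open>auto simp: insert_commute\<close>)
    then show False using nc by simp
  qed
qed

section \<open>Induction on a vertex of minimum degree\<close>

text \<open>The hypothesis passes to subsets, so the edges at a vertex of minimum degree are removed
  and put back. Only the odd degree \<open>2 * k + 1\<close>, and for triangles the degrees 3 and 4,
  can obstruct this.\<close>

theorem sparse_colourable:
  assumes "finite K" "\<forall>f\<in>K. card f = 2" "\<forall>T. T \<subseteq> K \<longrightarrow> 0 \<le> excess d T"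
  shows "colourable K"
  using assms
proof (induction "card K" arbitrary: K rule: less_induct)
  case less
  note fK = less.prems(1) and K2 = less.prems(2) and sparse = less.prems(3)
  show ?case
  proof (cases "K = {} \<or> C = {}")
    case True
    have "P \<noteq> {}" if "P \<in> C" for P using copy_card[OF that] e_ge3 by auto
    then show ?thesis using True by (auto simp: colourable_def)
  next
    case False
    have dens: "real (card K) \<le> d * real (card (\<Union>K))" using sparse by (auto simp: excess_def)
    obtain w where w: "w \<in> \<Union>K" "real (card (star w K)) \<le> 2 * d"
      "\<And>x. x \<in> \<Union>K \<Longrightarrow> card (star w K) \<le> card (star x K)"
      "real (card (star w K)) = 2 * d \<Longrightarrow> \<forall>x\<in>\<Union>K. card (star x K) = card (star w K)"
      using exists_low_degree[OF fK _ _ dens] K2 False by blast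
    let ?K = "K - star w K"
    have "star w K \<noteq> {}" "star w K \<subseteq> K" using w by (auto simp: star_def)
    then have "card ?K < card K" using fK by (intro psubset_card_mono) auto
    then have "colourable ?K" using less.hyps[of ?K] fK K2 sparse by auto
    then obtain \<kappa> where \<kappa>: "\<forall>P\<in>C. P \<subseteq> K - star w K \<longrightarrow> \<not> (\<exists>b::bool. \<forall>f\<in>P. \<kappa> f = b)"
      unfolding colourable_def by blast
    have tN: "card (nbrs w K) = card (star w K)" using star_nbrs(3)[OF K2] .
    show ?thesis
    proof (cases "v = 3")
      case True
      have d2: "d = 2" using triangle_param(2)[OF True] False by blast
      have deg: "\<forall>P\<in>C. \<forall>x\<in>\<Union>P. 1 < card (star x P)" using triangle_deg[OF True] by blast
      consider "card (star w K) \<le> 2 * 1" | "card (star w K) = 3" | "card (star w K) = 4"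
        using w(2) d2 by linarith
      then show ?thesis
      proof cases
        case 1
        then show ?thesis using colourable_of_low_degree[OF K2 fK \<kappa> deg] by simp
      next
        case 2
        then obtain a b c where N: "nbrs w K = {a, b, c}" "a \<noteq> b" "a \<noteq> c" "b \<noteq> c"
          using tN by (metis card_3_iff)
        show ?thesis
        proof (rule ccontr)
          assume nc: "\<not> colourable K"
          note st = triangle_stuck[OF True K2 fK \<kappa> nc]
          have "nbrs w K - {a, b} = {c}" using N by auto
          then have "\<kappa> {a, b}" using st[of "{a, b}"] N by (auto simp: insert_commute)
          moreover have "nbrs w K - {c} = {a, b}" using N by auto
          then have "\<not> \<kappa> {a, b}" using st[of "{c}"] N by (auto simp: insert_commute)
          ultimately show False by simp
        qed
      next
        case 3
        then show ?thesis using triangle_four_regular[OF True K2 fK \<kappa>] w(4) d2 tN by simp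
      qed
    next
      case v4: False
      \<comment> \<open>Copies have degree above \<open>d\<close>, hence above \<open>k\<close>,
        while \<open>2 * d < 2 * k + 2\<close> bounds the degree of \<open>w\<close> by
        \<open>2 * k + 1\<close>.\<close>
      define k where "k = nat \<lfloor>d\<rfloor>"
      have k: "real k \<le> d" "d < real k + 1" "1 \<le> k"
        using d_gt1 by (auto simp: k_def le_nat_iff)
      have deg: "\<forall>P\<in>C. \<forall>x\<in>\<Union>P. k < card (star x P)"
      proof (intro ballI)
        fix P x assume "P \<in> C" "x \<in> \<Union>P"
        then have "d < real (card (star x P))" using copy_degree_gt v4 v_ge3 by simp
        then show "k < card (star x P)" using k(1) by linarith
      qed
      have "card (star w K) \<le> 2 * k + 1" using w(2) k(2) by linarith
      then consider "card (star w K) \<le> 2 * k" | "card (star w K) = 2 * k + 1" by linarith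
      then show ?thesis
      proof cases
        case 1
        then show ?thesis using colourable_of_low_degree[OF K2 fK \<kappa> deg] by simp
      next
        case 2
        then have td: "real (2 * k + 1) \<le> 2 * d" using w(2) by simp
        show ?thesis
        proof (rule ccontr)
          assume nc: "\<not> colourable K"
          show False
          proof (cases "2 \<le> k")
            case True
            then show False using no_stuck_vertex_ge2[OF K2 fK sparse \<kappa> nc True deg _ td] tN 2 by simp
          next
            case False
            then have k1: "k = 1" using k(3) by simp
            have reg: "\<forall>x\<in>\<Union>K. card (star x K) = 3" if "d = 3 / 2"
              using w(4) 2 k1 that by simp
            show False
              using no_stuck_vertex_eq1[OF K2 fK sparse \<kappa> nc _ _ _ reg] deg tN 2 td k1 by simp
          qed
        qed
      qed
    qed
  qed
qed

section \<open>Growth of non-colourable graphs\<close>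

text \<open>In an edge-minimal non-colourable graph every edge is the whole intersection of two
  copies (\<open>critical_closed\<close>). An open edge lacks such a pair so far, so a further copy
  through it is still to come.\<close>

definition open_edges :: "'b set set \<Rightarrow> 'b set set" where
  "open_edges K = {g \<in> K. \<not> (\<exists>P\<in>C. \<exists>Q\<in>C. P \<subseteq> K \<and> Q \<subseteq> K \<and> P \<inter> Q = {g})}"

definition pendant :: "'b set set \<Rightarrow> 'b set set \<Rightarrow> 'b set \<Rightarrow> bool" where
  "pendant K P g \<longleftrightarrow> P \<in> C \<and> P \<subseteq> K \<and> g \<in> P \<and> \<Union>(K - P) \<inter> \<Union>P \<subseteq> g"

definition pendants :: "'b set set \<Rightarrow> 'b set set set" where
  "pendants K = {P. \<exists>g. pendant K P g}"

text \<open>An open edge on a pendant copy is accounted for by that copy; the remaining ones enter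
  the potential separately.\<close>

definition exposed :: "'b set set \<Rightarrow> 'b set set" where
  "exposed K = {g \<in> open_edges K. \<forall>P\<in>pendants K. g \<notin> P}"

text \<open>Preferring exposed edges is what makes the potential argument for \<open>reach_potential\<close> work.\<close>

definition pick :: "'b set set \<Rightarrow> 'b set" where
  "pick K = (SOME g. g \<in> (if exposed K \<noteq> {} then exposed K else open_edges K))"

definition regular :: "'b set set \<Rightarrow> 'b set set \<Rightarrow> 'b set \<Rightarrow> bool" where
  "regular K P g \<longleftrightarrow> P \<in> C \<and> g \<in> P \<inter> K \<and> \<Union>P \<inter> \<Union>K = g"

text \<open>Together with \<open>regular\<close>, this exhausts the copies that share an edge with
  \<open>K\<close> without lying in it.\<close>

definition degenerate :: "'b set set \<Rightarrow> 'b set set \<Rightarrow> bool" where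
  "degenerate K P \<longleftrightarrow> P \<in> C \<and> P \<inter> K \<noteq> {} \<and> \<not> P \<subseteq> K \<and> (\<forall>g\<in>P \<inter> K. \<Union>P \<inter> \<Union>K \<noteq> g)"

lemma pick_exposed: "exposed K \<noteq> {} \<Longrightarrow> pick K \<in> exposed K"
  unfolding pick_def by (simp add: some_in_eq)

lemma pick_open: "open_edges K \<noteq> {} \<Longrightarrow> pick K \<in> open_edges K"
proof (cases "exposed K = {}")
  case True
  then show "open_edges K \<noteq> {} \<Longrightarrow> pick K \<in> open_edges K" unfolding pick_def by (simp add: some_in_eq)
next
  case False
  then show "pick K \<in> open_edges K" using pick_exposed[OF False] by (simp add: exposed_def)
qed

section \<open>How pendant copies arise and disappear\<close>

text \<open>Cut \<open>P'\<close> into its part \<open>A\<close> inside \<open>P\<close>, without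
  \<open>g\<close>, and the rest \<open>B\<close>; the two can meet only in the ends of
  \<open>g\<close>. Both have excess at least \<open>2 * d - 1\<close>, and the total exceeds that
  of a copy by at most \<open>2 * d\<close>. This is so tight that \<open>A\<close> with
  \<open>g\<close> must be all of \<open>P\<close> and \<open>B\<close> must be
  \<open>{g}\<close>.\<close>

lemma pendant_unique:
  assumes pen: "pendant K P g" and P': "P' \<in> C" "P' \<subseteq> K"
  shows "P' = P \<or> P' \<inter> P \<subseteq> {g}"
proof (rule ccontr)
  assume n: "\<not> ?thesis"
  define A where "A = P' \<inter> P - {g}"
  define B where "B = P' - A"
  have P: "P \<in> C" "g \<in> P" using pen by (auto simp: pendant_def)
  have g2: "card g = 2" using copy_edge P by auto
  then have fg: "finite g" by (metis card.infinite zero_neq_numeral)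
  have fin: "finite P'" "finite (\<Union>P')" "finite P" "finite (\<Union>P)"
    using copy_finite copy_Union_finite P P' by auto
  have A0: "A \<noteq> {}" using n by (auto simp: A_def)
  have B0: "B \<noteq> {}"
  proof
    assume "B = {}"
    then have "P' \<subseteq> P" by (auto simp: A_def B_def)
    then show False using n card_subset_eq[OF fin(3)] copy_card P P' by auto
  qed
  have AB: "A \<union> B = P'" "A \<inter> B = {}" "A \<subseteq> P'" "B \<subseteq> P'" by (auto simp: A_def B_def)
  have fAB: "finite A" "finite B" "finite (\<Union>A)" "finite (\<Union>B)"
    using AB fin by (auto intro: finite_subset[OF _ fin(1)] finite_subset[OF _ fin(2)])
  have meet: "\<Union>A \<inter> \<Union>B \<subseteq> g"
  proof
    fix x assume "x \<in> \<Union>A \<inter> \<Union>B"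
    then obtain f where f: "f \<in> B" "x \<in> f" and xP: "x \<in> \<Union>P" by (auto simp: A_def)
    show "x \<in> g"
    proof (cases "f = g")
      case False
      then have "f \<in> K - P" using f P' by (auto simp: A_def B_def)
      then show ?thesis using f xP pen by (auto simp: pendant_def)
    qed (use f in auto)
  qed
  have ex: "2 * d - 1 = excess d A + excess d B - d * real (card (\<Union>A \<inter> \<Union>B))"
    using excess_Un[OF fAB, of d] AB excess_copy[OF P'(1)] by simp
  have eA: "2 * d - 1 \<le> excess d A" and eB: "2 * d - 1 \<le> excess d B"
    using sub_copy_excess[OF P'(1)] AB A0 B0 by auto
  have "card (\<Union>A \<inter> \<Union>B) \<le> 2" using card_mono[OF fg meet] g2 by simp
  moreover have "\<not> card (\<Union>A \<inter> \<Union>B) \<le> 1"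
  proof
    assume "card (\<Union>A \<inter> \<Union>B) \<le> 1"
    then have "d * real (card (\<Union>A \<inter> \<Union>B)) \<le> d * 1" using d_gt1 by (intro mult_left_mono) auto
    then have "d * real (card (\<Union>A \<inter> \<Union>B)) \<le> d" by (simp only: mult_1_right)
    then show False using ex eA eB d_gt1 by linarith
  qed
  ultimately have c2: "card (\<Union>A \<inter> \<Union>B) = 2" by simp
  then have gm: "\<Union>A \<inter> \<Union>B = g" using card_subset_eq[OF fg meet] g2 by simp
  have gA: "g \<notin> A" by (simp add: A_def)
  \<comment> \<open>Both ends of \<open>g\<close> are vertices of \<open>A\<close> already, so
    adding \<open>g\<close> lowers the excess by 1 and leaves no slack in either bound.\<close>
  have "\<Union>(insert g A) = \<Union>A" using gm by auto
  then have eiA: "excess d (insert g A) = excess d A - 1" using gA fAB by (simp add: excess_def)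
  have "insert g A \<subseteq> P" using P by (auto simp: A_def)
  then have "2 * d - 1 \<le> excess d (insert g A)" using sub_copy_excess[OF P(1)] by auto
  then have eqs: "excess d (insert g A) = 2 * d - 1" "excess d B = 2 * d - 1" using ex eA eB c2 eiA by auto
  have "card A \<noteq> 0" using A0 fAB by simp
  then have "card (insert g A) \<noteq> 1" using gA fAB by simp
  then have iP: "insert g A = P" using sub_copy_excess_eq[OF P(1) \<open>insert g A \<subseteq> P\<close>] eqs by auto
  have "B \<noteq> P'" using A0 AB by auto
  then have "card B = 1" using sub_copy_excess_eq[OF P'(1) AB(4) B0] eqs by auto
  then obtain b where b: "B = {b}" by (meson card_1_singletonE)
  then have "g \<subseteq> b" using gm by auto
  moreover have "card b = 2" using copy_edge[OF P'(1)] b AB by auto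
  ultimately have "g = b" using g2 by (metis card.infinite card_subset_eq zero_neq_numeral)
  then show False using iP AB b n by auto
qed

lemma pendant_only:
  assumes "pendant K P g" "h \<in> P" "h \<noteq> g" "P' \<in> C" "P' \<subseteq> K" "h \<in> P'"
  shows "P' = P"
  using pendant_unique[OF assms(1,4,5)] assms by auto

lemma open_if_only:
  assumes "\<And>P'. P' \<in> C \<Longrightarrow> P' \<subseteq> K \<Longrightarrow> h \<in> P' \<Longrightarrow> P' = P" "h \<in> K"
  shows "h \<in> open_edges K"
proof -
  have False if "P1 \<in> C" "P2 \<in> C" "P1 \<subseteq> K" "P2 \<subseteq> K" "P1 \<inter> P2 = {h}" for P1 P2
  proof -
    have "P1 = P" "P2 = P" using assms(1)[of P1] assms(1)[of P2] that by auto
    then have "P1 = {h}" using that by auto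
    then show False using copy_card[OF that(1)] e_ge3 by simp
  qed
  then show ?thesis using assms(2) unfolding open_edges_def by blast
qed

lemma copy_third:
  assumes "P \<in> C" obtains f where "f \<in> P" "f \<noteq> g" "f \<noteq> h"
proof -
  have "card {g, h} < card P" using copy_card[OF assms] e_ge3 by (simp add: card_insert_if)
  then have "\<not> P \<subseteq> {g, h}" by (metis card_mono finite.emptyI finite.insertI not_le)
  then show ?thesis using that by auto
qed

text \<open>An edge of a pendant copy other than the attaching one lies in no second copy, so it is
  open.\<close>

lemma closed_no_pendants:
  assumes "open_edges K = {}" shows "pendants K = {}" "exposed K = {}"
proof -
  have False if p: "pendant K P g" for P g
  proof -
    obtain h where h: "h \<in> P" "h \<noteq> g" using copy_third[of P g g] p by (auto simp: pendant_def)
    have "h \<in> open_edges K"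
      by (rule open_if_only[of _ _ P]) (use pendant_only[OF p h] h p in \<open>auto simp: pendant_def\<close>)
    then show False using assms by simp
  qed
  then show "pendants K = {}" by (auto simp: pendants_def)
  show "exposed K = {}" using assms by (auto simp: exposed_def)
qed

lemma finite_pendants: "finite K \<Longrightarrow> finite (pendants K)"
  by (rule finite_subset[of _ "Pow K"]) (auto simp: pendants_def pendant_def)

lemma regular_inter:
  assumes "regular K P g" shows "P \<inter> K = {g}"
proof -
  have P: "P \<in> C" "g \<in> P" "g \<in> K" "\<Union>P \<inter> \<Union>K = g" using assms by (auto simp: regular_def)
  have "f = g" if "f \<in> P \<inter> K" for f
  proof -
    have "f \<subseteq> g" using that P(4) by auto
    moreover have "card f = 2" "card g = 2" using copy_edge[OF P(1)] that P by auto
    moreover have "finite g" using calculation(3) by (metis card.infinite zero_neq_numeral)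
    ultimately show ?thesis using card_subset_eq[of g f] by simp
  qed
  then have "P \<inter> K \<subseteq> {g}" by blast
  moreover have "g \<in> P \<inter> K" using P(2,3) by simp
  ultimately show ?thesis by blast
qed

lemma regular_pendant:
  assumes "regular K P g" shows "pendant (K \<union> P) P g"
  using assms by (auto simp: regular_def pendant_def)

text \<open>\<open>P\<close> touches \<open>K\<close> only in \<open>g\<close>, so it can spoil the
  pendant copy \<open>Q\<close> only by sitting on an edge of \<open>Q\<close> other than its
  attaching edge.\<close>

lemma regular_preserve:
  assumes "regular K P g" "pendant K Q h" "g \<notin> Q \<or> g = h"
  shows "pendant (K \<union> P) Q h"
proof -
  have "x \<in> h" if x: "x \<in> \<Union>(K \<union> P - Q)" "x \<in> \<Union>Q" for x
  proof (cases "x \<in> \<Union>(K - Q)")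
    case True
    then show ?thesis using x assms(2) by (auto simp: pendant_def)
  next
    case False
    then have "x \<in> \<Union>P" using x by auto
    moreover have "x \<in> \<Union>K" using x assms(2) by (auto simp: pendant_def)
    ultimately have xg: "x \<in> g" using assms(1) by (auto simp: regular_def)
    moreover have "g \<in> K" using assms(1) by (auto simp: regular_def)
    ultimately have "g \<in> Q" using False by auto
    then show ?thesis using assms(3) xg by auto
  qed
  then show ?thesis using assms(2) unfolding pendant_def by auto
qed

text \<open>The new copy is itself pendant and destroys at most one pendant copy, because two of
  them cannot share \<open>g\<close> away from their attaching edges. If it destroys
  \<open>Q\<close>, then an edge of \<open>Q\<close> other than \<open>g\<close> and the attaching
  edge still lies in no other copy and becomes exposed.\<close>

lemma regular_step:
  assumes fK: "finite K" and reg: "regular K P g"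
  shows "card (pendants K) + 1 \<le> card (pendants (K \<union> P)) \<or>
    (card (pendants K) \<le> card (pendants (K \<union> P)) \<and> exposed (K \<union> P) \<noteq> {} \<and> (\<exists>Q\<in>pendants K. g \<in> Q))"
proof -
  have PC: "P \<in> C" using reg by (simp add: regular_def)
  have fKP: "finite (K \<union> P)" using fK copy_finite[OF PC] by simp
  define L where "L = {Q \<in> pendants K. Q \<notin> pendants (K \<union> P)}"
  have pP: "P \<in> pendants (K \<union> P)" using regular_pendant[OF reg] by (auto simp: pendants_def)
  have nP: "P \<notin> pendants K"
  proof
    assume "P \<in> pendants K"
    then have "P \<subseteq> K" by (auto simp: pendants_def pendant_def)
    then have "P = {g}" using regular_inter[OF reg] by auto
    then show False using copy_card[OF PC] e_ge3 by simp
  qed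
  have Lg: "g \<in> Q" "g \<noteq> h" if "Q \<in> L" "pendant K Q h" for Q h
    using regular_preserve[OF reg that(2)] that(1) by (auto simp: L_def pendants_def)
  have L1: "Q = Q'" if "Q \<in> L" "Q' \<in> L" for Q Q'
  proof -
    obtain h where h: "pendant K Q h" using \<open>Q \<in> L\<close> by (auto simp: L_def pendants_def)
    obtain h' where h': "pendant K Q' h'" using \<open>Q' \<in> L\<close> by (auto simp: L_def pendants_def)
    then have "Q' = Q \<or> Q' \<inter> Q \<subseteq> {h}" using pendant_unique[OF h] by (auto simp: pendant_def)
    then show ?thesis using Lg[OF that(1) h] Lg[OF that(2) h'] by auto
  qed
  have sub: "insert P (pendants K - L) \<subseteq> pendants (K \<union> P)" using pP by (auto simp: L_def)
  have fp: "finite (pendants K)" using finite_pendants[OF fK] .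
  have "card (insert P (pendants K - L)) \<le> card (pendants (K \<union> P))"
    using finite_pendants[OF fKP] sub by (rule card_mono)
  then have le: "card (pendants K - L) + 1 \<le> card (pendants (K \<union> P))" using fp nP by simp
  show ?thesis
  proof (cases "L = {}")
    case True then show ?thesis using le by simp
  next
    case False
    then obtain Q where Q: "Q \<in> L" by blast
    then have "L = {Q}" using L1 by blast
    moreover have "Q \<in> pendants K" using Q by (simp add: L_def)
    then have "card (pendants K - {Q}) + 1 = card (pendants K)"
      using fp by (metis Suc_eq_plus1 card_Suc_Diff1)
    ultimately have cle: "card (pendants K) \<le> card (pendants (K \<union> P))" using le by simp
    obtain h where h: "pendant K Q h" using \<open>Q \<in> L\<close> unfolding L_def pendants_def by blast
    have QC: "Q \<in> C" "Q \<subseteq> K" using h by (auto simp: pendant_def)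
    obtain f where f: "f \<in> Q" "f \<noteq> g" "f \<noteq> h" using copy_third[OF QC(1)] by metis
    have only: "P' = Q" if P': "P' \<in> C" "P' \<subseteq> K \<union> P" "f \<in> P'" for P'
    proof -
      have "P' \<noteq> P" using regular_inter[OF reg] f P' QC by auto
      then have "P' \<inter> P \<subseteq> {g}" using pendant_unique[OF regular_pendant[OF reg] P'(1,2)] by simp
      moreover have "g \<in> K" using reg by (simp add: regular_def)
      ultimately have "P' \<subseteq> K" using P'(2) by auto
      then show ?thesis using pendant_only[OF h f(1,3) P'(1) _ P'(3)] by simp
    qed
    have "f \<in> open_edges (K \<union> P)" by (rule open_if_only[of _ _ Q]) (use only f QC in auto)
    moreover have "f \<notin> R" if "R \<in> pendants (K \<union> P)" for R
    proof
      assume "f \<in> R"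
      then have "R = Q" using only that by (auto simp: pendants_def pendant_def)
      then show False using that Q by (simp add: L_def)
    qed
    ultimately have "exposed (K \<union> P) \<noteq> {}" by (auto simp: exposed_def)
    moreover have "\<exists>Q\<in>pendants K. g \<in> Q" using Lg(1)[OF Q h] Q by (auto simp: L_def)
    ultimately show ?thesis using cle by simp
  qed
qed

text \<open>Each destroyed pendant copy has a vertex in \<open>P\<close> away from its attaching
  edge, and no other pendant copy contains that vertex.\<close>

lemma pendants_loss:
  assumes fK: "finite K" and PC: "P \<in> C"
  shows "card (pendants K) \<le> card (pendants (K \<union> P)) + v"
proof -
  have fKP: "finite (K \<union> P)" using fK copy_finite[OF PC] by simp
  define L where "L = {Q \<in> pendants K. Q \<notin> pendants (K \<union> P)}"
  have fp: "finite (pendants K)" using finite_pendants[OF fK] .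
  have "\<forall>Q\<in>L. \<exists>x. \<exists>h. pendant K Q h \<and> x \<in> \<Union>P \<and> x \<in> \<Union>Q \<and> x \<notin> h"
  proof
    fix Q assume Q: "Q \<in> L"
    then obtain h where h: "pendant K Q h" by (auto simp: L_def pendants_def)
    have "\<not> pendant (K \<union> P) Q h" using Q by (auto simp: L_def pendants_def)
    then obtain x where "x \<in> \<Union>(K \<union> P - Q)" "x \<in> \<Union>Q" "x \<notin> h" using h by (auto simp: pendant_def)
    moreover have "x \<notin> \<Union>(K - Q)" using h calculation by (auto simp: pendant_def)
    ultimately show "\<exists>x. \<exists>h. pendant K Q h \<and> x \<in> \<Union>P \<and> x \<in> \<Union>Q \<and> x \<notin> h" using h by blast
  qed
  then obtain x where x: "\<And>Q. Q \<in> L \<Longrightarrow> \<exists>h. pendant K Q h \<and> x Q \<in> \<Union>P \<and> x Q \<in> \<Union>Q \<and> x Q \<notin> h"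
    by metis
  have "inj_on x L"
  proof (rule inj_onI, rule ccontr)
    fix Q Q' assume Q: "Q \<in> L" "Q' \<in> L" "x Q = x Q'" "Q \<noteq> Q'"
    obtain h where h: "pendant K Q h" "x Q \<in> \<Union>Q" "x Q \<notin> h" using x[OF Q(1)] by blast
    obtain h' where h': "pendant K Q' h'" "x Q \<in> \<Union>Q'" using x[OF Q(2)] Q(3) by auto
    have "Q' \<inter> Q \<subseteq> {h}" using pendant_unique[OF h(1), of Q'] h'(1) Q(4) by (auto simp: pendant_def)
    moreover obtain f where f: "f \<in> Q'" "x Q \<in> f" using h'(2) by auto
    have "f \<in> K" using f h'(1) by (auto simp: pendant_def)
    then have "f \<in> Q" using h f(2) by (auto simp: pendant_def)
    ultimately show False using f h(3) by auto
  qed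
  then have "card L \<le> card (\<Union>P)"
    using x copy_Union_finite[OF PC] by (intro card_inj_on_le[of x L]) auto
  then have cL: "card L \<le> v" using copy_verts[OF PC] by simp
  have "pendants K - L \<subseteq> pendants (K \<union> P)" by (auto simp: L_def)
  then have "card (pendants K - L) \<le> card (pendants (K \<union> P))"
    using finite_pendants[OF fKP] by (intro card_mono)
  moreover have "card (pendants K - L) = card (pendants K) - card L"
    using fp by (intro card_Diff_subset) (auto simp: L_def)
  ultimately show ?thesis using cL by linarith
qed

section \<open>Exploration copy by copy\<close>

text \<open>The first number counts the steps, the second one the degenerate steps among them.\<close>

inductive reach :: "'b set set \<Rightarrow> nat \<Rightarrow> nat \<Rightarrow> 'b set set \<Rightarrow> bool" for E where
  reach_edge: "g \<in> E \<Longrightarrow> reach E 0 0 {g}"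
| reach_regular: "reach E i D K \<Longrightarrow> regular K P g \<Longrightarrow> P \<subseteq> E \<Longrightarrow> (open_edges K \<noteq> {} \<longrightarrow> g = pick K)
    \<Longrightarrow> reach E (Suc i) D (K \<union> P)"
| reach_degenerate: "reach E i D K \<Longrightarrow> degenerate K P \<Longrightarrow> P \<subseteq> E \<Longrightarrow> reach E (Suc i) (Suc D) (K \<union> P)"

lemma reach_finite: "reach E i D K \<Longrightarrow> finite K"
  by (induction rule: reach.induct) (auto simp: regular_def degenerate_def copy_finite)

lemma reach_sub: "reach E i D K \<Longrightarrow> K \<subseteq> E"
  by (induction rule: reach.induct) auto

lemma reach_card:
  assumes "reach E i D K" "\<forall>f\<in>E. card f = 2"
  shows "card K \<le> 1 + i * e \<and> card (\<Union>K) \<le> 2 + i * v"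
  using assms
proof (induction rule: reach.induct)
  case (reach_edge g) then show ?case by simp
next
  case (reach_regular i D K P g)
  have PC: "P \<in> C" using reach_regular by (simp add: regular_def)
  have "card (K \<union> P) \<le> card K + card P" by (rule card_Un_le)
  moreover have "card (\<Union>(K \<union> P)) \<le> card (\<Union>K) + card (\<Union>P)" unfolding Union_Un_distrib by (rule card_Un_le)
  ultimately show ?case using copy_card[OF PC] copy_verts[OF PC] reach_regular.IH[OF reach_regular.prems] by simp
next
  case (reach_degenerate i D K P)
  have PC: "P \<in> C" using reach_degenerate by (simp add: degenerate_def)
  have "card (K \<union> P) \<le> card K + card P" by (rule card_Un_le)
  moreover have "card (\<Union>(K \<union> P)) \<le> card (\<Union>K) + card (\<Union>P)" unfolding Union_Un_distrib by (rule card_Un_le)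
  ultimately show ?case using copy_card[OF PC] copy_verts[OF PC] reach_degenerate.IH[OF reach_degenerate.prems] by simp
qed

text \<open>A regular step may leave the number of pendant copies unchanged, but only by attaching to a
  pendant copy, which then contains an exposed edge; the next regular step must use an exposed
  edge and increases the number.\<close>

lemma reach_potential:
  "reach E i D K \<Longrightarrow> i \<le> 2 * card (pendants K) + (2 * v + 2) * D + (if exposed K \<noteq> {} then 1 else 0)"
proof (induction rule: reach.induct)
  case (reach_edge g) then show ?case by simp
next
  case (reach_regular i D K P g)
  have fK: "finite K" using reach_finite reach_regular by blast
  have "\<not> (\<exists>Q\<in>pendants K. g \<in> Q)" if "exposed K \<noteq> {}"
  proof -
    have "open_edges K \<noteq> {}" using that by (auto simp: exposed_def)
    then have "g \<in> exposed K" using reach_regular pick_exposed[OF that] by simp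
    then show ?thesis by (auto simp: exposed_def)
  qed
  then show ?case using regular_step[OF fK reach_regular(2)] reach_regular.IH by (auto split: if_splits)
next
  \<comment> \<open>A degenerate step may cost \<open>v\<close> pendant copies of weight 2 each and
    the exposed edge; with the step itself this makes \<open>2 * v + 2\<close>.\<close>
  case (reach_degenerate i D K P)
  have fK: "finite K" using reach_finite reach_degenerate by blast
  have "P \<in> C" using reach_degenerate by (simp add: degenerate_def)
  then show ?case using pendants_loss[OF fK] reach_degenerate.IH by (fastforce split: if_splits)
qed

text \<open>When nothing is open, the potential retains neither pendant copies nor an exposed edge,
  only the degenerate steps.\<close>

lemma reach_closed:
  assumes "reach E i D K" "open_edges K = {}" shows "i \<le> (2 * v + 2) * D"
  using reach_potential[OF assms(1)] closed_no_pendants[OF assms(2)] by simp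

section \<open>Edge-minimal non-colourable graphs\<close>

text \<open>A good colouring of \<open>K - {g}\<close> fails for either colour of \<open>g\<close>.
  The two monochromatic copies through \<open>g\<close> have different colours elsewhere and so
  share only \<open>g\<close>.\<close>

lemma critical_closed:
  assumes nc: "\<not> colourable K" and crit: "\<And>K'. K' \<subset> K \<Longrightarrow> colourable K'"
  shows "open_edges K = {}"
proof -
  have "\<exists>P\<in>C. \<exists>Q\<in>C. P \<subseteq> K \<and> Q \<subseteq> K \<and> P \<inter> Q = {g}" if g: "g \<in> K" for g
  proof -
    have "K - {g} \<subset> K" using g by auto
    then obtain \<kappa> :: "'b set \<Rightarrow> bool" where \<kappa>: "\<forall>P\<in>C. P \<subseteq> K - {g} \<longrightarrow> \<not> (\<exists>b. \<forall>f\<in>P. \<kappa> f = b)"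
      using crit unfolding colourable_def by metis
    have mono: "\<exists>P\<in>C. P \<subseteq> K \<and> g \<in> P \<and> (\<forall>f\<in>P - {g}. \<kappa> f = b)" for b
    proof -
      obtain P b' where P: "P \<in> C" "P \<subseteq> K" "\<forall>f\<in>P. (\<kappa>(g := b)) f = b'"
        using not_colourableD[OF nc, of "\<kappa>(g := b)"] by auto
      have gP: "g \<in> P"
      proof (rule ccontr)
        assume "g \<notin> P"
        then have "P \<subseteq> K - {g}" using P by auto
        moreover have "\<forall>f\<in>P. \<kappa> f = b'" using P(3) \<open>g \<notin> P\<close> by (metis fun_upd_other)
        ultimately show False using \<kappa> P(1) by metis
      qed
      then have "b' = b" using P(3) by fastforce
      then have "\<forall>f\<in>P - {g}. \<kappa> f = b" using P(3) by (metis DiffE fun_upd_other singletonI)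
      then show ?thesis using P gP by blast
    qed
    obtain P where P: "P \<in> C" "P \<subseteq> K" "g \<in> P" "\<forall>f\<in>P - {g}. \<kappa> f = True" using mono[of True] by blast
    obtain Q where Q: "Q \<in> C" "Q \<subseteq> K" "g \<in> Q" "\<forall>f\<in>Q - {g}. \<kappa> f = False" using mono[of False] by blast
    have "P \<inter> Q = {g}" using P(3,4) Q(3,4) by auto
    then show ?thesis using P Q by blast
  qed
  then show ?thesis by (auto simp: open_edges_def)
qed

text \<open>Otherwise good colourings of \<open>L\<close> and of \<open>K - L\<close> could be put
  together.\<close>

lemma critical_connected:
  assumes nc: "\<not> colourable K" and crit: "\<And>K'. K' \<subset> K \<Longrightarrow> colourable K'"
    and L: "L \<subset> K" "L \<noteq> {}"
  shows "\<exists>P\<in>C. P \<subseteq> K \<and> P \<inter> L \<noteq> {} \<and> \<not> P \<subseteq> L"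
proof (rule ccontr)
  assume no: "\<not> ?thesis"
  have "K - L \<subset> K" using L by auto
  then obtain \<kappa>2 :: "'b set \<Rightarrow> bool" where \<kappa>2: "\<forall>P\<in>C. P \<subseteq> K - L \<longrightarrow> \<not> (\<exists>b. \<forall>f\<in>P. \<kappa>2 f = b)"
    using crit unfolding colourable_def by metis
  obtain \<kappa>1 :: "'b set \<Rightarrow> bool" where \<kappa>1: "\<forall>P\<in>C. P \<subseteq> L \<longrightarrow> \<not> (\<exists>b. \<forall>f\<in>P. \<kappa>1 f = b)"
    using crit[OF L(1)] unfolding colourable_def by metis
  obtain P b where P: "P \<in> C" "P \<subseteq> K" "\<forall>f\<in>P. (if f \<in> L then \<kappa>1 f else \<kappa>2 f) = b"
    using not_colourableD[OF nc, of "\<lambda>f. if f \<in> L then \<kappa>1 f else \<kappa>2 f"] by auto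
  have "P \<inter> L = {} \<or> P \<subseteq> L" using no P by blast
  then show False
  proof
    assume "P \<inter> L = {}"
    then have "P \<subseteq> K - L" "\<forall>f\<in>P. \<kappa>2 f = b" using P by (auto split: if_splits)
    then show False using \<kappa>2 P(1) by metis
  next
    assume PL: "P \<subseteq> L"
    then have "\<forall>f\<in>P. \<kappa>1 f = b" using P(3) by (metis subsetD)
    then show False using \<kappa>1 P(1) PL by metis
  qed
qed

text \<open>If some edge is open, the picked one is the intersection of two copies in
  \<open>K\<close>, not both inside \<open>L\<close>; if none is open,
  \<open>critical_connected\<close> supplies the next copy.\<close>

lemma reach_extend:
  assumes nc: "\<not> colourable K" and crit: "\<And>K'. K' \<subset> K \<Longrightarrow> colourable K'" and KE: "K \<subseteq> E"
    and r: "reach E i D L" and L: "L \<subset> K"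
  shows "\<exists>D' L'. reach E (Suc i) D' L' \<and> L' \<subseteq> K"
proof -
  have L0: "L \<noteq> {}" using r by (induction rule: reach.induct) auto
  have "\<exists>P\<in>C. P \<subseteq> K \<and> P \<inter> L \<noteq> {} \<and> \<not> P \<subseteq> L \<and> (open_edges L \<noteq> {} \<longrightarrow> pick L \<in> P)"
  proof (cases "open_edges L = {}")
    case True
    then show ?thesis using critical_connected[OF nc crit L L0] by auto
  next
    case False
    have p: "pick L \<in> open_edges L" using pick_open[OF False] .
    then have "pick L \<in> K" "pick L \<in> L" using L by (auto simp: open_edges_def)
    then obtain P Q where PQ: "P \<in> C" "Q \<in> C" "P \<subseteq> K" "Q \<subseteq> K" "P \<inter> Q = {pick L}"
      using critical_closed[OF nc crit] unfolding open_edges_def by blast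
    then have "\<not> P \<subseteq> L \<or> \<not> Q \<subseteq> L" using p unfolding open_edges_def by blast
    moreover have "pick L \<in> P" "pick L \<in> Q" using PQ by auto
    ultimately show ?thesis using PQ \<open>pick L \<in> L\<close> by blast
  qed
  then obtain P where P: "P \<in> C" "P \<subseteq> K" "P \<inter> L \<noteq> {}" "\<not> P \<subseteq> L" "open_edges L \<noteq> {} \<longrightarrow> pick L \<in> P" by blast
  show ?thesis
  proof (cases "degenerate L P")
    case True
    then show ?thesis using reach_degenerate[OF r] P KE L by (meson Un_least order_trans psubset_imp_subset)
  next
    case False
    then obtain g where g: "g \<in> P \<inter> L" "\<Union>P \<inter> \<Union>L = g" using P by (auto simp: degenerate_def)
    then have reg: "regular L P g" using P(1) by (auto simp: regular_def)
    have "open_edges L \<noteq> {} \<longrightarrow> g = pick L"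
    proof
      assume "open_edges L \<noteq> {}"
      then have "pick L \<in> P \<inter> L" using pick_open[of L] P(5) by (auto simp: open_edges_def)
      then show "g = pick L" using regular_inter[OF reg] by auto
    qed
    then show ?thesis using reach_regular[OF r reg] P(2) KE L by (meson Un_least order_trans psubset_imp_subset)
  qed
qed

lemma reach_size: "reach E i D K \<Longrightarrow> i < card K"
proof (induction rule: reach.induct)
  case (reach_regular i D K P g)
  have PC: "P \<in> C" using reach_regular(2) by (simp add: regular_def)
  have "\<not> P \<subseteq> K"
  proof
    assume "P \<subseteq> K"
    then have "P = {g}" using regular_inter[OF reach_regular(2)] by blast
    then show False using copy_card[OF PC] e_ge3 by simp
  qed
  then have "K \<subset> K \<union> P" by auto
  then have "card K < card (K \<union> P)" using reach_finite[OF reach_regular(1)] PC copy_finite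
    by (intro psubset_card_mono) auto
  then show ?case using reach_regular.IH by simp
next
  case (reach_degenerate i D K P)
  then have "K \<subset> K \<union> P" "P \<in> C" by (auto simp: degenerate_def)
  then have "card K < card (K \<union> P)" using reach_finite[OF reach_degenerate(1)] copy_finite
    by (intro psubset_card_mono) auto
  then show ?case using reach_degenerate.IH by simp
qed auto

text \<open>All earlier stages lie inside \<open>K\<close> as well, so the hypothesis forbids the
  first stage at which \<open>i\<close> would reach \<open>M\<close> or \<open>D\<close> would reach
  \<open>D0\<close>.\<close>

lemma reach_first:
  assumes "reach E i D K" "0 < M" "0 < D0"
    and "\<And>i D K'. reach E i D K' \<Longrightarrow> K' \<subseteq> K \<Longrightarrow> \<not> (i = M \<and> D < D0 \<or> i \<le> M \<and> D = D0)"
  shows "i < M \<and> D < D0"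
  using assms
proof (induction rule: reach.induct)
  case (reach_edge g) then show ?case by simp
next
  case (reach_regular i D K P g)
  have ih: "i < M \<and> D < D0"
    by (rule reach_regular.IH[OF reach_regular.prems(1,2)]) (rule reach_regular.prems(3), assumption, blast)
  have "reach E (Suc i) D (K \<union> P)" by (rule reach.reach_regular) (use reach_regular in auto)
  then have "\<not> (Suc i = M \<and> D < D0)" using reach_regular.prems(3) by blast
  then show ?case using ih by simp
next
  case (reach_degenerate i D K P)
  have ih: "i < M \<and> D < D0"
    by (rule reach_degenerate.IH[OF reach_degenerate.prems(1,2)]) (rule reach_degenerate.prems(3), assumption, blast)
  have "reach E (Suc i) (Suc D) (K \<union> P)" by (rule reach.reach_degenerate) (use reach_degenerate in auto)
  then have "\<not> (Suc i = M \<and> Suc D < D0 \<or> Suc i \<le> M \<and> Suc D = D0)" using reach_degenerate.prems(3) by blast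
  then show ?case using ih by auto
qed

text \<open>\<open>nb\<close> excludes explorations of length \<open>M\<close> with few degenerate
  steps and those that reach \<open>D0\<close> degenerate steps by then; both are unlikely in a
  random graph. What survives is closed, so the number of its steps is bounded through
  \<open>D0\<close>. The final bound does not involve \<open>M\<close>, which will grow like
  \<open>ln n\<close>.\<close>

theorem growth:
  assumes nc: "\<not> colourable K0" and fK0: "finite K0" and KE: "K0 \<subseteq> E" and E2: "\<forall>f\<in>E. card f = 2"
    and M: "0 < M" and D0: "0 < D0"
    and nb: "\<And>i D K. reach E i D K \<Longrightarrow> K \<subseteq> K0 \<Longrightarrow> \<not> (i = M \<and> D < D0 \<or> i \<le> M \<and> D = D0)"
  shows "\<exists>K\<subseteq>K0. \<not> colourable K \<and> card (\<Union>K) \<le> 2 + (2 * v + 2) * D0 * v"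
proof -
  obtain K where K: "K \<subseteq> K0" "\<not> colourable K" and crit: "\<And>K'. K' \<subset> K \<Longrightarrow> colourable K'"
  proof -
    have "\<exists>K. (K \<subseteq> K0 \<and> \<not> colourable K) \<and> (\<forall>K'. K' \<subseteq> K0 \<and> \<not> colourable K' \<longrightarrow> card K \<le> card K')"
      by (rule ex_has_least_nat[of "\<lambda>K. K \<subseteq> K0 \<and> \<not> colourable K" K0 card]) (use nc in simp)
    then obtain K where K: "K \<subseteq> K0" "\<not> colourable K"
      and least: "\<forall>K'. K' \<subseteq> K0 \<and> \<not> colourable K' \<longrightarrow> card K \<le> card K'" by (elim exE conjE)
    have "colourable K'" if "K' \<subset> K" for K'
    proof -
      have "card K' < card K" using that K fK0 by (meson finite_subset psubset_card_mono)
      then show ?thesis using least that K(1) by (meson leD order_trans psubset_imp_subset)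
    qed
    then show ?thesis using that K by simp
  qed
  have fK: "finite K" using K fK0 finite_subset by blast
  have K0: "K \<noteq> {}"
  proof
    assume "K = {}"
    moreover have "P \<noteq> {}" if "P \<in> C" for P using copy_card[OF that] e_ge3 by auto
    ultimately show False using K(2) by (auto simp: colourable_def)
  qed
  then obtain g where "g \<in> K" by blast
  then have base: "\<exists>D L. reach E 0 D L \<and> L \<subseteq> K" using reach_edge[of g E] K KE by blast
  have bound: "i \<le> card K" if "\<exists>D L. reach E i D L \<and> L \<subseteq> K" for i
    using that reach_size fK card_mono by (metis less_imp_le order_less_le_trans)
  \<comment> \<open>A longest exploration inside \<open>K\<close> is taken; by
    \<open>reach_extend\<close> it can end only with \<open>K\<close> itself.\<close>
  define Q where "Q = (\<lambda>i. \<exists>D L. reach E i D L \<and> L \<subseteq> K)"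
  have Qb: "\<forall>j. Q j \<longrightarrow> j \<le> card K" using bound by (simp add: Q_def)
  have Q0: "Q 0" using base by (simp add: Q_def)
  obtain i where i: "Q i" "\<And>j. Q j \<Longrightarrow> j \<le> i"
    using GreatestI_nat[of Q 0 "card K"] Greatest_le_nat[of Q _ "card K"] Qb Q0 by blast
  obtain D L where L: "reach E i D L" "L \<subseteq> K" using i(1) unfolding Q_def by blast
  have "L = K"
  proof (rule ccontr)
    assume "L \<noteq> K"
    then have "L \<subset> K" using L by auto
    then have "\<exists>D' L'. reach E (Suc i) D' L' \<and> L' \<subseteq> K"
      using reach_extend[OF K(2) crit _ L(1)] K KE by auto
    then have "Q (Suc i)" by (simp add: Q_def)
    then show False using i(2) by fastforce
  qed
  then have r: "reach E i D K" using L by simp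
  have "i < M \<and> D < D0" by (rule reach_first[OF r M D0]) (use nb K in blast)
  moreover have "i \<le> (2 * v + 2) * D" using reach_closed[OF r critical_closed[OF K(2) crit]] by simp
  ultimately have "i \<le> (2 * v + 2) * D0" by (meson less_imp_le_nat mult_le_mono2 order_trans)
  then have "card (\<Union>K) \<le> 2 + (2 * v + 2) * D0 * v"
    using reach_card[OF r E2] by (meson add_left_mono le_trans mult_le_mono1)
  then show ?thesis using K by blast
qed

end

section \<open>The binomial random graph\<close>

abbreviation (input) bg_prob :: "nat \<Rightarrow> real \<Rightarrow> nat ugraph set \<Rightarrow> real" where
  "bg_prob n q A \<equiv> measure_pmf.prob (binomial_graph n q) A"

lemma finite_all_pairs: "finite (all_pairs n)"
  by (rule finite_subset[of _ "Pow {..<n}"]) (auto simp: all_pairs_def)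

lemma card_all_pairs: "card (all_pairs n) \<le> n ^ 2"
proof -
  have "all_pairs n \<subseteq> (\<lambda>(x, y). {x, y}) ` ({..<n} \<times> {..<n})"
  proof
    fix e assume e: "e \<in> all_pairs n"
    then obtain x y where "e = {x, y}" by (auto simp: all_pairs_def card_2_iff)
    then show "e \<in> (\<lambda>(x, y). {x, y}) ` ({..<n} \<times> {..<n})" using e by (auto simp: all_pairs_def)
  qed
  then have "card (all_pairs n) \<le> card ({..<n} \<times> {..<n})" by (rule surj_card_le[rotated]) simp
  then show ?thesis by (simp add: power2_eq_square)
qed

lemma binomial_graph_support:
  assumes "G \<in> set_pmf (binomial_graph n q)" shows "verts G = {..<n}" "edges G \<subseteq> all_pairs n"
  using assms by (auto simp: binomial_graph_def)

lemma finite_set_binomial_graph: "finite (set_pmf (binomial_graph n q))"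
proof (rule finite_subset)
  show "set_pmf (binomial_graph n q) \<subseteq> {{..<n}} \<times> Pow (all_pairs n)"
    using binomial_graph_support by fastforce
qed (simp add: finite_all_pairs)

lemma edges_prob:
  assumes "S \<subseteq> all_pairs n" "0 \<le> q" "q \<le> 1"
  shows "bg_prob n q {G. S \<subseteq> edges G} = q ^ card S"
proof -
  let ?B = "\<lambda>e. if e \<in> S then {True} else UNIV"
  have "(\<lambda>X. ({..<n}, {e \<in> all_pairs n. X e})) -` {G. S \<subseteq> edges G} = Pi (all_pairs n) ?B"
    using assms(1) by (auto simp: Pi_def split: if_splits)
  then have "bg_prob n q {G. S \<subseteq> edges G} =
      measure_pmf.prob (Pi_pmf (all_pairs n) False (\<lambda>_. bernoulli_pmf q)) (Pi (all_pairs n) ?B)"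
    by (simp add: binomial_graph_def)
  also have "\<dots> = (\<Prod>e\<in>all_pairs n. measure_pmf.prob (bernoulli_pmf q) (?B e))"
    by (rule measure_Pi_pmf_Pi[OF finite_all_pairs])
  also have "\<dots> = (\<Prod>e\<in>all_pairs n. if e \<in> S then q else 1)"
    using assms by (intro prod.cong) (auto simp: measure_pmf_single)
  also have "\<dots> = (\<Prod>e\<in>S. q)"
    using assms(1) finite_all_pairs by (subst prod.inter_restrict[symmetric]) (auto simp: Int_absorb1)
  finally show ?thesis by simp
qed

section \<open>First and second moment bounds\<close>

lemma union_prob:
  assumes "finite A" "\<And>a. a \<in> A \<Longrightarrow> S a \<subseteq> all_pairs n" "0 \<le> q" "q \<le> 1"
  shows "bg_prob n q {G. \<exists>a\<in>A. S a \<subseteq> edges G} \<le> (\<Sum>a\<in>A. q ^ card (S a))"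
proof -
  have "{G. \<exists>a\<in>A. S a \<subseteq> edges G} = (\<Union>a\<in>A. {G. S a \<subseteq> edges G})" by auto
  then have "bg_prob n q {G. \<exists>a\<in>A. S a \<subseteq> edges G} \<le> (\<Sum>a\<in>A. bg_prob n q {G. S a \<subseteq> edges G})"
    using measure_pmf.finite_measure_subadditive_finite[OF assms(1), of "\<lambda>a. {G. S a \<subseteq> edges G}"] by simp
  also have "\<dots> = (\<Sum>a\<in>A. q ^ card (S a))" using assms edges_prob by (intro sum.cong) auto
  finally show ?thesis .
qed

lemma bg_prob_mono:
  assumes "\<And>G. verts G = {..<n} \<Longrightarrow> edges G \<subseteq> all_pairs n \<Longrightarrow> G \<in> A \<Longrightarrow> G \<in> B"
  shows "bg_prob n q A \<le> bg_prob n q B"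
  using assms binomial_graph_support
  by (intro measure_pmf.finite_measure_mono_AE) (auto simp: AE_measure_pmf_iff)

text \<open>Chebyshev's inequality: edge-disjoint pairs contribute at most the squared mean to the
  second moment, so the variance is bounded by the pairs that share an edge.\<close>

lemma second_moment_bound:
  assumes fin: "finite A" and S: "\<And>a. a \<in> A \<Longrightarrow> S a \<subseteq> all_pairs n" and q: "0 \<le> q" "q \<le> 1"
    and lam: "0 < \<mu>" "(\<Sum>a\<in>A. q ^ card (S a)) \<le> \<mu>"
  shows "bg_prob n q {G. real (card {a \<in> A. S a \<subseteq> edges G}) > 2 * \<mu>}
    \<le> (\<Sum>a\<in>A. \<Sum>b\<in>{b \<in> A. S a \<inter> S b \<noteq> {}}. q ^ card (S a \<union> S b)) / \<mu>\<^sup>2"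
proof -
  let ?M = "binomial_graph n q"
  let ?E = "measure_pmf.expectation ?M"
  let ?I = "\<lambda>a. indicat_real {G. S a \<subseteq> edges G}"
  define X where "X G = (\<Sum>a\<in>A. ?I a G)" for G :: "nat ugraph"
  define m where "m = (\<Sum>a\<in>A. q ^ card (S a))"
  have int: "integrable ?M f" for f :: "nat ugraph \<Rightarrow> real"
    by (rule integrable_measure_pmf_finite[OF finite_set_binomial_graph])
  have ind: "?E (indicat_real {G. T \<subseteq> edges G}) = q ^ card T" if "T \<subseteq> all_pairs n" for T
    using edges_prob[OF that q] by simp
  have EX: "?E X = m"
    unfolding X_def m_def using S ind by (subst Bochner_Integration.integral_sum[OF int]) (auto intro: sum.cong)
  have X2: "(X G)\<^sup>2 = (\<Sum>a\<in>A. \<Sum>b\<in>A. indicat_real {G. S a \<union> S b \<subseteq> edges G} G)" for G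
    unfolding X_def power2_eq_square sum_product by (intro sum.cong refl) (auto simp: indicator_def)
  have ind2: "bg_prob n q {G. S a \<subseteq> edges G \<and> S b \<subseteq> edges G} = q ^ card (S a \<union> S b)" if "a \<in> A" "b \<in> A" for a b
    using edges_prob[OF _ q, of "S a \<union> S b"] S that by simp
  have "?E (\<lambda>G. (X G)\<^sup>2) = (\<Sum>a\<in>A. \<Sum>b\<in>A. q ^ card (S a \<union> S b))"
    unfolding X2 by (subst Bochner_Integration.integral_sum[OF int])
      (auto intro!: sum.cong simp: Bochner_Integration.integral_sum[OF int] ind2)
  also have "\<dots> \<le> (\<Sum>a\<in>A. (\<Sum>b\<in>{b \<in> A. S a \<inter> S b \<noteq> {}}. q ^ card (S a \<union> S b)) + (\<Sum>b\<in>A. q ^ card (S a) * q ^ card (S b)))"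
  proof (rule sum_mono)
    fix a assume a: "a \<in> A"
    have "(\<Sum>b\<in>A. q ^ card (S a \<union> S b)) = (\<Sum>b\<in>{b \<in> A. S a \<inter> S b \<noteq> {}}. q ^ card (S a \<union> S b))
        + (\<Sum>b\<in>A - {b \<in> A. S a \<inter> S b \<noteq> {}}. q ^ card (S a \<union> S b))"
      using fin by (subst sum.subset_diff[of "{b \<in> A. S a \<inter> S b \<noteq> {}}"]) auto
    moreover have "(\<Sum>b\<in>A - {b \<in> A. S a \<inter> S b \<noteq> {}}. q ^ card (S a \<union> S b))
      = (\<Sum>b\<in>A - {b \<in> A. S a \<inter> S b \<noteq> {}}. q ^ card (S a) * q ^ card (S b))"
    proof (intro sum.cong refl)
      fix b assume "b \<in> A - {b \<in> A. S a \<inter> S b \<noteq> {}}"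
      then show "q ^ card (S a \<union> S b) = q ^ card (S a) * q ^ card (S b)"
        using S a finite_subset[OF S finite_all_pairs] by (subst card_Un_disjoint) (auto simp: power_add)
    qed
    moreover have "\<dots> \<le> (\<Sum>b\<in>A. q ^ card (S a) * q ^ card (S b))"
      using fin q by (intro sum_mono2) auto
    ultimately show "(\<Sum>b\<in>A. q ^ card (S a \<union> S b)) \<le> (\<Sum>b\<in>{b \<in> A. S a \<inter> S b \<noteq> {}}. q ^ card (S a \<union> S b)) + (\<Sum>b\<in>A. q ^ card (S a) * q ^ card (S b))"
      by linarith
  qed
  also have "\<dots> = (\<Sum>a\<in>A. \<Sum>b\<in>{b \<in> A. S a \<inter> S b \<noteq> {}}. q ^ card (S a \<union> S b)) + m\<^sup>2"
    by (simp add: sum.distrib m_def power2_eq_square sum_product)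
  finally have EX2: "?E (\<lambda>G. (X G)\<^sup>2) \<le> (\<Sum>a\<in>A. \<Sum>b\<in>{b \<in> A. S a \<inter> S b \<noteq> {}}. q ^ card (S a \<union> S b)) + m\<^sup>2" .
  have "?E (\<lambda>G. (X G - m)\<^sup>2) = ?E (\<lambda>G. (X G)\<^sup>2 + (m\<^sup>2 - 2 * m * X G))"
    by (intro Bochner_Integration.integral_cong refl) (simp add: power2_eq_square algebra_simps)
  also have "\<dots> = ?E (\<lambda>G. (X G)\<^sup>2) + (m\<^sup>2 - 2 * m * ?E X)"
    by (subst Bochner_Integration.integral_add[OF int int], subst Bochner_Integration.integral_diff[OF int int]) simp
  also have "\<dots> \<le> (\<Sum>a\<in>A. \<Sum>b\<in>{b \<in> A. S a \<inter> S b \<noteq> {}}. q ^ card (S a \<union> S b))"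
    using EX2 unfolding EX by (simp add: power2_eq_square)
  finally have var: "?E (\<lambda>G. (X G - m)\<^sup>2) \<le> (\<Sum>a\<in>A. \<Sum>b\<in>{b \<in> A. S a \<inter> S b \<noteq> {}}. q ^ card (S a \<union> S b))" .
  have Xc: "X G = real (card {a \<in> A. S a \<subseteq> edges G})" for G
  proof -
    have "X G = (\<Sum>a\<in>A. if S a \<subseteq> edges G then 1 else 0)" unfolding X_def by (intro sum.cong) (auto simp: indicator_def)
    also have "\<dots> = (\<Sum>a\<in>{a \<in> A. S a \<subseteq> edges G}. 1)" by (rule sum.inter_filter[OF fin, symmetric])
    finally show ?thesis by simp
  qed
  have "bg_prob n q {G. real (card {a \<in> A. S a \<subseteq> edges G}) > 2 * \<mu>} \<le> bg_prob n q {G \<in> space ?M. \<bar>X G - m\<bar> \<ge> \<mu>}"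
    using lam by (intro measure_pmf.finite_measure_mono) (auto simp: Xc m_def)
  also have "\<dots> \<le> ?E (\<lambda>G. (X G - m)\<^sup>2) / \<mu>\<^sup>2"
    using lam by (intro measure_pmf.second_moment_method int) auto
  also have "\<dots> \<le> (\<Sum>a\<in>A. \<Sum>b\<in>{b \<in> A. S a \<inter> S b \<noteq> {}}. q ^ card (S a \<union> S b)) / \<mu>\<^sup>2"
    using var by (intro divide_right_mono) auto
  finally show ?thesis .
qed

section \<open>Counting embeddings\<close>

abbreviation img :: "('a \<Rightarrow> 'b) \<Rightarrow> 'a set set \<Rightarrow> 'b set set" where
  "img \<psi> S \<equiv> (\<lambda>e. \<psi> ` e) ` S"

text \<open>Extensional functions are used so that an embedding is determined by its values on
  \<open>V\<close> and there are finitely many.\<close>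

definition embeddings :: "nat \<Rightarrow> 'a set \<Rightarrow> ('a \<Rightarrow> nat) set" where
  "embeddings n V = {\<psi> \<in> V \<rightarrow>\<^sub>E {..<n}. inj_on \<psi> V}"

lemma finite_embeddings: "finite V \<Longrightarrow> finite (embeddings n V)"
  by (rule finite_subset[of _ "V \<rightarrow>\<^sub>E {..<n}"]) (auto simp: embeddings_def intro: finite_PiE)

lemma card_embeddings: "finite V \<Longrightarrow> card (embeddings n V) \<le> n ^ card V"
  using card_mono[of "V \<rightarrow>\<^sub>E {..<n}" "embeddings n V"]
  by (auto simp: embeddings_def card_funcsetE finite_PiE)

lemma inj_on_img:
  assumes "inj_on \<psi> V" "\<Union>S \<subseteq> V" shows "inj_on (\<lambda>e. \<psi> ` e) S"
proof (rule inj_onI)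
  fix e e' assume "e \<in> S" "e' \<in> S" "\<psi> ` e = \<psi> ` e'"
  then show "e = e'" using inj_on_image_eq_iff[OF assms(1), of e e'] assms(2) by auto
qed

lemma card_img:
  assumes "inj_on \<psi> V" "\<Union>S \<subseteq> V" shows "card (img \<psi> S) = card S"
  using card_image[OF inj_on_img[OF assms]] .

lemma Union_img: "\<Union>(img \<psi> S) = \<psi> ` \<Union>S"
  by auto

lemma card_img_diff:
  assumes "inj_on \<psi> V" "\<Union>S \<subseteq> V" "finite S"
  shows "card (img \<psi> S - T) = card S - card {f \<in> S. \<psi> ` f \<in> T}"
proof -
  have "img \<psi> S - T = img \<psi> (S - {f \<in> S. \<psi> ` f \<in> T})" by auto
  moreover have "card (img \<psi> (S - {f \<in> S. \<psi> ` f \<in> T})) = card (S - {f \<in> S. \<psi> ` f \<in> T})"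
    using assms by (intro card_img[of \<psi> V]) auto
  ultimately show ?thesis using assms(3) by (simp add: card_Diff_subset)
qed

lemma img_all_pairs:
  assumes "\<psi> \<in> embeddings n V" "\<Union>S \<subseteq> V" "\<And>f. f \<in> S \<Longrightarrow> card f = 2"
  shows "img \<psi> S \<subseteq> all_pairs n"
proof
  fix g assume "g \<in> img \<psi> S"
  then obtain f where f: "f \<in> S" "g = \<psi> ` f" by auto
  then have "f \<subseteq> V" using assms by auto
  then show "g \<in> all_pairs n"
    using f assms card_image[of \<psi> f] unfolding all_pairs_def embeddings_def
    by (auto simp: inj_on_subset PiE_def Pi_def)
qed

text \<open>The weight \<open>x ^ card (img \<psi> S - T)\<close> counts only the edges outside the given set \<open>T\<close>; each
  class of embeddings with the same preimage of \<open>W\<close> is bounded separately.\<close>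

lemma extension_sum:
  fixes x \<beta> :: real
  assumes V: "finite V" and W: "finite W" "1 \<le> card W" and n: "1 \<le> n" and x: "0 \<le> x" and beta: "0 \<le> \<beta>"
    and A: "A \<subseteq> embeddings n V"
    and bound: "\<And>\<psi>. \<psi> \<in> A \<Longrightarrow> real n ^ (card V - card {u \<in> V. \<psi> u \<in> W}) * x ^ card (img \<psi> S - T) \<le> \<beta>"
  shows "(\<Sum>\<psi>\<in>A. x ^ card (img \<psi> S - T)) \<le> 2 ^ card V * real (card W) ^ card V * \<beta>"
proof -
  have fA: "finite A" using A finite_embeddings[OF V] finite_subset by blast
  let ?c = "\<lambda>\<psi>. {u \<in> V. \<psi> u \<in> W}"
  have cls: "(\<Sum>\<psi>\<in>{\<psi> \<in> A. ?c \<psi> = U}. x ^ card (img \<psi> S - T)) \<le> real (card W) ^ card V * \<beta>" if U: "U \<in> Pow V" for U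
  proof -
    let ?A = "{\<psi> \<in> A. ?c \<psi> = U}"
    have fU: "finite U" "U \<subseteq> V" using U V finite_subset by auto
    let ?N = "real n ^ (card V - card U)"
    have "?A \<subseteq> PiE V (\<lambda>v. if v \<in> U then W else {..<n})"
    proof
      fix \<psi> assume p: "\<psi> \<in> ?A"
      then have "\<psi> \<in> V \<rightarrow>\<^sub>E {..<n}" using A by (auto simp: embeddings_def)
      moreover have "\<psi> v \<in> W" if "v \<in> U" for v using p that by auto
      ultimately show "\<psi> \<in> PiE V (\<lambda>v. if v \<in> U then W else {..<n})" by (auto simp: PiE_iff)
    qed
    moreover have "finite (PiE V (\<lambda>v. if v \<in> U then W else {..<n}))" using V W by (intro finite_PiE) auto
    ultimately have "card ?A \<le> card (PiE V (\<lambda>v. if v \<in> U then W else {..<n}))" by (rule card_mono[rotated])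
    also have "\<dots> = (\<Prod>v\<in>V. if v \<in> U then card W else n)"
      using V by (subst card_PiE) (auto intro: prod.cong)
    also have "\<dots> = card W ^ card U * n ^ card (V - U)"
      using V fU by (subst prod.If_cases) (auto simp: Int_absorb1 Diff_eq[symmetric])
    also have "\<dots> = card W ^ card U * n ^ (card V - card U)"
      using fU by (simp add: card_Diff_subset)
    finally have cA: "real (card ?A) \<le> real (card W) ^ card U * ?N"
      by (simp flip: of_nat_mult of_nat_power)
    have "?N * (\<Sum>\<psi>\<in>?A. x ^ card (img \<psi> S - T)) = (\<Sum>\<psi>\<in>?A. ?N * x ^ card (img \<psi> S - T))"
      by (rule sum_distrib_left)
    also have "\<dots> \<le> (\<Sum>\<psi>\<in>?A. \<beta>)" using bound by (intro sum_mono) auto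
    also have "\<dots> = real (card ?A) * \<beta>" by simp
    also have "\<dots> \<le> (real (card W) ^ card U * ?N) * \<beta>" using cA beta by (rule mult_right_mono)
    finally have "?N * (\<Sum>\<psi>\<in>?A. x ^ card (img \<psi> S - T)) \<le> ?N * (real (card W) ^ card U * \<beta>)"
      by (simp add: mult_ac)
    moreover have "0 < ?N" using n by simp
    ultimately have "(\<Sum>\<psi>\<in>?A. x ^ card (img \<psi> S - T)) \<le> real (card W) ^ card U * \<beta>"
      by (simp only: mult_le_cancel_left_pos)
    also have "\<dots> \<le> real (card W) ^ card V * \<beta>"
      using W fU V beta by (intro mult_right_mono power_increasing card_mono) auto
    finally show ?thesis .
  qed
  have "(\<Sum>\<psi>\<in>A. x ^ card (img \<psi> S - T)) = (\<Sum>U\<in>Pow V. \<Sum>\<psi>\<in>{\<psi> \<in> A. ?c \<psi> = U}. x ^ card (img \<psi> S - T))"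
    using fA V by (subst sum.group[where g = ?c]) auto
  also have "\<dots> \<le> (\<Sum>U\<in>Pow V. real (card W) ^ card V * \<beta>)" by (rule sum_mono[OF cls])
  also have "\<dots> = 2 ^ card V * real (card W) ^ card V * \<beta>" using V by (simp add: card_Pow)
  finally show ?thesis .
qed

lemma sum_UN_le:
  fixes g :: "'a \<Rightarrow> real"
  assumes "finite I" "\<And>i. i \<in> I \<Longrightarrow> finite (A i)" "\<And>x. 0 \<le> g x"
  shows "sum g (\<Union>i\<in>I. A i) \<le> (\<Sum>i\<in>I. sum g (A i))"
  using assms(1,2)
proof (induction I rule: finite_induct)
  case (insert i I)
  have "0 \<le> sum g (A i \<inter> (\<Union>j\<in>I. A j))" using assms(3) by (simp add: sum_nonneg)
  moreover have "sum g (A i \<union> (\<Union>j\<in>I. A j)) + sum g (A i \<inter> (\<Union>j\<in>I. A j)) = sum g (A i) + sum g (\<Union>j\<in>I. A j)"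
    using insert by (intro sum.union_inter) auto
  ultimately have "sum g (\<Union>j\<in>insert i I. A j) \<le> sum g (A i) + sum g (\<Union>j\<in>I. A j)" by simp
  then show ?case using insert by force
qed simp

section \<open>The random Ramsey property below the threshold\<close>

lemma power_scale:
  fixes c :: real
  assumes "1 \<le> n"
  shows "real n ^ a * (c * real n powr (- 1 / d)) ^ b = c ^ b * real n powr (real a - real b / d)"
proof -
  have "real n ^ a = real n powr real a" using assms by (simp add: powr_realpow)
  moreover have "(real n powr (- 1 / d)) ^ b = real n powr (- (real b / d))"
    using assms by (simp flip: powr_realpow add: powr_powr mult.commute)
  ultimately show ?thesis by (simp add: power_mult_distrib powr_diff powr_minus divide_inverse mult_ac)
qed

text \<open>Only finitely many values occur. Applied to exponents, this yields one power of
  \<open>n\<close> that serves all overlaps at once.\<close>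

lemma positive_gap:
  fixes h :: "nat \<Rightarrow> nat \<Rightarrow> real"
  shows "\<exists>\<epsilon>>0. \<forall>a\<le>A. \<forall>b\<le>B. 0 < h a b \<longrightarrow> \<epsilon> \<le> h a b"
proof -
  define X where "X = insert 1 {x \<in> (\<lambda>(a, b). h a b) ` ({..A} \<times> {..B}). 0 < x}"
  have "finite X" "X \<noteq> {}" by (auto simp: X_def)
  then have "0 < Min X" by (subst Min_gr_iff) (auto simp: X_def)
  moreover have "Min X \<le> h a b" if "a \<le> A" "b \<le> B" "0 < h a b" for a b
    using \<open>finite X\<close> that by (intro Min_le) (auto simp: X_def)
  ultimately show ?thesis by blast
qed

locale sb_graph =
  fixes S :: "'a set set" and d :: real
  assumes fin_S: "finite S" and edge_S: "f \<in> S \<Longrightarrow> card f = 2"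
    and d_gt: "1 < d" and card_S: "3 \<le> card S"
    and tight_S: "real (card S) - 1 = d * (real (card (\<Union>S)) - 2)"
    and strict_S: "T \<subset> S \<Longrightarrow> 2 \<le> card T \<Longrightarrow> real (card T) - 1 < d * (real (card (\<Union>T)) - 2)"
begin

definition copies :: "nat set set set" where
  "copies = {img \<psi> S |\<psi>. inj_on \<psi> (\<Union>S)}"

lemma fin_V: "finite (\<Union>S)"
  using fin_S edge_S by (metis card.infinite finite_Union zero_neq_numeral)

sublocale sb_family copies d "card S" "card (\<Union>S)"
proof
  show "1 < d" "3 \<le> card S" "real (card S) - 1 = d * (real (card (\<Union>S)) - 2)"
    using d_gt card_S tight_S .
  fix P assume "P \<in> copies"
  then obtain \<psi> where psi: "P = img \<psi> S" "inj_on \<psi> (\<Union>S)" by (auto simp: copies_def)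
  show "finite P" "card P = card S" using psi fin_S by (auto simp: card_img)
  show "card (\<Union>P) = card (\<Union>S)" unfolding psi Union_img by (rule card_image[OF psi(2)])
  show "card f = 2" if f: "f \<in> P" for f
  proof -
    obtain h where h: "h \<in> S" "f = \<psi> ` h" using f psi by auto
    then have "inj_on \<psi> h" using inj_on_subset[OF psi(2)] by auto
    then show ?thesis using h edge_S by (simp add: card_image)
  qed
  fix T assume T: "T \<subset> P" "2 \<le> card T"
  define T' where "T' = {f \<in> S. \<psi> ` f \<in> T}"
  have TT: "T = img \<psi> T'" using T psi by (auto simp: T'_def)
  have sub: "T' \<subseteq> S" "\<Union>T' \<subseteq> \<Union>S" by (auto simp: T'_def)
  have c: "card T = card T'" unfolding TT using psi(2) sub by (intro card_img) auto
  have u: "card (\<Union>T) = card (\<Union>T')" unfolding TT Union_img using inj_on_subset[OF psi(2) sub(2)] by (rule card_image)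
  have "T' \<noteq> S" using T TT psi by auto
  then show "real (card T) - 1 < d * (real (card (\<Union>T)) - 2)"
    using strict_S[of T'] sub T(2) c u by auto
qed

lemma copies_embedding:
  assumes "P \<in> copies" "P \<subseteq> all_pairs n"
  obtains \<psi> where "\<psi> \<in> embeddings n (\<Union>S)" "P = img \<psi> S"
proof -
  obtain \<psi> where psi: "P = img \<psi> S" "inj_on \<psi> (\<Union>S)" using assms(1) by (auto simp: copies_def)
  have "\<psi> u < n" if u: "u \<in> \<Union>S" for u
  proof -
    obtain f where "f \<in> S" "u \<in> f" using u by auto
    then have "\<psi> ` f \<in> all_pairs n" using psi assms(2) by auto
    then show ?thesis using \<open>u \<in> f\<close> by (auto simp: all_pairs_def)
  qed
  moreover have "inj_on (restrict \<psi> (\<Union>S)) (\<Union>S)" using psi(2) by (simp add: inj_on_def)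
  ultimately have "restrict \<psi> (\<Union>S) \<in> embeddings n (\<Union>S)" by (auto simp: embeddings_def)
  moreover have "img (restrict \<psi> (\<Union>S)) S = img \<psi> S"
    by (intro image_cong refl) (auto intro!: image_cong)
  ultimately show ?thesis using that psi(1) by metis
qed

lemma fin_pairs_sub: "K \<subseteq> all_pairs n \<Longrightarrow> finite K"
  using finite_all_pairs finite_subset by blast

lemma preimage_edge:
  assumes "\<psi> \<in> embeddings n (\<Union>S)" "f \<in> S"
  shows "{u \<in> \<Union>S. \<psi> u \<in> \<psi> ` f} = f"
  using assms by (auto simp: embeddings_def dest: inj_onD)

context
  fixes n :: nat and c p :: real
  assumes n1: "1 \<le> n" and c: "0 < c" "c \<le> 1" and p_def: "p = c * real n powr (- 1 / d)"
begin

lemma p_range: "0 \<le> p" "p \<le> 1"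
proof -
  have "real n powr (- 1 / d) \<le> 1" using powr_mono[of "- 1 / d" 0 "real n"] n1 d_gt by simp
  then show "0 \<le> p" "p \<le> 1" using c by (auto simp: p_def mult_le_one)
qed

text \<open>By \<open>tight_S\<close> the powers of \<open>n\<close> in
  \<open>n ^ (card (\<Union>S) - 2) * p ^ (card S - 1)\<close> cancel and
  \<open>c ^ (card S - 1)\<close> is left. One factor \<open>2 ^ card (\<Union>S)\<close> chooses
  the vertices sent to \<open>g\<close>, another their images.\<close>

lemma regular_sum:
  assumes K: "K \<subseteq> all_pairs n" and g: "g \<in> K"
  shows "(\<Sum>K'\<in>{K \<union> P |P. regular K P g \<and> P \<subseteq> all_pairs n}. p ^ card K') \<le> p ^ card K * (4 ^ card (\<Union>S) * c ^ (card S - 1))"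
proof -
  let ?V = "\<Union>S"
  define A where "A = {\<psi> \<in> embeddings n ?V. regular K (img \<psi> S) g}"
  have fA: "finite A" using finite_embeddings[OF fin_V] by (simp add: A_def)
  have sub: "{K \<union> P |P. regular K P g \<and> P \<subseteq> all_pairs n} \<subseteq> (\<lambda>\<psi>. K \<union> img \<psi> S) ` A"
  proof
    fix K' assume "K' \<in> {K \<union> P |P. regular K P g \<and> P \<subseteq> all_pairs n}"
    then obtain P where P: "K' = K \<union> P" "regular K P g" "P \<subseteq> all_pairs n" by auto
    have "P \<in> copies" using P(2) by (simp add: regular_def)
    then obtain \<psi> where "\<psi> \<in> embeddings n ?V" "P = img \<psi> S" by (rule copies_embedding[OF _ P(3)])
    then show "K' \<in> (\<lambda>\<psi>. K \<union> img \<psi> S) ` A" using P by (auto simp: A_def)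
  qed
  have g2: "finite g" "card g = 2" using g K by (auto simp: all_pairs_def intro!: card_ge_0_finite)
  have edge: "card {u \<in> ?V. \<psi> u \<in> g} = 2" "card (img \<psi> S - {g}) = card S - 1" "img \<psi> S - K = img \<psi> S - {g}" if psi: "\<psi> \<in> A" for \<psi>
  proof -
    have r: "regular K (img \<psi> S) g" and emb: "\<psi> \<in> embeddings n ?V" using psi by (auto simp: A_def)
    have "g \<in> img \<psi> S" using r by (simp add: regular_def)
    then obtain f where f: "f \<in> S" "g = \<psi> ` f" by (rule imageE)
    show "card {u \<in> ?V. \<psi> u \<in> g} = 2" using preimage_edge[OF emb f(1)] f edge_S by simp
    have "card (img \<psi> S) = card S" using emb by (intro card_img[of _ ?V]) (auto simp: embeddings_def)
    then show "card (img \<psi> S - {g}) = card S - 1" using f by (simp add: card_Diff_singleton)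
    have "img \<psi> S \<inter> K = {g}" by (rule regular_inter[OF r])
    moreover have "X - K = X - (X \<inter> K)" for X :: "nat set set" by blast
    ultimately show "img \<psi> S - K = img \<psi> S - {g}" by metis
  qed
  have "(\<Sum>K'\<in>{K \<union> P |P. regular K P g \<and> P \<subseteq> all_pairs n}. p ^ card K') \<le> (\<Sum>K'\<in>(\<lambda>\<psi>. K \<union> img \<psi> S) ` A. p ^ card K')"
    using fA sub p_range by (intro sum_mono2) auto
  also have "\<dots> \<le> (\<Sum>\<psi>\<in>A. p ^ card (K \<union> img \<psi> S))"
    using sum_image_le[OF fA, of "\<lambda>K'. p ^ card K'" "\<lambda>\<psi>. K \<union> img \<psi> S"] p_range by (simp add: o_def)
  also have "\<dots> = p ^ card K * (\<Sum>\<psi>\<in>A. p ^ card (img \<psi> S - {g}))"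
  proof -
    have "p ^ card (K \<union> img \<psi> S) = p ^ card K * p ^ card (img \<psi> S - {g})" if "\<psi> \<in> A" for \<psi>
    proof -
      have "card (K \<union> (img \<psi> S - K)) = card K + card (img \<psi> S - K)"
        using fin_pairs_sub[OF K] fin_S by (intro card_Un_disjoint) auto
      then show ?thesis unfolding Un_Diff_cancel unfolding edge(3)[OF that] by (simp only: power_add)
    qed
    then show ?thesis by (simp add: sum_distrib_left)
  qed
  also have "(\<Sum>\<psi>\<in>A. p ^ card (img \<psi> S - {g})) \<le> 2 ^ card ?V * real (card g) ^ card ?V * c ^ (card S - 1)"
  proof (rule extension_sum[OF fin_V g2(1) _ n1])
    show "A \<subseteq> embeddings n ?V" by (auto simp: A_def)
    fix \<psi> assume psi: "\<psi> \<in> A"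
    have v3: "3 \<le> card ?V" by (rule v_ge3)
    have "real (card ?V - 2) = real (card ?V) - 2" "real (card S - 1) = real (card S) - 1"
      using v3 card_S by (simp_all add: of_nat_diff)
    then have "real n ^ (card ?V - 2) * p ^ (card S - 1) = c ^ (card S - 1)"
      unfolding p_def power_scale[OF n1] using tight_S d_gt n1 by simp
    then show "real n ^ (card ?V - card {u \<in> ?V. \<psi> u \<in> g}) * p ^ card (img \<psi> S - {g}) \<le> c ^ (card S - 1)"
      using edge[OF psi] by simp
  qed (use g2 p_range c in auto)
  also have "2 ^ card ?V * real (card g) ^ card ?V = 4 ^ card ?V"
    using g2 by (simp flip: power_mult_distrib)
  finally show ?thesis using p_range by (simp add: mult_left_mono)
qed

text \<open>If the vertices \<open>U\<close> and the edges \<open>I\<close> of \<open>S\<close> land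
  in \<open>K\<close>, the exponent of \<open>n\<close> is
  \<open>- (card U - 2 - (card I - 1) / d)\<close>. It is negative by strictness if \<open>I\<close>
  has two edges or more, and for a single edge because \<open>U\<close> then has a further vertex,
  the attachment not being regular.\<close>

lemma degenerate_sum:
  assumes K: "K \<subseteq> all_pairs n" "K \<noteq> {}" and m: "card (\<Union>K) \<le> m"
    and eps: "\<And>a b. a \<le> card (\<Union>S) \<Longrightarrow> b \<le> card S \<Longrightarrow> 0 < real a - 2 - (real b - 1) / d \<Longrightarrow> \<epsilon> \<le> real a - 2 - (real b - 1) / d"
  shows "(\<Sum>K'\<in>{K \<union> P |P. degenerate K P \<and> P \<subseteq> all_pairs n}. p ^ card K') \<le>
    p ^ card K * (2 ^ card (\<Union>S) * real m ^ card (\<Union>S) * real n powr (- \<epsilon>))"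
proof -
  let ?V = "\<Union>S"
  define A where "A = {\<psi> \<in> embeddings n ?V. degenerate K (img \<psi> S)}"
  have fA: "finite A" using finite_embeddings[OF fin_V] by (simp add: A_def)
  have fK: "finite K" using fin_pairs_sub[OF K(1)] .
  have fUK: "finite (\<Union>K)" using fK K by (auto simp: all_pairs_def intro: finite_subset)
  have sub: "{K \<union> P |P. degenerate K P \<and> P \<subseteq> all_pairs n} \<subseteq> (\<lambda>\<psi>. K \<union> img \<psi> S) ` A"
  proof
    fix K' assume "K' \<in> {K \<union> P |P. degenerate K P \<and> P \<subseteq> all_pairs n}"
    then obtain P where P: "K' = K \<union> P" "degenerate K P" "P \<subseteq> all_pairs n" by auto
    have "P \<in> copies" using P(2) by (simp add: degenerate_def)
    then obtain \<psi> where "\<psi> \<in> embeddings n ?V" "P = img \<psi> S" by (rule copies_embedding[OF _ P(3)])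
    then show "K' \<in> (\<lambda>\<psi>. K \<union> img \<psi> S) ` A" using P by (auto simp: A_def)
  qed
  have "(\<Sum>K'\<in>{K \<union> P |P. degenerate K P \<and> P \<subseteq> all_pairs n}. p ^ card K') \<le> (\<Sum>K'\<in>(\<lambda>\<psi>. K \<union> img \<psi> S) ` A. p ^ card K')"
    using fA sub p_range by (intro sum_mono2) auto
  also have "\<dots> \<le> (\<Sum>\<psi>\<in>A. p ^ card (K \<union> img \<psi> S))"
    using sum_image_le[OF fA, of "\<lambda>K'. p ^ card K'" "\<lambda>\<psi>. K \<union> img \<psi> S"] p_range by (simp add: o_def)
  also have "\<dots> = p ^ card K * (\<Sum>\<psi>\<in>A. p ^ card (img \<psi> S - K))"
  proof -
    have "p ^ card (K \<union> img \<psi> S) = p ^ card K * p ^ card (img \<psi> S - K)" for \<psi>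
    proof -
      have "card (K \<union> (img \<psi> S - K)) = card K + card (img \<psi> S - K)"
        using fK fin_S by (intro card_Un_disjoint) auto
      then show ?thesis by (simp add: power_add)
    qed
    then show ?thesis by (simp add: sum_distrib_left)
  qed
  also have "(\<Sum>\<psi>\<in>A. p ^ card (img \<psi> S - K)) \<le> 2 ^ card ?V * real (card (\<Union>K)) ^ card ?V * real n powr (- \<epsilon>)"
  proof (rule extension_sum[OF fin_V fUK _ n1])
    obtain f where "f \<in> K" using K by auto
    then have "f \<subseteq> \<Union>K" "f \<noteq> {}" using K by (auto simp: all_pairs_def)
    then show "1 \<le> card (\<Union>K)" using fUK by (metis One_nat_def Suc_leI card_gt_0_iff subset_empty)
    show "A \<subseteq> embeddings n ?V" by (auto simp: A_def)
    fix \<psi> assume "\<psi> \<in> A"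
    then have emb: "\<psi> \<in> embeddings n ?V" and dg: "degenerate K (img \<psi> S)" by (auto simp: A_def)
    have inj: "inj_on \<psi> ?V" using emb by (simp add: embeddings_def)
    define I where "I = {f \<in> S. \<psi> ` f \<in> K}"
    define U where "U = {u \<in> ?V. \<psi> u \<in> \<Union>K}"
    have IS: "I \<subseteq> S" "I \<noteq> S" "I \<noteq> {}" using dg by (auto simp: I_def degenerate_def)
    have fI: "finite I" using IS fin_S finite_subset by blast
    have UV: "U \<subseteq> ?V" unfolding U_def by blast
    then have fU: "finite U" "U \<subseteq> ?V" using finite_subset[OF _ fin_V] by auto
    have IU: "\<Union>I \<subseteq> U" by (auto simp: I_def U_def)
    then have cIU: "card (\<Union>I) \<le> card U" using fU by (intro card_mono)
    have ci: "card (img \<psi> S - K) = card S - card I"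
      unfolding I_def by (rule card_img_diff[OF inj _ fin_S]) simp
    have cI: "card I \<le> card S" using IS fin_S card_mono by blast
    have cU: "card U \<le> card ?V" using fU fin_V card_mono by blast
    have pos: "0 < real (card U) - 2 - (real (card I) - 1) / d"
    proof (cases "card I = 1")
      case True
      then obtain f where f: "I = {f}" by (meson card_1_singletonE)
      have fS: "f \<in> S" using f IS by auto
      have "U \<noteq> f"
      proof
        assume "U = f"
        have "\<Union>(img \<psi> S) \<inter> \<Union>K = \<psi> ` U" unfolding Union_img U_def by blast
        then have "\<Union>(img \<psi> S) \<inter> \<Union>K = \<psi> ` f" using \<open>U = f\<close> by simp
        moreover have "\<psi> ` f \<in> img \<psi> S \<inter> K" using f fS by (auto simp: I_def)
        ultimately show False using dg by (auto simp: degenerate_def)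
      qed
      moreover have "f \<subseteq> U" using IU f by auto
      ultimately have "card f < card U" using fU by (intro psubset_card_mono) auto
      then show ?thesis using True edge_S[OF fS] by simp
    next
      case False
      have "card I \<noteq> 0" using IS fI by simp
      then have "2 \<le> card I" using False by simp
      then have "real (card I) - 1 < d * (real (card (\<Union>I)) - 2)" using IS by (intro strict_S) auto
      also have "\<dots> \<le> d * (real (card U) - 2)" using d_gt cIU by (intro mult_left_mono) auto
      finally have "(real (card I) - 1) / d < real (card U) - 2" using d_gt by (simp add: pos_divide_less_eq mult.commute)
      then show ?thesis by simp
    qed
    have le: "\<epsilon> \<le> real (card U) - 2 - (real (card I) - 1) / d" using eps[OF cU cI pos] .
    have "real n ^ (card ?V - card U) * p ^ (card S - card I)
       = c ^ (card S - card I) * real n powr (real (card ?V - card U) - real (card S - card I) / d)"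
      unfolding p_def by (rule power_scale[OF n1])
    also have "\<dots> \<le> 1 * real n powr (real (card ?V - card U) - real (card S - card I) / d)"
      using c by (intro mult_right_mono power_le_one) auto
    also have "real (card ?V - card U) - real (card S - card I) / d = - (real (card U) - 2 - (real (card I) - 1) / d)"
    proof -
      have "real (card ?V) - 2 = (real (card S) - 1) / d" using tight_S d_gt by simp
      then show ?thesis using cU cI by (simp add: of_nat_diff diff_divide_distrib)
    qed
    also have "1 * real n powr \<dots> \<le> real n powr (- \<epsilon>)"
      unfolding mult_1 by (rule powr_mono) (use le n1 in auto)
    finally show "real n ^ (card ?V - card {u \<in> ?V. \<psi> u \<in> \<Union>K}) * p ^ card (img \<psi> S - K) \<le> real n powr (- \<epsilon>)"
      unfolding ci U_def .
  qed (use p_range in auto)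
  also have "\<dots> \<le> 2 ^ card ?V * real m ^ card ?V * real n powr (- \<epsilon>)"
    using m by (intro mult_right_mono mult_left_mono power_mono) auto
  finally show ?thesis using p_range by (simp add: mult_left_mono)
qed

section \<open>Expected number of explored graphs\<close>

definition reach_weight :: "nat \<Rightarrow> nat \<Rightarrow> real" where
  "reach_weight i D = (\<Sum>K\<in>{K. reach (all_pairs n) i D K}. p ^ card K)"

lemma finite_reach: "finite {K. reach (all_pairs n) i D K}"
  by (rule finite_subset[of _ "Pow (all_pairs n)"]) (auto simp: finite_all_pairs dest: reach_sub)

lemma all_pairs_2: "\<forall>f\<in>all_pairs n. card f = 2"
  by (simp add: all_pairs_def)

text \<open>A regular step has one place to go if some edge is open. Otherwise every edge of
  \<open>K\<close> is allowed, but \<open>reach_closed\<close> then bounds the size of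
  \<open>K\<close> through \<open>D0\<close>. This is the first factor in \<open>rho\<close>, and it
  does not grow with \<open>i\<close>.\<close>

lemma reach_weight_step:
  assumes rho: "(1 + (2 * real (card (\<Union>S)) + 2) * real D0 * real (card S)) * (4 ^ card (\<Union>S) * c ^ (card S - 1)) \<le> \<rho>"
    and gam: "2 ^ card (\<Union>S) * real (2 + M * card (\<Union>S)) ^ card (\<Union>S) * real n powr (- \<epsilon>) \<le> \<gamma>"
    and eps: "\<And>a b. a \<le> card (\<Union>S) \<Longrightarrow> b \<le> card S \<Longrightarrow> 0 < real a - 2 - (real b - 1) / d \<Longrightarrow> \<epsilon> \<le> real a - 2 - (real b - 1) / d"
    and iM: "i \<le> M" and D: "D \<le> D0"
  shows "reach_weight (Suc i) D \<le> \<rho> * reach_weight i D + (if D = 0 then 0 else \<gamma> * reach_weight i (D - 1))"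
proof -
  let ?V = "\<Union>S"
  let ?E = "all_pairs n"
  let ?g = "\<lambda>K. p ^ card K"
  define G where "G K = (if open_edges K \<noteq> {} then {pick K} else K)" for K :: "nat set set"
  define RE where "RE K g = {K \<union> P |P. regular K P g \<and> P \<subseteq> ?E}" for K g
  define DE where "DE K = {K \<union> P |P. degenerate K P \<and> P \<subseteq> ?E}" for K
  let ?R = "\<Union>K\<in>{K. reach ?E i D K}. \<Union>g\<in>G K. RE K g"
  let ?D = "if D = 0 then {} else (\<Union>K\<in>{K. reach ?E i (D - 1) K}. DE K)"
  have finE: "finite (RE K g)" "finite (DE K)" if "K \<subseteq> ?E" for K g
    using that by (auto simp: RE_def DE_def intro!: finite_subset[of _ "Pow ?E"] simp: finite_all_pairs)
  have GK: "G K \<subseteq> K" "finite (G K)" "card (G K) \<le> 1 + (2 * card ?V + 2) * D0 * card S" if r: "reach ?E i D K" for K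
  proof -
    have fK: "finite K" using reach_finite[OF r] .
    show sub: "G K \<subseteq> K" using pick_open[of K] by (auto simp: G_def open_edges_def)
    then show "finite (G K)" using fK finite_subset by blast
    show "card (G K) \<le> 1 + (2 * card ?V + 2) * D0 * card S"
    proof (cases "open_edges K = {}")
      case True
      have "card K \<le> 1 + i * card S" using reach_card[OF r all_pairs_2] by simp
      also have "i \<le> (2 * card ?V + 2) * D" using reach_closed[OF r True] .
      also have "\<dots> \<le> (2 * card ?V + 2) * D0" using D by (rule mult_le_mono2)
      finally show ?thesis using True by (simp add: G_def)
    qed (simp add: G_def)
  qed
  have "{K. reach ?E (Suc i) D K} \<subseteq> ?R \<union> ?D"
  proof
    fix K' assume "K' \<in> {K. reach ?E (Suc i) D K}"
    then have "reach ?E (Suc i) D K'" by simp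
    then show "K' \<in> ?R \<union> ?D"
    proof (cases rule: reach.cases)
      case (reach_regular K P g)
      then have "g \<in> G K" by (auto simp: G_def regular_def)
      then show ?thesis using reach_regular by (auto simp: RE_def)
    next
      case (reach_degenerate D' K P)
      then have "K' \<in> DE K" by (auto simp: DE_def)
      then show ?thesis using reach_degenerate by auto
    qed
  qed
  moreover have fR: "finite ?R"
    by (intro finite_UN_I finite_reach GK finE) (auto dest: reach_sub)
  moreover have fD: "finite ?D"
    using finite_reach finE by (auto intro!: finite_UN_I dest: reach_sub)
  ultimately have "reach_weight (Suc i) D \<le> sum ?g (?R \<union> ?D)"
    unfolding reach_weight_def using p_range by (intro sum_mono2) auto
  also have "\<dots> \<le> sum ?g ?R + sum ?g ?D"
    using sum.union_inter[OF fR fD, of ?g] sum_nonneg[of "?R \<inter> ?D" ?g] p_range by simp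
  also have "sum ?g ?R \<le> \<rho> * reach_weight i D"
  proof -
    have "sum ?g ?R \<le> (\<Sum>K\<in>{K. reach ?E i D K}. sum ?g (\<Union>g\<in>G K. RE K g))"
      using p_range by (intro sum_UN_le finite_reach) (auto intro!: finite_UN_I GK finE dest: reach_sub)
    also have "\<dots> \<le> (\<Sum>K\<in>{K. reach ?E i D K}. \<rho> * p ^ card K)"
    proof (rule sum_mono)
      fix K assume "K \<in> {K. reach ?E i D K}"
      then have r: "reach ?E i D K" by simp
      let ?q = "4 ^ card ?V * c ^ (card S - 1)"
      have "sum ?g (\<Union>g\<in>G K. RE K g) \<le> (\<Sum>g\<in>G K. sum ?g (RE K g))"
        using p_range GK[OF r] reach_sub[OF r] by (intro sum_UN_le finE) auto
      also have "\<dots> \<le> (\<Sum>g\<in>G K. p ^ card K * ?q)"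
        unfolding RE_def using GK(1)[OF r] reach_sub[OF r] by (intro sum_mono regular_sum) auto
      also have "\<dots> = real (card (G K)) * ?q * p ^ card K" by simp
      also have "\<dots> \<le> \<rho> * p ^ card K"
      proof (rule mult_right_mono)
        have "real (card (G K)) \<le> 1 + (2 * real (card ?V) + 2) * real D0 * real (card S)"
          using of_nat_mono[OF GK(3)[OF r], where 'a = real] by (simp add: algebra_simps)
        then have "real (card (G K)) * ?q \<le> (1 + (2 * real (card ?V) + 2) * real D0 * real (card S)) * ?q"
          using c by (intro mult_right_mono) auto
        then show "real (card (G K)) * ?q \<le> \<rho>" using rho by linarith
      qed (use p_range in simp)
      finally show "sum ?g (\<Union>g\<in>G K. RE K g) \<le> \<rho> * p ^ card K" .
    qed
    finally show ?thesis by (simp add: reach_weight_def sum_distrib_left)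
  qed
  also have "sum ?g ?D \<le> (if D = 0 then 0 else \<gamma> * reach_weight i (D - 1))"
  proof (cases "D = 0")
    case False
    have "sum ?g (\<Union>K\<in>{K. reach ?E i (D - 1) K}. DE K) \<le> (\<Sum>K\<in>{K. reach ?E i (D - 1) K}. sum ?g (DE K))"
      using p_range by (intro sum_UN_le finite_reach finE) (auto dest: reach_sub)
    also have "\<dots> \<le> (\<Sum>K\<in>{K. reach ?E i (D - 1) K}. \<gamma> * p ^ card K)"
    proof (rule sum_mono)
      fix K assume "K \<in> {K. reach ?E i (D - 1) K}"
      then have r: "reach ?E i (D - 1) K" by simp
      have K0: "K \<noteq> {}" using r by (induction rule: reach.induct) auto
      have "card (\<Union>K) \<le> 2 + i * card ?V" using reach_card[OF r all_pairs_2] by simp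
      also have "\<dots> \<le> 2 + M * card ?V" using iM by simp
      finally have m: "card (\<Union>K) \<le> 2 + M * card ?V" .
      have "sum ?g (DE K) \<le> p ^ card K * (2 ^ card ?V * real (2 + M * card ?V) ^ card ?V * real n powr (- \<epsilon>))"
        unfolding DE_def by (rule degenerate_sum[OF reach_sub[OF r] K0 m eps])
      also have "\<dots> \<le> p ^ card K * \<gamma>" using gam p_range by (intro mult_left_mono) auto
      finally show "sum ?g (DE K) \<le> \<gamma> * p ^ card K" by (simp add: mult.commute)
    qed
    finally show ?thesis using False by (simp add: reach_weight_def sum_distrib_left)
  qed simp
  finally show ?thesis by simp
qed

text \<open>The bound solves the recursion \<open>w (i + 1) D \<le> \<rho> * w i D + \<gamma> * w i (D - 1)\<close>: both summands equal half of
  the right-hand side.\<close>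

lemma reach_weight_bound:
  assumes rho: "(1 + (2 * real (card (\<Union>S)) + 2) * real D0 * real (card S)) * (4 ^ card (\<Union>S) * c ^ (card S - 1)) \<le> \<rho>"
    and gam: "2 ^ card (\<Union>S) * real (2 + M * card (\<Union>S)) ^ card (\<Union>S) * real n powr (- \<epsilon>) \<le> \<gamma>"
    and eps: "\<And>a b. a \<le> card (\<Union>S) \<Longrightarrow> b \<le> card S \<Longrightarrow> 0 < real a - 2 - (real b - 1) / d \<Longrightarrow> \<epsilon> \<le> real a - 2 - (real b - 1) / d"
    and rho0: "0 < \<rho>" and gam0: "0 \<le> \<gamma>"
  shows "i \<le> M \<Longrightarrow> D \<le> D0 \<Longrightarrow> reach_weight i D \<le> real n ^ 2 * (2 * \<rho>) ^ i * (\<gamma> / \<rho>) ^ D"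
proof (induction i arbitrary: D)
  case 0
  have R: "{K. reach (all_pairs n) 0 D K} = (if D = 0 then (\<lambda>g. {g}) ` all_pairs n else {})"
    by (auto intro: reach_edge elim: reach.cases)
  have "reach_weight 0 0 \<le> (\<Sum>K\<in>(\<lambda>g. {g}) ` all_pairs n. 1)"
  proof -
    have "{K. reach (all_pairs n) 0 0 K} = (\<lambda>g. {g}) ` all_pairs n"
      by (auto intro: reach_edge elim: reach.cases)
    then show ?thesis unfolding reach_weight_def using p_range by (simp only:) (intro sum_mono power_le_one)
  qed
  also have "\<dots> \<le> real (card (all_pairs n))" using card_image_le[OF finite_all_pairs] by simp
  also have "\<dots> \<le> real n ^ 2" using card_all_pairs by (simp flip: of_nat_power)
  finally show ?case
  proof (cases "D = 0")
    case False
    then have "{K. reach (all_pairs n) 0 D K} = {}" using R by simp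
    then have "reach_weight 0 D = 0" unfolding reach_weight_def by (simp only: sum.empty)
    then show ?thesis using rho0 gam0 by simp
  qed simp
next
  case (Suc i)
  let ?x = "real n ^ 2 * (2 * \<rho>) ^ i"
  have "reach_weight (Suc i) D \<le> \<rho> * reach_weight i D + (if D = 0 then 0 else \<gamma> * reach_weight i (D - 1))"
    by (rule reach_weight_step[OF rho gam eps]) (use Suc.prems in auto)
  also have "\<rho> * reach_weight i D \<le> \<rho> * (?x * (\<gamma> / \<rho>) ^ D)" using Suc rho0 by (intro mult_left_mono) auto
  also have "(if D = 0 then 0 else \<gamma> * reach_weight i (D - 1)) \<le> \<rho> * (?x * (\<gamma> / \<rho>) ^ D)"
  proof (cases D)
    case 0
    then show ?thesis using rho0 by simp
  next
    case (Suc D')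
    have "\<gamma> * reach_weight i D' \<le> \<gamma> * (?x * (\<gamma> / \<rho>) ^ D')"
      using Suc.IH Suc Suc.prems gam0 by (intro mult_left_mono) auto
    also have "\<dots> = \<rho> * (?x * (\<gamma> / \<rho>) ^ D)" using Suc rho0 by simp
    finally show ?thesis using Suc by simp
  qed
  finally show ?case by (simp add: mult_ac)
qed

end

end

lemma powr_neg_tendsto_0:
  fixes s :: real assumes "s < 0" shows "(\<lambda>n. real n powr s) \<longlonglongrightarrow> 0"
  using tendsto_neg_powr[OF assms filterlim_real_sequentially] .

context sb_graph begin

section \<open>Small dense subgraphs\<close>

text \<open>Representatives on initial segments of the naturals for the graphs of negative excess
  with at most \<open>m\<close> vertices, so that there are finitely many.\<close>

definition dense_patterns :: "nat \<Rightarrow> (nat \<times> nat set set) set" where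
  "dense_patterns m = {(u, T). u \<le> m \<and> T \<subseteq> {f. f \<subseteq> {..<u} \<and> card f = 2} \<and> d * real u < real (card T)}"

lemma finite_dense_patterns: "finite (dense_patterns m)"
proof (rule finite_subset)
  show "dense_patterns m \<subseteq> {..m} \<times> Pow (Pow {..<m})"
  proof
    fix x assume "x \<in> dense_patterns m"
    then obtain u T where x: "x = (u, T)" "u \<le> m" "T \<subseteq> {f. f \<subseteq> {..<u} \<and> card f = 2}"
      unfolding dense_patterns_def by blast
    have "f \<subseteq> {..<m}" if "f \<in> T" for f
    proof -
      have "f \<subseteq> {..<u}" using x(3) that by blast
      also have "\<dots> \<subseteq> {..<m}" using x(2) by simp
      finally show ?thesis .
    qed
    then have "T \<subseteq> Pow {..<m}" by blast
    then show "x \<in> {..m} \<times> Pow (Pow {..<m})" using x by auto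
  qed
qed simp

lemma dense_set_pattern:
  assumes T: "T \<subseteq> all_pairs n" "card (\<Union>T) \<le> m" "excess d T < 0"
  obtains u T' \<psi> where "(u, T') \<in> dense_patterns m" "\<psi> \<in> embeddings n {..<u}" "img \<psi> T' = T"
proof -
  define u where "u = card (\<Union>T)"
  have "\<Union>T \<subseteq> {..<n}" using T(1) by (auto simp: all_pairs_def)
  then have fU: "finite (\<Union>T)" using finite_subset by blast
  obtain h where h: "bij_betw h {0..<u} (\<Union>T)" using ex_bij_betw_nat_finite[OF fU] u_def by blast
  then have h: "bij_betw h {..<u} (\<Union>T)" by (simp add: lessThan_atLeast0)
  define \<psi> where "\<psi> = restrict h {..<u}"
  have inj: "inj_on \<psi> {..<u}" using h by (auto simp: \<psi>_def bij_betw_def inj_on_def)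
  have im: "\<psi> ` {..<u} = \<Union>T" using h by (auto simp: \<psi>_def bij_betw_def)
  have "\<Union>T \<subseteq> {..<n}" using T(1) by (auto simp: all_pairs_def)
  then have "\<psi> ` {..<u} \<subseteq> {..<n}" using im by simp
  then have emb: "\<psi> \<in> embeddings n {..<u}"
    using inj by (auto simp: embeddings_def \<psi>_def PiE_def Pi_def image_subset_iff)
  define T' where "T' = {f. f \<subseteq> {..<u} \<and> \<psi> ` f \<in> T}"
  have img: "img \<psi> T' = T"
  proof (intro equalityI subsetI)
    fix f assume f: "f \<in> T"
    then have "f \<subseteq> \<psi> ` {..<u}" unfolding im by auto
    then obtain f' where "f' \<subseteq> {..<u}" "f = \<psi> ` f'" by (meson subset_imageE)
    then show "f \<in> img \<psi> T'" using f by (auto simp: T'_def)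
  qed (auto simp: T'_def)
  have c2: "card f = 2" if "f \<in> T'" for f
  proof -
    have "inj_on \<psi> f" using that inj inj_on_subset by (auto simp: T'_def)
    then have "card (\<psi> ` f) = card f" by (rule card_image)
    then show ?thesis using that T(1) by (auto simp: T'_def all_pairs_def)
  qed
  have "card T = card T'" using card_img[OF inj, of T'] img by (auto simp: T'_def)
  then have "d * real u < real (card T')" using T(3) by (simp add: excess_def u_def)
  moreover have "u \<le> m" using T(2) by (simp add: u_def)
  moreover have "T' \<subseteq> {f. f \<subseteq> {..<u} \<and> card f = 2}" using c2 by (auto simp: T'_def)
  ultimately have "(u, T') \<in> dense_patterns m" unfolding dense_patterns_def by blast
  then show ?thesis using that emb img by blast
qed

text \<open>Union bound over all placements of all patterns; each exponent on the right is
  negative.\<close>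

lemma dense_prob:
  assumes n1: "1 \<le> n" and c: "0 < c" "c \<le> 1" and p: "p = c * real n powr (- 1 / d)"
  shows "bg_prob n p {G. \<exists>T\<subseteq>edges G. card (\<Union>T) \<le> m \<and> excess d T < 0}
    \<le> (\<Sum>(u, T)\<in>dense_patterns m. real n powr (real u - real (card T) / d))"
proof -
  note pr = p_range[OF n1 c p]
  let ?I = "Sigma (dense_patterns m) (\<lambda>(u, T). embeddings n {..<u})"
  let ?S = "\<lambda>((u, T), \<psi>). img \<psi> T"
  have fI: "finite ?I" using finite_dense_patterns by (auto intro!: finite_SigmaI finite_embeddings)
  have "bg_prob n p {G. \<exists>T\<subseteq>edges G. card (\<Union>T) \<le> m \<and> excess d T < 0} \<le> bg_prob n p {G. \<exists>x\<in>?I. ?S x \<subseteq> edges G}"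
  proof (rule bg_prob_mono)
    fix G :: "nat ugraph" assume G: "edges G \<subseteq> all_pairs n"
      "G \<in> {G. \<exists>T\<subseteq>edges G. card (\<Union>T) \<le> m \<and> excess d T < 0}"
    then obtain T where T: "T \<subseteq> edges G" "card (\<Union>T) \<le> m" "excess d T < 0" by auto
    have "T \<subseteq> all_pairs n" using T(1) G(1) by (rule order_trans)
    then obtain u T' \<psi> where "(u, T') \<in> dense_patterns m" "\<psi> \<in> embeddings n {..<u}" "img \<psi> T' = T"
      by (rule dense_set_pattern[OF _ T(2,3)])
    then have "?S ((u, T'), \<psi>) \<subseteq> edges G" "((u, T'), \<psi>) \<in> ?I" using T(1) by auto
    then show "G \<in> {G. \<exists>x\<in>?I. ?S x \<subseteq> edges G}" by (intro CollectI bexI[of _ "((u, T'), \<psi>)"])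
  qed
  also have "\<dots> \<le> (\<Sum>x\<in>?I. p ^ card (?S x))"
  proof (rule union_prob[OF fI _ pr])
    fix x assume "x \<in> ?I"
    then obtain u T \<psi> where x: "x = ((u, T), \<psi>)" "(u, T) \<in> dense_patterns m" "\<psi> \<in> embeddings n {..<u}" by auto
    then have "img \<psi> T \<subseteq> all_pairs n" by (intro img_all_pairs[OF x(3)]) (auto simp: dense_patterns_def)
    then show "?S x \<subseteq> all_pairs n" using x by simp
  qed
  also have "\<dots> = (\<Sum>(u, T)\<in>dense_patterns m. \<Sum>\<psi>\<in>embeddings n {..<u}. p ^ card (img \<psi> T))"
  proof -
    have "(\<Sum>x\<in>dense_patterns m. \<Sum>\<psi>\<in>(case x of (u, T) \<Rightarrow> embeddings n {..<u}). p ^ card (img \<psi> (snd x)))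
        = (\<Sum>(x, \<psi>)\<in>?I. p ^ card (img \<psi> (snd x)))"
      using finite_dense_patterns by (intro sum.Sigma) (auto intro!: finite_embeddings)
    then show ?thesis by (simp add: case_prod_unfold)
  qed
  also have "\<dots> \<le> (\<Sum>(u, T)\<in>dense_patterns m. real n powr (real u - real (card T) / d))"
  proof (rule sum_mono, clarify)
    fix u T assume uT: "(u, T) \<in> dense_patterns m"
    then have "card (img \<psi> T) = card T" if "\<psi> \<in> embeddings n {..<u}" for \<psi>
      using that by (intro card_img[of _ "{..<u}"]) (auto simp: embeddings_def dense_patterns_def)
    then have "(\<Sum>\<psi>\<in>embeddings n {..<u}. p ^ card (img \<psi> T)) = real (card (embeddings n {..<u})) * p ^ card T"
      by simp
    also have "\<dots> \<le> real n ^ u * p ^ card T"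
      using card_embeddings[of "{..<u}" n] pr by (intro mult_right_mono) (simp_all flip: of_nat_power)
    also have "\<dots> = c ^ card T * real n powr (real u - real (card T) / d)" unfolding p by (rule power_scale[OF n1])
    also have "\<dots> \<le> 1 * real n powr (real u - real (card T) / d)"
      using c by (intro mult_right_mono power_le_one) auto
    finally show "(\<Sum>\<psi>\<in>embeddings n {..<u}. p ^ card (img \<psi> T)) \<le> real n powr (real u - real (card T) / d)" by simp
  qed
  finally show ?thesis .
qed

lemma dense_sum_tendsto: "(\<lambda>n. \<Sum>(u, T)\<in>dense_patterns m. real n powr (real u - real (card T) / d)) \<longlonglongrightarrow> 0"
proof -
  have "(\<lambda>n. case x of (u, T) \<Rightarrow> real n powr (real u - real (card T) / d)) \<longlonglongrightarrow> 0" if "x \<in> dense_patterns m" for x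
  proof -
    obtain u T where x: "x = (u, T)" by force
    then have "d * real u < real (card T)" using that by (simp add: dense_patterns_def)
    then have "real u - real (card T) / d < 0" using d_gt by (simp add: pos_less_divide_eq mult.commute)
    then show ?thesis unfolding x prod.case by (rule powr_neg_tendsto_0)
  qed
  then show ?thesis using tendsto_sum[of "dense_patterns m" "\<lambda>x n. case x of (u, T) \<Rightarrow> real n powr (real u - real (card T) / d)" "\<lambda>_. 0"]
    by simp
qed

section \<open>The 0-statement for a strictly 2-balanced graph\<close>

text \<open>Outside the events \<open>bad\<close> and \<open>dns\<close> a non-colourable graph
  would, by \<open>growth\<close>, have a non-colourable part on at most \<open>m\<close> vertices
  without subsets of negative excess, against \<open>sparse_colourable\<close>.\<close>

theorem whp_colourable:
  "\<exists>c0>0. c0 \<le> 1 \<and> (\<forall>c. 0 < c \<and> c < c0 \<longrightarrow>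
     (\<lambda>n. bg_prob n (c * real n powr (- 1 / d)) {G. colourable (edges G)}) \<longlonglongrightarrow> 1)"
proof -
  let ?v = "card (\<Union>S)" and ?e = "card S"
  obtain \<epsilon> where eps0: "0 < \<epsilon>" and eps: "\<forall>a\<le>?v. \<forall>b\<le>?e. 0 < real a - 2 - (real b - 1) / d \<longrightarrow> \<epsilon> \<le> real a - 2 - (real b - 1) / d"
    using positive_gap[of ?v ?e "\<lambda>a b. real a - 2 - (real b - 1) / d"] by blast
  \<comment> \<open>\<open>D0\<close> degenerate steps, each worth
    \<open>n powr (- (\<epsilon> / 2))\<close>, have to beat the \<open>n ^ 2\<close> first edges
    and still leave \<open>1 / n ^ 2\<close> for the sum over the lengths; hence
    \<open>D0 * (\<epsilon> / 2) \<ge> 4\<close>.\<close>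
  define D0 where "D0 = nat \<lceil>8 / \<epsilon>\<rceil> + 1"
  have D0: "0 < D0" "4 \<le> real D0 * (\<epsilon> / 2)"
  proof -
    have "8 / \<epsilon> \<le> real D0" unfolding D0_def by linarith
    then show "4 \<le> real D0 * (\<epsilon> / 2)" using eps0 by (simp add: pos_divide_le_eq)
  qed (simp add: D0_def)
  \<comment> \<open>\<open>2 * \<rho> = exp (- 3)\<close> is the factor per step in
    \<open>reach_weight_bound\<close>. Over at least \<open>ln n\<close> steps it yields
    \<open>1 / n ^ 3\<close> against \<open>n ^ 2\<close> first edges.\<close>
  define \<rho> :: real where "\<rho> = exp (- 3) / 2"
  have rho: "0 < \<rho>" "2 * \<rho> = exp (- 3)" "2 * \<rho> \<le> 1" by (auto simp: \<rho>_def)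
  define B where "B = (1 + (2 * real ?v + 2) * real D0 * real ?e) * 4 ^ ?v"
  have B0: "0 < B" unfolding B_def by (intro mult_pos_pos add_pos_nonneg) auto
  \<comment> \<open>For \<open>c \<le> 1\<close> a regular step has factor at most
    \<open>B * c\<close>, which this choice keeps below \<open>\<rho>\<close>.\<close>
  define c0 where "c0 = min 1 (\<rho> / B)"
  have "(\<lambda>n. bg_prob n (c * real n powr (- 1 / d)) {G. colourable (edges G)}) \<longlonglongrightarrow> 1" if c: "0 < c" "c < c0" for c
  proof -
    have c1: "c \<le> 1" using c by (simp add: c0_def)
    have "B * c ^ (?e - 1) \<le> B * c"
    proof -
      have "c ^ (?e - 1) \<le> c ^ 1" using c c1 card_S by (intro power_decreasing) auto
      then show ?thesis using B0 by simp
    qed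
    also have "\<dots> \<le> \<rho>" using c B0 by (simp add: c0_def pos_less_divide_eq mult.commute)
    finally have rhoB: "(1 + (2 * real ?v + 2) * real D0 * real ?e) * (4 ^ ?v * c ^ (?e - 1)) \<le> \<rho>"
      by (simp add: B_def mult_ac)
    define M where "M n = nat \<lceil>ln (real n)\<rceil> + 1" for n
    define \<gamma> where "\<gamma> n = 2 ^ ?v * real (2 + M n * ?v) ^ ?v * real n powr (- \<epsilon>)" for n
    define p where "p n = c * real n powr (- 1 / d)" for n
    define m where "m = 2 + (2 * ?v + 2) * D0 * ?v"
    define bad where "bad n = {G. \<exists>i D K. reach (all_pairs n) i D K \<and> K \<subseteq> edges G \<and> (i = M n \<and> D < D0 \<or> i \<le> M n \<and> D = D0)}" for n
    define dns where "dns = {G :: nat ugraph. \<exists>T\<subseteq>edges G. card (\<Union>T) \<le> m \<and> excess d T < 0}"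
    have M_bounds: "ln (real n) \<le> real (M n)" "real (M n) \<le> ln (real n) + 2" if "1 \<le> n" for n
    proof -
      have "0 \<le> ln (real n)" using that by simp
      then show "ln (real n) \<le> real (M n)" "real (M n) \<le> ln (real n) + 2" unfolding M_def by linarith+
    qed
    have v0: "0 < real ?v" using v_ge3 by simp
    have gam_small: "eventually (\<lambda>n. \<gamma> n / \<rho> \<le> real n powr (- (\<epsilon> / 2))) sequentially"
    proof -
      \<comment> \<open>The factor \<open>(2 + M n * ?v) ^ ?v\<close> of \<open>\<gamma> n\<close>
        is a power of a logarithm; half of the exponent \<open>\<epsilon>\<close>, divided into
        \<open>?v\<close> equal shares, absorbs it.\<close>
      define \<delta> where "\<delta> = \<epsilon> / (2 * real ?v)"
      have del: "0 < \<delta>" using eps0 v0 by (simp add: \<delta>_def)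
      have "(\<lambda>n::nat. (2 + (ln (real n) + 2) * real ?v) / real n powr \<delta>) \<longlonglongrightarrow> 0"
        using del v0 by real_asymp
      then have "(\<lambda>n::nat. 2 ^ ?v / \<rho> * ((2 + (ln (real n) + 2) * real ?v) / real n powr \<delta>) ^ ?v) \<longlonglongrightarrow> 2 ^ ?v / \<rho> * 0 ^ ?v"
        by (intro tendsto_intros)
      then have "(\<lambda>n::nat. 2 ^ ?v / \<rho> * ((2 + (ln (real n) + 2) * real ?v) / real n powr \<delta>) ^ ?v) \<longlonglongrightarrow> 0"
        using v0 by (simp add: zero_power)
      then have "eventually (\<lambda>n::nat. 2 ^ ?v / \<rho> * ((2 + (ln (real n) + 2) * real ?v) / real n powr \<delta>) ^ ?v < 1) sequentially"
        by (rule order_tendstoD) simp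
      then show ?thesis using eventually_ge_at_top[of 1]
      proof eventually_elim
        case (elim n)
        let ?y = "2 + (ln (real n) + 2) * real ?v"
        have np: "0 < real n" using elim by simp
        have "real (2 + M n * ?v) = 2 + real (M n) * real ?v" by simp
        also have "\<dots> \<le> ?y" using M_bounds(2)[of n] elim by (intro add_left_mono mult_right_mono) auto
        finally have le: "real (2 + M n * ?v) ^ ?v \<le> ?y ^ ?v" by (intro power_mono) auto
        have split: "real n powr (- \<epsilon>) = real n powr (- (\<epsilon> / 2)) / (real n powr \<delta>) ^ ?v"
        proof -
          have "(real n powr \<delta>) ^ ?v = real n powr (\<epsilon> / 2)"
            using np v0 by (simp flip: powr_realpow add: powr_powr \<delta>_def)
          then show ?thesis using np by (simp flip: powr_diff)
        qed
        have "\<gamma> n / \<rho> \<le> 2 ^ ?v * ?y ^ ?v * real n powr (- \<epsilon>) / \<rho>"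
          unfolding \<gamma>_def using le rho by (intro divide_right_mono mult_right_mono mult_left_mono) auto
        also have "\<dots> = real n powr (- (\<epsilon> / 2)) * (2 ^ ?v / \<rho> * (?y / real n powr \<delta>) ^ ?v)"
          unfolding split by (simp add: power_divide mult_ac)
        also have "\<dots> \<le> real n powr (- (\<epsilon> / 2)) * 1" using elim(1) by (intro mult_left_mono) auto
        finally show ?case by simp
      qed
    qed
    have bad_bound: "eventually (\<lambda>n. bg_prob n (p n) (bad n) \<le> real D0 / real n + (ln (real n) + 3) / real n ^ 2) sequentially"
      using gam_small eventually_ge_at_top[of 1]
    proof eventually_elim
      case (elim n)
      have n1: "1 \<le> n" using elim by simp
      note pr = p_range[OF n1 c(1) c1 p_def]
      have np: "1 \<le> real n" using n1 by simp
      have gr: "\<gamma> n / \<rho> \<le> 1"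
      proof -
        have "real n powr (- (\<epsilon> / 2)) \<le> 1" using powr_mono[of "- (\<epsilon> / 2)" 0 "real n"] np eps0 by simp
        then show ?thesis using elim(1) by linarith
      qed
      have gam0: "0 \<le> \<gamma> n" by (simp add: \<gamma>_def)
      have wb: "reach_weight n (p n) i D \<le> real n ^ 2 * (2 * \<rho>) ^ i * (\<gamma> n / \<rho>) ^ D" if "i \<le> M n" "D \<le> D0" for i D
        by (rule reach_weight_bound[OF n1 c(1) c1 p_def rhoB _ _ rho(1) gam0 that, where \<epsilon> = \<epsilon>])
          (use eps in \<open>auto simp: \<gamma>_def\<close>)
      let ?I = "{M n} \<times> {..<D0} \<union> {..M n} \<times> {D0}"
      have "bad n \<subseteq> (\<Union>(i, D)\<in>?I. {G. \<exists>K\<in>{K. reach (all_pairs n) i D K}. K \<subseteq> edges G})"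
        unfolding bad_def by blast
      then have "bg_prob n (p n) (bad n) \<le> bg_prob n (p n) (\<Union>(i, D)\<in>?I. {G. \<exists>K\<in>{K. reach (all_pairs n) i D K}. K \<subseteq> edges G})"
        by (intro measure_pmf.finite_measure_mono) auto
      also have "\<dots> \<le> (\<Sum>x\<in>?I. bg_prob n (p n) (case x of (i, D) \<Rightarrow> {G. \<exists>K\<in>{K. reach (all_pairs n) i D K}. K \<subseteq> edges G}))"
        by (intro measure_pmf.finite_measure_subadditive_finite) auto
      also have "\<dots> \<le> (\<Sum>x\<in>?I. case x of (i, D) \<Rightarrow> reach_weight n (p n) i D)"
      proof (rule sum_mono, clarify)
        fix i D
        show "bg_prob n (p n) {G. \<exists>K\<in>{K. reach (all_pairs n) i D K}. K \<subseteq> edges G} \<le> reach_weight n (p n) i D"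
          unfolding reach_weight_def[OF n1 c(1) c1 p_def]
          by (rule union_prob[OF finite_reach[OF n1 c(1) c1 p_def] _ pr]) (auto dest: reach_sub)
      qed
      also have "\<dots> = (\<Sum>D<D0. reach_weight n (p n) (M n) D) + (\<Sum>i\<le>M n. reach_weight n (p n) i D0)"
        by (subst sum.union_disjoint) (auto simp: sum.cartesian_product[symmetric])
      also have "(\<Sum>D<D0. reach_weight n (p n) (M n) D) \<le> (\<Sum>D<D0. 1 / real n)"
      proof (rule sum_mono)
        fix D assume "D \<in> {..<D0}"
        then have "reach_weight n (p n) (M n) D \<le> real n ^ 2 * (2 * \<rho>) ^ M n * (\<gamma> n / \<rho>) ^ D" by (intro wb) auto
        also have "\<dots> \<le> real n ^ 2 * (2 * \<rho>) ^ M n * 1"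
          using gr gam0 rho by (intro mult_left_mono power_le_one) auto
        also have "(2 * \<rho>) ^ M n = exp (- (3 * real (M n)))" unfolding rho(2) by (simp flip: exp_of_nat_mult)
        also have "real n ^ 2 * exp (- (3 * real (M n))) * 1 \<le> real n ^ 2 * exp (- (3 * ln (real n))) * 1"
          using M_bounds(1)[OF n1] by (intro mult_right_mono mult_left_mono) auto
        also have "exp (- (3 * ln (real n))) = 1 / real n ^ 3"
          using np by (simp add: exp_minus inverse_eq_divide exp_of_nat_mult[of 3, simplified])
        also have "real n ^ 2 * (1 / real n ^ 3) * 1 = 1 / real n" using np by (simp add: field_simps power2_eq_square power3_eq_cube)
        finally show "reach_weight n (p n) (M n) D \<le> 1 / real n" .
      qed
      also have "(\<Sum>D<D0. 1 / real n) = real D0 / real n" by simp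
      also have "(\<Sum>i\<le>M n. reach_weight n (p n) i D0) \<le> (\<Sum>i\<le>M n. 1 / real n ^ 2)"
      proof (rule sum_mono)
        fix i assume "i \<in> {..M n}"
        have "(real n powr (- (\<epsilon> / 2))) ^ D0 = real n powr (- (real D0 * (\<epsilon> / 2)))"
          using np by (simp flip: powr_realpow add: powr_powr mult.commute)
        also have "\<dots> \<le> real n powr (- 4)" using D0(2) np by (intro powr_mono) auto
        also have "\<dots> = 1 / real n ^ 4" using np by (simp add: powr_minus_divide powr_numeral)
        finally have q: "(real n powr (- (\<epsilon> / 2))) ^ D0 \<le> 1 / real n ^ 4" .
        have "reach_weight n (p n) i D0 \<le> real n ^ 2 * (2 * \<rho>) ^ i * (\<gamma> n / \<rho>) ^ D0"
          using \<open>i \<in> {..M n}\<close> by (intro wb) auto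
        also have "\<dots> \<le> real n ^ 2 * 1 * (real n powr (- (\<epsilon> / 2))) ^ D0"
          using elim(1) gam0 rho by (intro mult_mono power_mono power_le_one) auto
        also have "\<dots> \<le> real n ^ 2 * 1 * (1 / real n ^ 4)" using q by (intro mult_left_mono) auto
        also have "real n ^ 2 * 1 * (1 / real n ^ 4) = 1 / real n ^ 2"
          using np by (simp add: field_simps flip: power_add)
        finally show "reach_weight n (p n) i D0 \<le> 1 / real n ^ 2" by simp
      qed
      also have "(\<Sum>i\<le>M n. 1 / real n ^ 2) = (real (M n) + 1) / real n ^ 2" by simp
      also have "\<dots> \<le> (ln (real n) + 3) / real n ^ 2" using M_bounds(2)[OF n1] by (intro divide_right_mono) auto
      finally show ?case by simp
    qed
    have low: "eventually (\<lambda>n. 1 - (real D0 / real n + (ln (real n) + 3) / real n ^ 2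
          + (\<Sum>(u, T)\<in>dense_patterns m. real n powr (real u - real (card T) / d)))
        \<le> bg_prob n (p n) {G. colourable (edges G)}) sequentially"
      using bad_bound eventually_ge_at_top[of 1]
    proof eventually_elim
      case (elim n)
      have n1: "1 \<le> n" using elim by simp
      have "bg_prob n (p n) (- {G. colourable (edges G)}) \<le> bg_prob n (p n) (bad n \<union> dns)"
      proof (rule bg_prob_mono)
        fix G :: "nat ugraph" assume G: "edges G \<subseteq> all_pairs n" "G \<in> - {G. colourable (edges G)}"
        show "G \<in> bad n \<union> dns"
        proof (rule ccontr)
          assume no: "G \<notin> bad n \<union> dns"
          have fG: "finite (edges G)" using G(1) finite_all_pairs finite_subset by blast
          have "\<exists>K\<subseteq>edges G. \<not> colourable K \<and> card (\<Union>K) \<le> 2 + (2 * ?v + 2) * D0 * ?v"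
          proof (rule growth[OF _ fG G(1) _ _ D0(1)])
            show "\<not> colourable (edges G)" using G(2) by simp
            show "\<forall>f\<in>all_pairs n. card f = 2" by (simp add: all_pairs_def)
            show "0 < M n" by (simp add: M_def)
            show "\<not> (i = M n \<and> D < D0 \<or> i \<le> M n \<and> D = D0)" if "reach (all_pairs n) i D K" "K \<subseteq> edges G" for i D K
              using no that unfolding bad_def by blast
          qed
          then obtain K where K: "K \<subseteq> edges G" "\<not> colourable K" "card (\<Union>K) \<le> m" unfolding m_def by blast
          have fK: "finite K" using K(1) fG finite_subset by blast
          have K2: "\<forall>f\<in>K. card f = 2" using K(1) G(1) by (auto simp: all_pairs_def)
          have fU: "finite (\<Union>K)" using fK K2 by (metis card.infinite finite_Union zero_neq_numeral)
          have "0 \<le> excess d T" if T: "T \<subseteq> K" for T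
          proof -
            have "card (\<Union>T) \<le> card (\<Union>K)" using T fU by (intro card_mono Union_mono)
            then have "card (\<Union>T) \<le> m" using K(3) by simp
            moreover have "T \<subseteq> edges G" using T K(1) by simp
            ultimately have "\<not> excess d T < 0" using no unfolding dns_def by blast
            then show ?thesis by simp
          qed
          then show False using sparse_colourable[OF fK K2] K(2) by blast
        qed
      qed
      also have "\<dots> \<le> bg_prob n (p n) (bad n) + bg_prob n (p n) dns"
        by (rule measure_Un_le) auto
      also have "bg_prob n (p n) dns \<le> (\<Sum>(u, T)\<in>dense_patterns m. real n powr (real u - real (card T) / d))"
        unfolding dns_def by (rule dense_prob[OF n1 c(1) c1 p_def])
      finally have "bg_prob n (p n) (- {G. colourable (edges G)}) \<le> real D0 / real n + (ln (real n) + 3) / real n ^ 2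
          + (\<Sum>(u, T)\<in>dense_patterns m. real n powr (real u - real (card T) / d))" using elim(1) by linarith
      moreover have "bg_prob n (p n) (- {G. colourable (edges G)}) = 1 - bg_prob n (p n) {G. colourable (edges G)}"
        using measure_pmf.prob_compl[of "{G. colourable (edges G)}" "binomial_graph n (p n)"] by (simp add: Compl_eq_Diff_UNIV)
      ultimately show ?case by linarith
    qed
    have "(\<lambda>n::nat. real D0 / real n + (ln (real n) + 3) / real n ^ 2) \<longlonglongrightarrow> 0" by real_asymp
    note tendsto_diff[OF tendsto_const[of 1] tendsto_add[OF this dense_sum_tendsto[of m]]]
    then have "(\<lambda>n. bg_prob n (p n) {G. colourable (edges G)}) \<longlonglongrightarrow> 1"
      by (intro tendsto_sandwich[OF low _ _ tendsto_const]) auto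
    then show ?thesis by (simp add: p_def)
  qed
  moreover have "0 < c0" "c0 \<le> 1" using rho B0 by (auto simp: c0_def)
  ultimately show ?thesis by blast
qed

end

section \<open>The graph $F \otimes_1 (F,f)$\<close>

lemma card_Union_ge3:
  assumes "finite T" "\<And>f. f \<in> T \<Longrightarrow> card f = 2" "2 \<le> card T"
  shows "3 \<le> card (\<Union>T)"
proof (rule ccontr)
  assume "\<not> ?thesis"
  then have le: "card (\<Union>T) \<le> 2" by simp
  have fU: "finite (\<Union>T)" using assms by (metis card.infinite finite_Union zero_neq_numeral)
  have "f = \<Union>T" if "f \<in> T" for f
    using that assms(2)[OF that] le card_seteq[OF fU, of f] by auto
  then have "T \<subseteq> {\<Union>T}" by blast
  then have "card T \<le> 1" using card_mono[of "{\<Union>T}" T] by simp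
  then show False using assms(3) by simp
qed

text \<open>With as many edges as vertices this subgraph has \<open>d2\<close> above 1, which is how
  the cycle yields \<open>1 < d\<close>.\<close>

lemma cycle_subgraph:
  assumes "is_graph F" "contains_cycle F"
  obtains U T where "(U, T) \<in> subgraphs F" "card T = card U" "3 \<le> card U"
proof -
  obtain xs where xs: "length xs \<ge> 3" "distinct xs" "set xs \<subseteq> verts F"
    "\<forall>i<length xs. {xs ! i, xs ! (Suc i mod length xs)} \<in> edges F"
    using assms(2) unfolding contains_cycle_def by blast
  let ?m = "length xs"
  let ?e = "\<lambda>i. {xs ! i, xs ! (Suc i mod ?m)}"
  have lt: "Suc i mod ?m < ?m" for i using xs(1) by (intro mod_less_divisor) auto
  have inj: "inj_on ?e {..<?m}"
  proof (rule inj_onI, rule ccontr)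
    fix i j assume ij: "i \<in> {..<?m}" "j \<in> {..<?m}" "?e i = ?e j" "i \<noteq> j"
    then have "xs ! i = xs ! (Suc j mod ?m)" "xs ! j = xs ! (Suc i mod ?m)"
      using xs(2) lt nth_eq_iff_index_eq[OF xs(2)] by (auto simp: doubleton_eq_iff)
    \<comment> \<open>Each position would be the cyclic successor of the other, impossible with at
      least three positions.\<close>
    then have 1: "i = Suc j mod ?m" "j = Suc i mod ?m"
      using ij lt nth_eq_iff_index_eq[OF xs(2)] by auto
    show False
    proof (cases "Suc i < ?m")
      case True
      then have j: "j = Suc i" using 1(2) by (metis mod_less)
      show False
      proof (cases "Suc (Suc i) = ?m")
        case eq: True
        then have "Suc j mod ?m = 0" using j by simp
        then have "i = 0" using 1(1) by metis
        then show False using eq xs(1) by simp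
      next
        case False
        then have "Suc j mod ?m = Suc j" using True j by simp
        then have "i = Suc (Suc i)" using 1(1) j by metis
        then show False by simp
      qed
    next
      case False
      then have "Suc i = ?m" using ij by simp
      then have "j = 0" using 1(2) by (metis mod_self)
      then have "i = 1" using 1(1) xs(1) by (metis One_nat_def Suc_1 Suc_le_eq eval_nat_numeral(3) mod_less less_trans lessI)
      then show False using xs(1) \<open>Suc i = ?m\<close> by simp
    qed
  qed
  have ed: "?e i \<subseteq> set xs \<and> card (?e i) = 2" if "i < ?m" for i
  proof -
    have "?e i \<in> edges F" using xs(4) that by blast
    then have "card (?e i) = 2" using assms(1) by (auto simp: is_graph_def)
    then show ?thesis using lt that by auto
  qed
  have "(set xs, ?e ` {..<?m}) \<in> subgraphs F"
    using xs(3,4) ed unfolding subgraphs_def is_graph_def by auto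
  moreover have "card (?e ` {..<?m}) = ?m" using card_image[OF inj] by simp
  moreover have "card (set xs) = ?m" using xs(2) by (rule distinct_card)
  ultimately show ?thesis using that xs(1) by metis
qed

locale balanced_graph =
  fixes F :: "'a ugraph" and d :: real
  assumes graph: "is_graph F" and balanced: "two_balanced F" and cycle: "contains_cycle F"
    and d_def: "d = (real (card (edges F)) - 1) / (real (card (verts F)) - 2)"
begin

lemma fin_F: "finite (verts F)" "finite (edges F)"
proof -
  show fv: "finite (verts F)" using graph by (simp add: is_graph_def)
  have "edges F \<subseteq> Pow (verts F)" using graph by (auto simp: is_graph_def)
  then show "finite (edges F)" using fv finite_subset by blast
qed

lemma edge_F: "f \<in> edges F \<Longrightarrow> card f = 2" "f \<in> edges F \<Longrightarrow> f \<subseteq> verts F"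
  using graph by (auto simp: is_graph_def)

lemma size_F: "3 \<le> card (edges F)" "3 \<le> card (verts F)" "1 < d" "d2 F = d"
proof -
  obtain U T where UT: "(U, T) \<in> subgraphs F" "card T = card U" "3 \<le> card U"
    using cycle_subgraph[OF graph cycle] .
  have sub: "U \<subseteq> verts F" "T \<subseteq> edges F" using UT by (auto simp: subgraphs_def)
  show e: "3 \<le> card (edges F)" using card_mono[OF fin_F(2) sub(2)] UT by simp
  show v: "3 \<le> card (verts F)" using card_mono[OF fin_F(1) sub(1)] UT by simp
  show d2F: "d2 F = d" using e by (auto simp: d2_def d_def)
  have "d2 (U, T) \<le> d2 F" using balanced UT(1) by (cases "(U, T) = F") (auto simp: two_balanced_def)
  moreover have "1 < d2 (U, T)" using UT by (auto simp: d2_def)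
  ultimately show "1 < d" using d2F by simp
qed

text \<open>The product form, with both sides 0 for a single edge, avoids the exceptional values of
  \<open>d2\<close>.\<close>

lemma sub_density:
  assumes T: "T \<subseteq> edges F" "T \<noteq> {}"
  shows "real (card T) - 1 \<le> d * (real (card (\<Union>T)) - 2)"
proof -
  have fT: "finite T" using T fin_F finite_subset by blast
  have c0: "card T \<noteq> 0" using fT T by simp
  show ?thesis
  proof (cases "card T = 1")
    case True
    then obtain f where "T = {f}" by (meson card_1_singletonE)
    then show ?thesis using T edge_F by simp
  next
    case False
    then have c2: "2 \<le> card T" using c0 by simp
    have c3: "3 \<le> card (\<Union>T)" using T edge_F by (intro card_Union_ge3[OF fT _ c2]) auto
    have "\<Union>T \<subseteq> verts F" using T edge_F by auto
    then have "(\<Union>T, T) \<in> subgraphs F"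
      using T edge_F finite_subset[OF _ fin_F(1)] by (auto simp: subgraphs_def is_graph_def)
    then have "d2 (\<Union>T, T) \<le> d2 F" using balanced by (cases "(\<Union>T, T) = F") (auto simp: two_balanced_def)
    moreover have "d2 (\<Union>T, T) = (real (card T) - 1) / (real (card (\<Union>T)) - 2)"
      using T False by (simp add: d2_def)
    ultimately have "(real (card T) - 1) / (real (card (\<Union>T)) - 2) \<le> d" using size_F(4) by simp
    then show ?thesis using c3 by (simp add: pos_divide_le_eq)
  qed
qed

text \<open>Dropping an isolated vertex would raise the density above that of
  \<open>F\<close>.\<close>

lemma Union_F: "\<Union>(edges F) = verts F"
proof (rule card_seteq[OF fin_F(1)])
  show "\<Union>(edges F) \<subseteq> verts F" using edge_F by auto
  have ne: "edges F \<noteq> {}" using size_F by auto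
  have "real (card (edges F)) - 1 \<le> d * (real (card (\<Union>(edges F))) - 2)" using sub_density[OF _ ne] by simp
  moreover have "real (card (edges F)) - 1 = d * (real (card (verts F)) - 2)"
    using size_F(2) by (simp add: d_def)
  ultimately show "card (verts F) \<le> card (\<Union>(edges F))" using size_F(3) by simp
qed

lemma tight_F: "real (card (edges F)) - 1 = d * (real (card (verts F)) - 2)"
  using size_F(2) by (simp add: d_def)

lemma strict_core:
  obtains S where "S \<subseteq> edges F" "sb_graph S d"
proof -
  \<comment> \<open>A single edge satisfies the equation with both sides 0; the bound
    \<open>2 \<le> card T\<close> keeps it out of the minimisation.\<close>
  define Q where "Q T \<longleftrightarrow> T \<subseteq> edges F \<and> 2 \<le> card T \<and> real (card T) - 1 = d * (real (card (\<Union>T)) - 2)" for T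
  have "Q (edges F)" using size_F tight_F by (simp add: Q_def Union_F)
  then have "\<exists>S. Q S \<and> (\<forall>T. Q T \<longrightarrow> card S \<le> card T)" by (rule ex_has_least_nat)
  then obtain S where S: "Q S" and least: "\<forall>T. Q T \<longrightarrow> card S \<le> card T" by (elim exE conjE)
  have SE: "S \<subseteq> edges F" "2 \<le> card S" "real (card S) - 1 = d * (real (card (\<Union>S)) - 2)" using S by (auto simp: Q_def)
  have fS: "finite S" using SE fin_F finite_subset by blast
  have U3: "3 \<le> card (\<Union>S)" using SE edge_F by (intro card_Union_ge3[OF fS]) auto
  have "1 * (real (card (\<Union>S)) - 2) < d * (real (card (\<Union>S)) - 2)"
    using size_F(3) U3 by (intro mult_strict_right_mono) auto
  then have "real (card (\<Union>S)) - 2 < real (card S) - 1" using SE(3) by simp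
  then have "card (\<Union>S) < card S + 1" by linarith
  then have c3: "3 \<le> card S" using U3 by linarith
  have "sb_graph S d"
  proof
    show "finite S" "\<And>f. f \<in> S \<Longrightarrow> card f = 2" "1 < d" "3 \<le> card S"
      "real (card S) - 1 = d * (real (card (\<Union>S)) - 2)" using fS SE edge_F size_F(3) c3 by auto
    fix T assume T: "T \<subset> S" "2 \<le> card T"
    have "card T < card S" using fS T(1) by (rule psubset_card_mono)
    then have "\<not> Q T" using least by (meson leD)
    then have "real (card T) - 1 \<noteq> d * (real (card (\<Union>T)) - 2)" using T SE by (auto simp: Q_def)
    moreover have "T \<noteq> {}" using T(2) by auto
    then have "real (card T) - 1 \<le> d * (real (card (\<Union>T)) - 2)" using T SE by (intro sub_density) auto
    ultimately show "real (card T) - 1 < d * (real (card (\<Union>T)) - 2)" by simp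
  qed
  then show ?thesis using that SE by blast
qed

end

locale attached_graph = balanced_graph F d for F :: "'a ugraph" and d +
  fixes f :: "'a set" and \<tau> :: "'a set \<Rightarrow> 'a \<Rightarrow> 'a" and H :: "('a + ('a set \<times> 'a)) ugraph"
  assumes f_edge: "f \<in> edges F" and tau: "\<And>g. g \<in> edges F \<Longrightarrow> bij_betw (\<tau> g) f g"
    and H_def: "H = otimes1 F F f \<tau>"
begin

abbreviation att :: "'a set \<Rightarrow> 'a \<Rightarrow> 'a + ('a set \<times> 'a)" where "att g \<equiv> attach_map f \<tau> g"

section \<open>Structure and density of \<open>H\<close>\<close>

text \<open>The image of \<open>f\<close> is included. It is the central edge \<open>g\<close>, so
  the parts together cover the central copy as well.\<close>

definition part :: "'a set \<Rightarrow> ('a + ('a set \<times> 'a)) set set" where "part g = img (att g) (edges F)"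

lemma attach_inj: "g \<in> edges F \<Longrightarrow> inj_on (att g) (verts F)"
  using tau[of g] by (auto simp: inj_on_def attach_map_def bij_betw_def)

lemma attach_f: "g \<in> edges F \<Longrightarrow> att g ` f = Inl ` g"
proof -
  assume "g \<in> edges F"
  then have "\<tau> g ` f = g" using tau by (auto simp: bij_betw_def)
  moreover have "att g ` f = Inl ` (\<tau> g ` f)" by (auto simp: attach_map_def)
  ultimately show ?thesis by simp
qed

lemma attach_other:
  assumes "h \<in> edges F" "h \<noteq> f"
  obtains w where "w \<in> h" "w \<notin> f" "att g w = Inr (g, w)"
proof -
  have "\<not> h \<subseteq> f" using assms edge_F f_edge by (metis card.infinite card_subset_eq zero_neq_numeral)
  then show ?thesis using that by (auto simp: attach_map_def)
qed

lemma edges_H: "edges H = (\<Union>g\<in>edges F. part g)"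
proof -
  have "Inl ` g \<in> part g" if "g \<in> edges F" for g
    using imageI[OF f_edge, of "\<lambda>e. att g ` e"] attach_f[OF that] by (simp add: part_def)
  then show ?thesis unfolding H_def otimes1_def part_def by auto
qed

lemma verts_H: "verts H = Inl ` verts F \<union> Inr ` (edges F \<times> (verts F - f))"
proof -
  have "att g w \<in> Inl ` verts F \<union> Inr ` (edges F \<times> (verts F - f))" if "g \<in> edges F" "w \<in> verts F" for g w
    using that tau[OF that(1)] edge_F(2)[OF that(1)] by (auto simp: attach_map_def bij_betw_def)
  moreover have "Inr (g, w) \<in> att g ` verts F" if "w \<in> verts F - f" for g w
    using that by (auto simp: attach_map_def image_iff)
  ultimately show ?thesis unfolding H_def otimes1_def by auto
qed

lemma fin_H: "finite (verts H)"
  unfolding verts_H using fin_F by simp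

text \<open>An edge that is not the image of \<open>f\<close> has a new vertex, which carries the
  label \<open>g\<close>; the image of \<open>f\<close> is \<open>g\<close> itself.\<close>

lemma part_disjoint:
  assumes "g \<in> edges F" "g' \<in> edges F" "g \<noteq> g'" shows "part g \<inter> part g' = {}"
proof (rule ccontr)
  assume "part g \<inter> part g' \<noteq> {}"
  then obtain h h' where h: "h \<in> edges F" "h' \<in> edges F" "att g ` h = att g' ` h'" by (auto simp: part_def)
  show False
  proof (cases "h = f")
    case True
    have "h' = f"
    proof (rule ccontr)
      assume "h' \<noteq> f"
      then obtain w where "w \<in> h'" "att g' w = Inr (g', w)" using attach_other[OF h(2)] by blast
      then have "Inr (g', w) \<in> att g ` f" using h(3) True by (metis imageI)
      then show False unfolding attach_f[OF assms(1)] by auto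
    qed
    then have "(Inl ` g :: ('a + ('a set \<times> 'a)) set) = Inl ` g'" using h(3) True attach_f assms by simp
    then show False using assms(3) by (auto dest: inj_image_eq_iff[THEN iffD1, rotated])
  next
    case False
    then obtain w where w: "w \<in> h" "att g w = Inr (g, w)" using attach_other[OF h(1)] by blast
    then have "Inr (g, w) \<in> att g' ` h'" using h(3) by (metis imageI)
    then show False using assms(3) by (auto simp: attach_map_def split: if_splits)
  qed
qed

lemma card_part: "g \<in> edges F \<Longrightarrow> card (part g) = card (edges F)"
  unfolding part_def using attach_inj by (intro card_img[of _ "verts F"]) (auto simp: Union_F)

lemma finite_part: "finite (part g)"
  using fin_F by (simp add: part_def)

lemma finite_edges_H: "finite (edges H)"
  unfolding edges_H using fin_F finite_part by auto

lemma card_edges_H: "card (edges H) = card (edges F) ^ 2"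
proof -
  have "card (edges H) = (\<Sum>g\<in>edges F. card (part g))"
    unfolding edges_H using fin_F part_disjoint finite_part by (intro card_UN_disjoint) auto
  then show ?thesis by (simp add: card_part power2_eq_square)
qed

lemma card_verts_H: "card (verts H) = card (verts F) + card (edges F) * (card (verts F) - 2)"
proof -
  have ff: "f \<subseteq> verts F" "card f = 2" using f_edge edge_F by auto
  then have "finite f" using fin_F finite_subset by blast
  have "card (verts H) = card ((Inl ` verts F) :: ('a + ('a set \<times> 'a)) set) + card ((Inr ` (edges F \<times> (verts F - f))) :: ('a + ('a set \<times> 'a)) set)"
    unfolding verts_H using fin_F by (intro card_Un_disjoint) auto
  then show ?thesis using fin_F ff \<open>finite f\<close> by (simp add: card_image card_cartesian_product card_Diff_subset)
qed

lemma edge_H: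
  assumes "h \<in> edges H" shows "card h = 2" "h \<subseteq> verts H"
proof -
  obtain g h' where gh: "g \<in> edges F" "h' \<in> edges F" "h = att g ` h'" using assms unfolding edges_H part_def by auto
  have "inj_on (att g) h'" using inj_on_subset[OF attach_inj[OF gh(1)] edge_F(2)[OF gh(2)]] .
  then show "card h = 2" using gh edge_F(1) by (simp add: card_image)
  have "att g ` verts F \<subseteq> verts H" using gh(1) unfolding H_def otimes1_def by auto
  then show "h \<subseteq> verts H" using gh edge_F(2) by blast
qed

text \<open>\<open>J\<close> is cut into central edges \<open>Jc\<close> and edges
  \<open>Jg g\<close> of the attached copies, its vertices into central ones \<open>C\<close> and
  new ones \<open>N g\<close>. Attached copies have at most \<open>d\<close> edges per new vertex.
  The constants 1 and 2 come from \<open>Jc\<close> if it is nonempty, from two central vertices if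
  there are such, and otherwise from one attached copy.\<close>

lemma H_sub_density:
  assumes J: "J \<subseteq> edges H" "J \<noteq> {}"
  shows "real (card J) - 1 \<le> d * (real (card (\<Union>J)) - 2)"
proof -
  let ?E = "edges F"
  have fJ: "finite J" using J finite_edges_H finite_subset by blast
  have UJ: "\<Union>J \<subseteq> verts H" using J edge_H(2) by auto
  then have fUJ: "finite (\<Union>J)" using fin_H finite_subset by blast
  define N where "N g = {x \<in> \<Union>J. \<exists>w. x = Inr (g, w)}" for g
  define Jg where "Jg g = img (att g) {h \<in> ?E - {f}. att g ` h \<in> J}" for g
  define Jc where "Jc = {g \<in> ?E. Inl ` g \<in> J}"
  define IJ :: "('a + ('a set \<times> 'a)) set set" where "IJ = img Inl Jc"
  define C where "C = {x. Inl x \<in> \<Union>J}"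
  have fN: "finite (N g)" for g by (rule finite_subset[OF _ fUJ]) (auto simp: N_def)
  have fC: "finite C" unfolding C_def using finite_vimageI[OF fUJ inj_Inl] by (simp add: vimage_def)
  have fJc: "finite Jc" "Jc \<subseteq> ?E" using fin_F by (auto simp: Jc_def)
  have cov: "J \<subseteq> IJ \<union> (\<Union>g\<in>?E. Jg g)"
  proof
    fix x assume x: "x \<in> J"
    then obtain g h where gh: "g \<in> ?E" "h \<in> ?E" "x = att g ` h" using J unfolding edges_H part_def by blast
    show "x \<in> IJ \<union> (\<Union>g\<in>?E. Jg g)"
    proof (cases "h = f")
      case True
      then have "x = Inl ` g" using gh attach_f by simp
      then show ?thesis using x gh(1) by (auto simp: Jc_def IJ_def)
    next
      case False
      then show ?thesis using x gh unfolding Jg_def by blast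
    qed
  qed
  have cardJ: "card J \<le> card Jc + (\<Sum>g\<in>G. card (Jg g)) + card (\<Union>g\<in>?E - G. Jg g)" if "G \<subseteq> ?E" for G
  proof -
    have fJg: "finite (Jg g)" for g using fin_F by (simp add: Jg_def)
    have fG: "finite G" using that fin_F finite_subset by blast
    have "(\<Union>g\<in>?E. Jg g) = (\<Union>g\<in>G. Jg g) \<union> (\<Union>g\<in>?E - G. Jg g)" using that by auto
    then have "card J \<le> card (IJ \<union> ((\<Union>g\<in>G. Jg g) \<union> (\<Union>g\<in>?E - G. Jg g)))"
      using cov fJc fin_F fG fJg by (intro card_mono) (auto simp: IJ_def)
    also have "\<dots> \<le> card IJ + card ((\<Union>g\<in>G. Jg g) \<union> (\<Union>g\<in>?E - G. Jg g))" by (rule card_Un_le)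
    also have "card IJ \<le> card Jc" unfolding IJ_def using fJc by (intro card_image_le) auto
    also have "card ((\<Union>g\<in>G. Jg g) \<union> (\<Union>g\<in>?E - G. Jg g)) \<le> card (\<Union>g\<in>G. Jg g) + card (\<Union>g\<in>?E - G. Jg g)" by (rule card_Un_le)
    also have "card (\<Union>g\<in>G. Jg g) \<le> (\<Sum>g\<in>G. card (Jg g))" using fG by (rule card_UN_le)
    finally show ?thesis by simp
  qed
  \<comment> \<open>\<open>sub_density\<close> is applied after adding \<open>f\<close>: this edge
    and its two ends cancel the constants.\<close>
  have jN: "real (card (Jg g)) \<le> d * real (card (N g))" if g: "g \<in> ?E" for g
  proof -
    define T where "T = {h \<in> ?E - {f}. att g ` h \<in> J}"
    have fT: "finite T" "T \<subseteq> ?E" "f \<notin> T" using fin_F by (auto simp: T_def)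
    have "card (Jg g) \<le> card T" unfolding Jg_def T_def[symmetric] using fT by (intro card_image_le)
    moreover have "real (card (insert f T)) - 1 \<le> d * (real (card (\<Union>(insert f T))) - 2)"
      using fT f_edge by (intro sub_density) auto
    moreover have "card (\<Union>(insert f T)) \<le> 2 + card (N g)"
    proof -
      have "\<Union>(insert f T) \<subseteq> f \<union> {w. Inr (g, w) \<in> N g}"
      proof
        fix w assume w: "w \<in> \<Union>(insert f T)"
        show "w \<in> f \<union> {w. Inr (g, w) \<in> N g}"
        proof (cases "w \<in> f")
          case False
          then obtain h where h: "h \<in> T" "w \<in> h" using w by auto
          then have "att g w \<in> \<Union>J" by (auto simp: T_def)
          then show ?thesis using False by (auto simp: attach_map_def N_def)
        qed simp
      qed
      moreover have inj: "inj_on (\<lambda>w. Inr (g, w) :: 'a + ('a set \<times> 'a)) A" for A by (auto simp: inj_on_def)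
      have fin: "finite {w. Inr (g, w) \<in> N g}"
        using finite_vimage_IntI[OF fN[of g] inj[of UNIV]] by (simp add: vimage_def)
      moreover have "card {w. Inr (g, w) \<in> N g} \<le> card (N g)"
        by (rule card_inj_on_le[OF inj _ fN]) auto
      moreover have "card f = 2" "f \<subseteq> verts F" using f_edge edge_F by auto
      moreover have "finite f" using calculation(5) fin_F finite_subset by blast
      ultimately have "card (\<Union>(insert f T)) \<le> card (f \<union> {w. Inr (g, w) \<in> N g})" by (intro card_mono) auto
      also have "\<dots> \<le> card f + card {w. Inr (g, w) \<in> N g}" by (rule card_Un_le)
      finally show ?thesis using \<open>card f = 2\<close> \<open>card {w. Inr (g, w) \<in> N g} \<le> card (N g)\<close> by simp
    qed
    then have "d * (real (card (\<Union>(insert f T))) - 2) \<le> d * real (card (N g))"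
      using size_F(3) by (intro mult_left_mono) auto
    ultimately show ?thesis using fT by simp
  qed
  have cU: "real (card C) + (\<Sum>g\<in>?E. real (card (N g))) \<le> real (card (\<Union>J))"
  proof -
    have "card ((Inl ` C :: ('a + ('a set \<times> 'a)) set) \<union> (\<Union>g\<in>?E. N g)) \<le> card (\<Union>J)"
      using fUJ by (intro card_mono) (auto simp: C_def N_def)
    moreover have "card ((Inl ` C :: ('a + ('a set \<times> 'a)) set) \<union> (\<Union>g\<in>?E. N g)) = card (Inl ` C :: ('a + ('a set \<times> 'a)) set) + card (\<Union>g\<in>?E. N g)"
      using fC fN fin_F by (intro card_Un_disjoint) (auto simp: N_def)
    moreover have "card (\<Union>g\<in>?E. N g) = (\<Sum>g\<in>?E. card (N g))"
      using fN fin_F by (intro card_UN_disjoint) (auto simp: N_def)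
    ultimately have "card C + (\<Sum>g\<in>?E. card (N g)) \<le> card (\<Union>J)" by (simp add: card_image)
    then show ?thesis by (simp flip: of_nat_sum of_nat_add)
  qed
  have sumN: "(\<Sum>g\<in>G. real (card (Jg g))) \<le> d * (\<Sum>g\<in>G. real (card (N g)))" if "G \<subseteq> ?E" for G
    unfolding sum_distrib_left using jN that by (intro sum_mono) auto
  have dmono: "d * a \<le> d * b" if "a \<le> b" for a b using that size_F(3) by (intro mult_left_mono) auto
  show ?thesis
  proof (cases "Jc = {}")
    case False
    have "\<Union>Jc \<subseteq> C" by (auto simp: Jc_def C_def)
    then have "card (\<Union>Jc) \<le> card C" using fC by (intro card_mono)
    then have "real (card Jc) - 1 \<le> d * (real (card C) - 2)"
      using sub_density[OF fJc(2) False] dmono[of "real (card (\<Union>Jc)) - 2" "real (card C) - 2"] by simp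
    moreover have "real (card J) \<le> real (card Jc) + (\<Sum>g\<in>?E. real (card (Jg g)))"
      using cardJ[of ?E] by (simp flip: of_nat_sum of_nat_add)
    ultimately have "real (card J) - 1 \<le> d * (real (card C) - 2) + d * (\<Sum>g\<in>?E. real (card (N g)))"
      using sumN[of ?E] by simp
    also have "\<dots> = d * (real (card C) + (\<Sum>g\<in>?E. real (card (N g))) - 2)" by (simp add: algebra_simps)
    also have "\<dots> \<le> d * (real (card (\<Union>J)) - 2)" using cU by (intro dmono) simp
    finally show ?thesis .
  next
    case Jc: True
    show ?thesis
    proof (cases "2 \<le> card C")
      case True
      have "real (card J) \<le> (\<Sum>g\<in>?E. real (card (Jg g)))"
        using cardJ[of ?E] Jc by (simp flip: of_nat_sum of_nat_add)
      also have "\<dots> \<le> d * (\<Sum>g\<in>?E. real (card (N g)))" by (rule sumN) simp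
      also have "\<dots> \<le> d * (real (card (\<Union>J)) - 2)" using cU True by (intro dmono) simp
      finally show ?thesis by simp
    next
      case False
      \<comment> \<open>With at most one central vertex, one nonempty attached copy is estimated
        without adding \<open>f\<close> and so supplies the constants; the others are treated as
        before.\<close>
      obtain x where "x \<in> J" using J by blast
      then obtain g where g: "g \<in> ?E" "x \<in> Jg g" using cov Jc by (auto simp: IJ_def)
      define T where "T = {h \<in> ?E - {f}. att g ` h \<in> J}"
      have T: "T \<subseteq> ?E" "T \<noteq> {}" "finite T" using g fin_F by (auto simp: T_def Jg_def)
      have "card (Jg g) \<le> card T" unfolding Jg_def T_def[symmetric] using T by (intro card_image_le)
      moreover have "card (\<Union>T) \<le> card C + card (N g)"
      proof -
        have "att g ` \<Union>T \<subseteq> Inl ` C \<union> N g"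
        proof
          fix y assume "y \<in> att g ` \<Union>T"
          then obtain w h where w: "h \<in> T" "w \<in> h" "y = att g w" by auto
          then have "y \<in> \<Union>J" by (auto simp: T_def)
          then show "y \<in> Inl ` C \<union> N g"
            using w(3) by (cases "w \<in> f") (auto simp: C_def N_def attach_map_def intro!: imageI)
        qed
        then have "card (att g ` \<Union>T) \<le> card ((Inl ` C :: ('a + ('a set \<times> 'a)) set) \<union> N g)"
          using fC fN by (intro card_mono) auto
        also have "\<dots> \<le> card (Inl ` C :: ('a + ('a set \<times> 'a)) set) + card (N g)" by (rule card_Un_le)
        also have "card (att g ` \<Union>T) = card (\<Union>T)"
          using T(1) edge_F(2) by (intro card_image inj_on_subset[OF attach_inj[OF g(1)]]) auto
        finally show ?thesis by (simp add: card_image)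
      qed
      ultimately have "real (card (Jg g)) - 1 \<le> d * (real (card C) + real (card (N g)) - 2)"
        using sub_density[OF T(1,2)] dmono[of "real (card (\<Union>T)) - 2" "real (card C) + real (card (N g)) - 2"] by simp
      moreover have "real (card J) \<le> real (card (Jg g)) + (\<Sum>g\<in>?E - {g}. real (card (Jg g)))"
        using cardJ[of ?E] Jc g(1) fin_F by (simp add: sum.remove[of _ g] flip: of_nat_sum of_nat_add)
      moreover have "(\<Sum>g\<in>?E - {g}. real (card (Jg g))) \<le> d * (\<Sum>g\<in>?E - {g}. real (card (N g)))" by (rule sumN) auto
      ultimately have "real (card J) - 1 \<le> d * (real (card C) + real (card (N g)) - 2) + d * (\<Sum>g\<in>?E - {g}. real (card (N g)))" by simp
      also have "\<dots> = d * (real (card C) + (\<Sum>g\<in>?E. real (card (N g))) - 2)"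
        using g(1) fin_F by (simp add: sum.remove[of _ g] algebra_simps)
      also have "\<dots> \<le> d * (real (card (\<Union>J)) - 2)" using cU by (intro dmono) simp
      finally show ?thesis .
    qed
  qed
qed

lemma graph_H: "is_graph H"
  using fin_H edge_H by (auto simp: is_graph_def)

text \<open>\<open>H\<close> attains the bound of \<open>H_sub_density\<close>: with
  \<open>e\<close> edges and \<open>v\<close> vertices in \<open>F\<close>, passing from
  \<open>F\<close> to \<open>H\<close> multiplies both \<open>e - 1\<close> and \<open>v - 2\<close>
  by \<open>e + 1\<close>.\<close>

lemma m2_H: "m2 H = d"
  unfolding m2_def
proof (rule Max_eqI)
  show "finite (d2 ` subgraphs H)" using finite_subgraphs[OF graph_H] by simp
  fix y assume "y \<in> d2 ` subgraphs H"
  then obtain U J where UJ: "y = d2 (U, J)" "(U, J) \<in> subgraphs H" by auto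
  then have sub: "J \<subseteq> edges H" "\<Union>J \<subseteq> U" "finite U" by (auto simp: subgraphs_def is_graph_def)
  show "y \<le> d"
  proof (cases "J = {} \<or> card J = 1")
    case True
    then show ?thesis using UJ(1) size_F(3) by (auto simp: d2_def)
  next
    case False
    have fJ: "finite J" using sub finite_edges_H finite_subset by blast
    then have "card J \<noteq> 0" using False by simp
    then have c2: "2 \<le> card J" using False by simp
    have c3: "3 \<le> card (\<Union>J)" using sub edge_H by (intro card_Union_ge3[OF fJ _ c2]) auto
    have cU: "card (\<Union>J) \<le> card U" using sub by (intro card_mono) auto
    have "real (card J) - 1 \<le> d * (real (card (\<Union>J)) - 2)" using H_sub_density[OF sub(1)] False by simp
    also have "\<dots> \<le> d * (real (card U) - 2)" using cU size_F(3) by (intro mult_left_mono) auto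
    finally show ?thesis using UJ(1) False c3 cU by (simp add: d2_def pos_divide_le_eq)
  qed
next
  have e: "real (card (edges H)) = real (card (edges F)) ^ 2" by (simp add: card_edges_H)
  have v: "real (card (verts H)) = real (card (verts F)) + real (card (edges F)) * (real (card (verts F)) - 2)"
    using size_F(2) by (simp add: card_verts_H of_nat_diff)
  have "card (edges F) * 1 < card (edges F) * card (edges F)" using size_F(1) by (intro mult_strict_left_mono) auto
  then have c1: "card (edges H) \<noteq> 1" "edges H \<noteq> {}" using size_F(1) card_edges_H by (auto simp: power2_eq_square)
  have "real (card (edges H)) - 1 = (real (card (edges F)) - 1) * (real (card (edges F)) + 1)"
    unfolding e by (simp add: power2_eq_square algebra_simps)
  also have "\<dots> = d * (real (card (verts H)) - 2)"
    unfolding tight_F v by (simp add: algebra_simps)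
  finally have eq: "real (card (edges H)) - 1 = d * (real (card (verts H)) - 2)" .
  have "3 \<le> card (verts H)" using size_F(2) by (simp add: card_verts_H)
  then have "d2 H = d" using eq c1 by (simp add: d2_def)
  then show "d \<in> d2 ` subgraphs H" using self_in_subgraphs[OF graph_H] by (metis imageI)
qed

section \<open>Partial copies of \<open>H\<close> in the first graph\<close>

text \<open>All vertices of \<open>H\<close> are placed, even those outside
  \<open>\<Union>J\<close>, since the edges outside \<open>J\<close> are to come from the second
  random graph. Hence the scale \<open>n ^ card (verts H) * p ^ card J\<close>.\<close>

definition placements :: "nat \<Rightarrow> ('a + ('a set \<times> 'a)) set set \<Rightarrow> nat ugraph \<Rightarrow> (('a + ('a set \<times> 'a)) \<Rightarrow> nat) set" where
  "placements n J G = {\<phi> \<in> embeddings n (verts H). img \<phi> J \<subseteq> edges G}"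

lemma Union_sub_H: "J \<subseteq> edges H \<Longrightarrow> \<Union>J \<subseteq> verts H"
  using edge_H(2) by blast

text \<open>An overlap in the edges \<open>I\<close> and the vertices \<open>U\<close> saves the
  factor \<open>n ^ card U * p ^ card I\<close>, which is at least of order \<open>n\<close>: by
  \<open>H_sub_density\<close>, \<open>card U - card I / d \<ge> 2 - 1 / d \<ge> 1\<close>. So the
  second moment method fails with probability of order \<open>1 / n\<close> only.\<close>

lemma placements_whp:
  assumes n1: "1 \<le> n" and c: "0 < c" "c \<le> 1" and p: "p = c * real n powr (- 1 / d)" and J: "J \<subseteq> edges H"
  shows "bg_prob n p {G. real (card (placements n J G)) > 2 * (real n ^ card (verts H) * p ^ card J)}
    \<le> 2 ^ card (verts H) * real (card (verts H)) ^ card (verts H) / c ^ card J / real n"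
proof -
  let ?V = "verts H"
  let ?A = "embeddings n ?V"
  let ?l = "real n ^ card ?V * p ^ card J"
  let ?\<beta> = "?l / (c ^ card J * real n)"
  let ?C = "2 ^ card ?V * real (card ?V) ^ card ?V"
  have np: "0 < real n" using n1 by simp
  have p0: "0 < p" using c np by (simp add: p)
  have "real n powr (- 1 / d) \<le> 1" using powr_mono[of "- 1 / d" 0 "real n"] n1 size_F(3) by simp
  then have p1: "p \<le> 1" using c by (simp add: p mult_le_one)
  have fA: "finite ?A" using finite_embeddings[OF fin_H] .
  have fJ: "finite J" using J finite_edges_H finite_subset by blast
  have UJ: "\<Union>J \<subseteq> ?V" using Union_sub_H[OF J] .
  have ci: "card (img \<phi> J) = card J" if "\<phi> \<in> ?A" for \<phi>
    using that UJ by (intro card_img[of _ ?V]) (auto simp: embeddings_def)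
  have l0: "0 < ?l" using np p0 by simp
  have "(\<Sum>\<phi>\<in>?A. p ^ card (img \<phi> J)) = real (card ?A) * p ^ card J" using ci by simp
  also have "\<dots> \<le> ?l"
    using card_embeddings[OF fin_H, of n] p0 by (intro mult_right_mono) (simp_all flip: of_nat_power)
  finally have sum1: "(\<Sum>\<phi>\<in>?A. p ^ card (img \<phi> J)) \<le> ?l" .
  have inner: "(\<Sum>\<psi>\<in>{\<psi> \<in> ?A. img \<phi> J \<inter> img \<psi> J \<noteq> {}}. p ^ card (img \<phi> J \<union> img \<psi> J)) \<le> p ^ card J * (?C * ?\<beta>)"
    if phi: "\<phi> \<in> ?A" for \<phi>
  proof -
    let ?B = "{\<psi> \<in> ?A. img \<phi> J \<inter> img \<psi> J \<noteq> {}}"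
    let ?T = "img \<phi> J"
    have inj: "inj_on \<phi> ?V" using phi by (simp add: embeddings_def)
    have cW: "card (\<phi> ` ?V) = card ?V" using card_image[OF inj] .
    have "p ^ card (?T \<union> img \<psi> J) = p ^ card J * p ^ card (img \<psi> J - ?T)" for \<psi>
    proof -
      have "card (?T \<union> (img \<psi> J - ?T)) = card ?T + card (img \<psi> J - ?T)"
        using fJ by (intro card_Un_disjoint) auto
      then show ?thesis unfolding Un_Diff_cancel ci[OF phi] by (simp only: power_add)
    qed
    then have "(\<Sum>\<psi>\<in>?B. p ^ card (?T \<union> img \<psi> J)) = p ^ card J * (\<Sum>\<psi>\<in>?B. p ^ card (img \<psi> J - ?T))"
      by (simp add: sum_distrib_left)
    also have "(\<Sum>\<psi>\<in>?B. p ^ card (img \<psi> J - ?T)) \<le> 2 ^ card ?V * real (card (\<phi> ` ?V)) ^ card ?V * ?\<beta>"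
    proof (rule extension_sum[OF fin_H _ _ n1])
      show "finite (\<phi> ` ?V)" using fin_H by simp
      have "verts H \<noteq> {}" using size_F(2) by (auto simp: verts_H)
      then show "1 \<le> card (\<phi> ` ?V)" unfolding cW using fin_H by (simp add: Suc_le_eq card_gt_0_iff)
      show "0 \<le> ?\<beta>" using l0 c np by simp
      fix \<psi> assume psi: "\<psi> \<in> ?B"
      then have injp: "inj_on \<psi> ?V" by (simp add: embeddings_def)
      define I where "I = {f \<in> J. \<psi> ` f \<in> ?T}"
      define U where "U = {u \<in> ?V. \<psi> u \<in> \<phi> ` ?V}"
      obtain g where "g \<in> img \<phi> J" "g \<in> img \<psi> J" using psi by blast
      then obtain f0 where "f0 \<in> J" "\<psi> ` f0 \<in> ?T" by (metis imageE)
      then have I0: "I \<noteq> {}" "I \<subseteq> J" unfolding I_def by blast+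
      have fU: "finite U" "U \<subseteq> ?V" using fin_H by (auto simp: U_def)
      have "\<Union>I \<subseteq> U"
      proof
        fix u assume "u \<in> \<Union>I"
        then obtain f where f: "f \<in> J" "u \<in> f" "\<psi> ` f \<in> ?T" by (auto simp: I_def)
        then obtain f' where "f' \<in> J" "\<psi> ` f = \<phi> ` f'" by auto
        then have "\<psi> u \<in> \<phi> ` ?V" using f UJ by blast
        then show "u \<in> U" using f UJ by (auto simp: U_def)
      qed
      then have cIU: "card (\<Union>I) \<le> card U" using fU by (intro card_mono)
      have cU: "card U \<le> card ?V" using fU fin_H card_mono by blast
      have cI: "card I \<le> card J" using I0 fJ card_mono by blast
      have "real (card I) - 1 \<le> d * (real (card (\<Union>I)) - 2)" using I0 J by (intro H_sub_density) auto
      also have "\<dots> \<le> d * (real (card U) - 2)" using cIU size_F(3) by (intro mult_left_mono) auto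
      finally have "(real (card I) - 1) / d \<le> real (card U) - 2"
        using size_F(3) by (simp add: pos_divide_le_eq mult.commute)
      moreover have "1 / d \<le> 1" using size_F(3) by simp
      ultimately have ge1: "1 \<le> real (card U) - real (card I) / d" by (simp add: diff_divide_distrib)
      have "c ^ card J * real n \<le> c ^ card I * real n powr (real (card U) - real (card I) / d)"
      proof (rule mult_mono)
        show "c ^ card J \<le> c ^ card I" using c cI by (intro power_decreasing) auto
        show "real n \<le> real n powr (real (card U) - real (card I) / d)"
          using powr_mono[OF ge1, of "real n"] n1 by simp
      qed (use c in auto)
      also have "\<dots> = real n ^ card U * p ^ card I" unfolding p by (rule power_scale[OF n1, symmetric])
      finally have low: "c ^ card J * real n \<le> real n ^ card U * p ^ card I" .
      have "card (img \<psi> J - ?T) = card J - card I" unfolding I_def by (rule card_img_diff[OF injp UJ fJ])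
      then have "real n ^ (card ?V - card U) * p ^ card (img \<psi> J - ?T) * (real n ^ card U * p ^ card I) = ?l"
        using cU cI by (simp add: mult_ac flip: power_add)
      moreover have "real n ^ (card ?V - card U) * p ^ card (img \<psi> J - ?T) * (c ^ card J * real n)
          \<le> real n ^ (card ?V - card U) * p ^ card (img \<psi> J - ?T) * (real n ^ card U * p ^ card I)"
        using low p0 by (intro mult_left_mono) auto
      ultimately have "real n ^ (card ?V - card U) * p ^ card (img \<psi> J - ?T) * (c ^ card J * real n) \<le> ?l" by simp
      then show "real n ^ (card ?V - card {u \<in> ?V. \<psi> u \<in> \<phi> ` ?V}) * p ^ card (img \<psi> J - ?T) \<le> ?\<beta>"
        unfolding U_def[symmetric] using c np by (simp add: pos_le_divide_eq)
    qed (use p0 in auto)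
    finally show ?thesis unfolding cW using p0 by (simp add: mult_left_mono)
  qed
  have "bg_prob n p {G. real (card {\<phi> \<in> ?A. img \<phi> J \<subseteq> edges G}) > 2 * ?l}
    \<le> (\<Sum>\<phi>\<in>?A. \<Sum>\<psi>\<in>{\<psi> \<in> ?A. img \<phi> J \<inter> img \<psi> J \<noteq> {}}. p ^ card (img \<phi> J \<union> img \<psi> J)) / ?l\<^sup>2"
    using p0 p1 l0 sum1 UJ edge_H(1) J by (intro second_moment_bound fA img_all_pairs) auto
  also have "\<dots> \<le> (\<Sum>\<phi>\<in>?A. p ^ card J * (?C * ?\<beta>)) / ?l\<^sup>2"
    using inner by (intro divide_right_mono sum_mono) auto
  also have "\<dots> = real (card ?A) * (p ^ card J * (?C * ?\<beta>)) / ?l\<^sup>2" by simp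
  also have "\<dots> \<le> real n ^ card ?V * (p ^ card J * (?C * ?\<beta>)) / ?l\<^sup>2"
    using card_embeddings[OF fin_H, of n] p0 l0 c by (intro divide_right_mono mult_right_mono) (simp_all flip: of_nat_power)
  also have "real n ^ card ?V * (p ^ card J * (?C * ?\<beta>)) = ?l\<^sup>2 * (?C / c ^ card J / real n)"
    by (simp add: power2_eq_square)
  also have "?l\<^sup>2 * (?C / c ^ card J / real n) / ?l\<^sup>2 = ?C / c ^ card J / real n"
    using zero_less_power[OF l0, of 2] by (intro nonzero_mult_div_cancel_left) (metis less_irrefl)
  finally show ?thesis by (simp add: placements_def)
qed

text \<open>\<open>J\<close> stands for the edges of a copy of \<open>H\<close> that are present in
  the first graph.\<close>

definition sparse_missing :: "('a + ('a set \<times> 'a)) set set set" where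
  "sparse_missing = {J. J \<subseteq> edges H \<and> card (edges F) \<le> card (edges H - J)}"

lemma finite_sparse_missing: "finite sparse_missing"
  by (rule finite_subset[of _ "Pow (edges H)"]) (auto simp: sparse_missing_def finite_edges_H)

text \<open>At least one edge of each of the \<open>card (edges F)\<close> edge-disjoint attached copies is missing
  from \<open>J\<close>; the extremal case, one missing edge per copy, gives exactly \<open>n ^ v(F) * \<theta> ^ e(F)\<close>.\<close>

lemma placements_weight:
  assumes n1: "1 \<le> n" and c: "0 < c" "c \<le> 1" and p: "p = c * real n powr (- 1 / d)"
    and cnt: "\<And>J. J \<subseteq> edges H \<Longrightarrow> real (card (placements n J G)) \<le> 2 * (real n ^ card (verts H) * p ^ card J)"
    and theta: "0 \<le> \<theta>" "\<theta> \<le> p"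
  shows "(\<Sum>J\<in>sparse_missing. \<Sum>\<phi>\<in>placements n J G. \<theta> ^ card (edges H - J))
    \<le> 2 ^ (card (edges H) + 1) * (real n ^ card (verts F) * \<theta> ^ card (edges F))"
proof -
  let ?e = "card (edges F)"
  have p0: "0 \<le> p" using theta by simp
  have eH: "card (edges H) = ?e + ?e * (?e - 1)"
    using size_F(1) by (simp add: card_edges_H power2_eq_square algebra_simps diff_mult_distrib2)
  \<comment> \<open>With \<open>e\<close> edges and \<open>v\<close> vertices in \<open>F\<close>,
    the \<open>e * (v - 2)\<close> new vertices of \<open>H\<close> are paid for by
    \<open>e * (e - 1)\<close> edges of density \<open>p\<close>, since
    \<open>d * (v - 2) = e - 1\<close>.\<close>
  have scale: "real n ^ card (verts H) * p ^ (?e * (?e - 1)) \<le> real n ^ card (verts F)"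
  proof -
    have vF: "real (card (verts H)) = real (card (verts F)) + real ?e * (real (card (verts F)) - 2)"
      using size_F(2) by (simp add: card_verts_H of_nat_diff)
    have "real (?e * (?e - 1)) / d = real ?e * (real (card (verts F)) - 2)"
      using size_F tight_F by (simp add: of_nat_diff)
    then have "real n ^ card (verts H) * p ^ (?e * (?e - 1)) = c ^ (?e * (?e - 1)) * real n powr (real (card (verts F)))"
      unfolding p power_scale[OF n1] vF by simp
    also have "\<dots> \<le> 1 * real n powr (real (card (verts F)))" using c by (intro mult_right_mono power_le_one) auto
    finally show ?thesis using n1 by (simp add: powr_realpow)
  qed
  have summand: "(\<Sum>\<phi>\<in>placements n J G. \<theta> ^ card (edges H - J)) \<le> 2 * (real n ^ card (verts F) * \<theta> ^ ?e)"
    if J: "J \<in> sparse_missing" for J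
  proof -
    have JE: "J \<subseteq> edges H" "?e \<le> card (edges H - J)" using J by (auto simp: sparse_missing_def)
    have "card (edges H - J) = card (edges H) - card J" "card J \<le> card (edges H)"
      using JE finite_edges_H finite_subset[OF JE(1)] by (auto simp: card_Diff_subset card_mono)
    then have s: "card J + (card (edges H - J) - ?e) = ?e * (?e - 1)" using JE(2) eH by linarith
    have "\<theta> ^ card (edges H - J) = \<theta> ^ ?e * \<theta> ^ (card (edges H - J) - ?e)" using JE(2) by (simp flip: power_add)
    \<comment> \<open>Missing edges beyond the first \<open>?e\<close> are charged \<open>p\<close>
      instead of \<open>\<theta>\<close>, which reduces everything to the extremal case.\<close>
    also have "\<dots> \<le> \<theta> ^ ?e * p ^ (card (edges H - J) - ?e)" using theta by (intro mult_left_mono power_mono) auto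
    finally have th: "\<theta> ^ card (edges H - J) \<le> \<theta> ^ ?e * p ^ (card (edges H - J) - ?e)" .
    have "(\<Sum>\<phi>\<in>placements n J G. \<theta> ^ card (edges H - J)) = real (card (placements n J G)) * \<theta> ^ card (edges H - J)" by simp
    also have "\<dots> \<le> (2 * (real n ^ card (verts H) * p ^ card J)) * (\<theta> ^ ?e * p ^ (card (edges H - J) - ?e))"
      using cnt[OF JE(1)] th theta p0 by (intro mult_mono) auto
    also have "\<dots> = 2 * ((real n ^ card (verts H) * p ^ (?e * (?e - 1))) * \<theta> ^ ?e)"
      unfolding s[symmetric] power_add by simp
    also have "\<dots> \<le> 2 * (real n ^ card (verts F) * \<theta> ^ ?e)"
      using scale theta by (intro mult_left_mono mult_right_mono) auto
    finally show ?thesis .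
  qed
  have "card sparse_missing \<le> 2 ^ card (edges H)"
    using card_mono[of "Pow (edges H)" sparse_missing] finite_edges_H by (auto simp: sparse_missing_def card_Pow)
  then have cs: "real (card sparse_missing) \<le> 2 ^ card (edges H)"
    by (metis of_nat_le_iff of_nat_numeral of_nat_power)
  have "(\<Sum>J\<in>sparse_missing. \<Sum>\<phi>\<in>placements n J G. \<theta> ^ card (edges H - J))
      \<le> (\<Sum>J\<in>sparse_missing. 2 * (real n ^ card (verts F) * \<theta> ^ ?e))" by (rule sum_mono[OF summand])
  also have "\<dots> = real (card sparse_missing) * (2 * (real n ^ card (verts F) * \<theta> ^ ?e))" by simp
  also have "\<dots> \<le> 2 ^ card (edges H) * (2 * (real n ^ card (verts F) * \<theta> ^ ?e))"
    using cs theta by (intro mult_right_mono) auto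
  finally show ?thesis by simp
qed

lemma missing_edge_count:
  assumes J: "J \<subseteq> edges H" and miss: "\<And>g. g \<in> edges F \<Longrightarrow> \<not> part g \<subseteq> J"
  shows "J \<in> sparse_missing"
proof -
  have "\<forall>g\<in>edges F. \<exists>x. x \<in> part g - J" using miss by blast
  then obtain x where x: "\<And>g. g \<in> edges F \<Longrightarrow> x g \<in> part g - J" by metis
  have "inj_on x (edges F)"
  proof (rule inj_onI, rule ccontr)
    fix g g' assume g: "g \<in> edges F" "g' \<in> edges F" "x g = x g'" "g \<noteq> g'"
    then have "x g \<in> part g \<inter> part g'" using x by (metis DiffD1 IntI)
    then show False using part_disjoint[OF g(1,2,4)] by simp
  qed
  moreover have "x ` edges F \<subseteq> edges H - J" using x unfolding edges_H by blast
  ultimately have "card (edges F) \<le> card (edges H - J)"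
    using finite_edges_H by (intro card_inj_on_le[of x]) auto
  then show ?thesis using J by (simp add: sparse_missing_def)
qed

lemma mono_copy_embedding:
  assumes "has_mono_copy H G \<kappa>" "verts G = {..<n}"
  obtains \<phi> k where "\<phi> \<in> embeddings n (verts H)" "img \<phi> (edges H) \<subseteq> edges G" "\<And>e. e \<in> img \<phi> (edges H) \<Longrightarrow> \<kappa> e = k"
proof -
  obtain K k where K: "K \<in> subgraphs G" "isomorphic H K" "\<forall>e\<in>edges K. \<kappa> e = k"
    using assms(1) by (auto simp: has_mono_copy_def)
  obtain \<phi> where phi: "bij_betw \<phi> (verts H) (verts K)" "edges K = img \<phi> (edges H)"
    using K(2) by (auto simp: isomorphic_def)
  define \<phi>' where "\<phi>' = restrict \<phi> (verts H)"
  have "inj_on \<phi>' (verts H)" using phi(1) by (auto simp: \<phi>'_def bij_betw_def inj_on_def)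
  moreover have "\<phi>' ` verts H \<subseteq> {..<n}"
    using phi(1) K(1) assms(2) by (auto simp: \<phi>'_def bij_betw_def subgraphs_def)
  ultimately have emb: "\<phi>' \<in> embeddings n (verts H)" by (auto simp: embeddings_def \<phi>'_def image_subset_iff)
  have "\<phi>' ` e = \<phi> ` e" if "e \<in> edges H" for e
    using edge_H(2)[OF that] by (auto simp: \<phi>'_def intro!: image_cong)
  then have "img \<phi>' (edges H) = edges K" unfolding phi(2) by (rule image_cong[OF refl])
  then show ?thesis using that[OF emb] K by (auto simp: subgraphs_def)
qed

lemma core_copy_in_part:
  assumes S: "S \<subseteq> edges F" "sb_graph S d" and g: "g \<in> edges F" and phi: "\<phi> \<in> embeddings n (verts H)"
  obtains P where "P \<in> sb_graph.copies S" "P \<subseteq> img \<phi> (part g)"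
proof -
  have sub: "att g ` verts F \<subseteq> verts H" using g unfolding H_def otimes1_def by auto
  have "inj_on \<phi> (verts H)" using phi by (simp add: embeddings_def)
  then have "inj_on (\<phi> \<circ> att g) (verts F)" using attach_inj[OF g] sub inj_on_subset by (blast intro: comp_inj_on)
  moreover have "\<Union>S \<subseteq> verts F" using S(1) edge_F(2) by blast
  ultimately have "inj_on (\<phi> \<circ> att g) (\<Union>S)" using inj_on_subset by blast
  then have "img (\<phi> \<circ> att g) S \<in> sb_graph.copies S" unfolding sb_graph.copies_def[OF S(2)] by blast
  moreover have "img (\<phi> \<circ> att g) S \<subseteq> img \<phi> (part g)" 
  proof
    fix x assume "x \<in> img (\<phi> \<circ> att g) S"
    then obtain e where e: "e \<in> S" "x = \<phi> ` (att g ` e)" by (auto simp: image_comp)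
    then have "att g ` e \<in> part g" using S(1) by (auto simp: part_def)
    then show "x \<in> img \<phi> (part g)" using e by blast
  qed
  ultimately show ?thesis using that by blast
qed

section \<open>Extending the colouring\<close>

text \<open>Deterministic conditions on the first graph that do not mention \<open>q\<close>; the
  same sets serve two and three colours.\<close>

definition typical :: "'a set set \<Rightarrow> real \<Rightarrow> nat \<Rightarrow> nat ugraph set" where
  "typical S p n = {G. verts G = {..<n} \<and> edges G \<subseteq> all_pairs n \<and> sb_family.colourable (sb_graph.copies S) (edges G) \<and>
     (\<forall>J. J \<subseteq> edges H \<longrightarrow> real (card (placements n J G)) \<le> 2 * (real n ^ card (verts H) * p ^ card J))}"

lemma typical_whp:
  assumes S: "sb_graph S d"
  shows "\<exists>c0>0. c0 \<le> 1 \<and> (\<forall>c. 0 < c \<and> c < c0 \<longrightarrow>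
    (\<lambda>n. bg_prob n (c * real n powr (- 1 / d)) (typical S (c * real n powr (- 1 / d)) n)) \<longlonglongrightarrow> 1)"
proof -
  obtain c0 where c0: "0 < c0" "c0 \<le> 1" and col: "\<And>c. 0 < c \<Longrightarrow> c < c0 \<Longrightarrow>
     (\<lambda>n. bg_prob n (c * real n powr (- 1 / d)) {G. sb_family.colourable (sb_graph.copies S) (edges G)}) \<longlonglongrightarrow> 1"
    using sb_graph.whp_colourable[OF S] by blast
  have "(\<lambda>n. bg_prob n (c * real n powr (- 1 / d)) (typical S (c * real n powr (- 1 / d)) n)) \<longlonglongrightarrow> 1" if c: "0 < c" "c < c0" for c
  proof -
    define p where "p n = c * real n powr (- 1 / d)" for n
    define B where "B n J = {G. real (card (placements n J G)) > 2 * (real n ^ card (verts H) * p n ^ card J)}" for n J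
    define K where "K = {G :: nat ugraph. sb_family.colourable (sb_graph.copies S) (edges G)}"
    define b where "b J = 2 ^ card (verts H) * real (card (verts H)) ^ card (verts H) / c ^ card J" for J :: "('a + ('a set \<times> 'a)) set set"
    have low: "\<forall>\<^sub>F n in sequentially. bg_prob n (p n) K - (\<Sum>J\<in>Pow (edges H). b J / real n) \<le> bg_prob n (p n) (typical S (p n) n)"
      using eventually_ge_at_top[of 1]
    proof eventually_elim
      case (elim n)
      have "bg_prob n (p n) K \<le> bg_prob n (p n) (typical S (p n) n \<union> (\<Union>J\<in>Pow (edges H). B n J))"
        by (rule bg_prob_mono) (auto simp: K_def typical_def B_def not_less)
      also have "\<dots> \<le> bg_prob n (p n) (typical S (p n) n) + bg_prob n (p n) (\<Union>J\<in>Pow (edges H). B n J)"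
        by (rule measure_Un_le) auto
      also have "bg_prob n (p n) (\<Union>J\<in>Pow (edges H). B n J) \<le> (\<Sum>J\<in>Pow (edges H). bg_prob n (p n) (B n J))"
        using finite_edges_H by (intro measure_pmf.finite_measure_subadditive_finite) auto
      also have "\<dots> \<le> (\<Sum>J\<in>Pow (edges H). b J / real n)"
        unfolding B_def b_def using c c0 elim by (intro sum_mono placements_whp) (auto simp: p_def)
      finally show ?case by simp
    qed
    have "(\<lambda>n. b J / real n) \<longlonglongrightarrow> 0" for J by real_asymp
    then have "(\<lambda>n. \<Sum>J\<in>Pow (edges H). b J / real n) \<longlonglongrightarrow> (\<Sum>J\<in>Pow (edges H). 0)" by (intro tendsto_sum)
    then have "(\<lambda>n. bg_prob n (p n) K - (\<Sum>J\<in>Pow (edges H). b J / real n)) \<longlonglongrightarrow> 1 - 0"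
      using col[OF c] unfolding K_def p_def by (intro tendsto_diff) simp_all
    then have "(\<lambda>n. bg_prob n (p n) (typical S (p n) n)) \<longlonglongrightarrow> 1"
      by (intro tendsto_sandwich[OF low _ _ tendsto_const]) auto
    then show ?thesis by (simp add: p_def)
  qed
  then show ?thesis using c0 by blast
qed

text \<open>For fixed \<open>S\<close>, \<open>SOME\<close> makes the colouring a function of
  \<open>G\<close> alone, as the order of quantifiers in \<open>whp_extendable_colouring\<close>
  demands.\<close>

definition core_colouring :: "'a set set \<Rightarrow> nat ugraph \<Rightarrow> nat set \<Rightarrow> nat" where
  "core_colouring S G e = (if (SOME \<kappa> :: nat set \<Rightarrow> bool. \<forall>P\<in>sb_graph.copies S. P \<subseteq> edges G \<longrightarrow> \<not> (\<exists>b. \<forall>f\<in>P. \<kappa> f = b)) e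
     then 1 else 0)"

lemma core_colouring_less: "core_colouring S G e < 2"
  by (simp add: core_colouring_def)

context
  fixes S assumes S: "S \<subseteq> edges F" "sb_graph S d"
begin

lemma core_colouring_no_mono:
  assumes G: "G \<in> typical S p n" and P: "P \<in> sb_graph.copies S" "P \<subseteq> edges G"
  shows "\<not> (\<forall>f\<in>P. core_colouring S G f = k)"
proof
  interpret sb_graph S d by (rule S(2))
  define \<kappa> where "\<kappa> = (SOME \<kappa> :: nat set \<Rightarrow> bool. \<forall>P\<in>sb_graph.copies S. P \<subseteq> edges G \<longrightarrow> \<not> (\<exists>b. \<forall>f\<in>P. \<kappa> f = b))"
  have ex: "\<exists>\<kappa> :: nat set \<Rightarrow> bool. \<forall>P\<in>sb_graph.copies S. P \<subseteq> edges G \<longrightarrow> \<not> (\<exists>b. \<forall>f\<in>P. \<kappa> f = b)"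
    using G unfolding typical_def colourable_def by blast
  have good: "\<forall>P\<in>sb_graph.copies S. P \<subseteq> edges G \<longrightarrow> \<not> (\<exists>b. \<forall>f\<in>P. \<kappa> f = b)"
    unfolding \<kappa>_def by (rule someI_ex[OF ex])
  have colk: "core_colouring S G f = (if \<kappa> f then 1 else 0)" for f by (simp add: core_colouring_def \<kappa>_def)
  assume "\<forall>f\<in>P. core_colouring S G f = k"
  then have "\<forall>f\<in>P. \<kappa> f = (k = 1)" unfolding colk by (auto split: if_splits)
  then show False using good P by metis
qed

lemma core_colouring_part:
  assumes G: "G \<in> typical S p n" and phi: "\<phi> \<in> embeddings n (verts H)" and g: "g \<in> edges F"
    and sub: "img \<phi> (part g) \<subseteq> edges G" and mono: "\<And>e. e \<in> img \<phi> (part g) \<Longrightarrow> core_colouring S G e = k"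
  shows False
proof -
  obtain P where P: "P \<in> sb_graph.copies S" "P \<subseteq> img \<phi> (part g)" using core_copy_in_part[OF S g phi] .
  then have "P \<subseteq> edges G" "\<forall>f\<in>P. core_colouring S G f = k" using sub mono by blast+
  then show False using core_colouring_no_mono[OF G P(1)] by blast
qed

lemma core_colouring_good:
  assumes G: "G \<in> typical S p n" and r: "2 \<le> r"
  shows "good_colouring r H G (core_colouring S G)"
proof -
  have "\<not> has_mono_copy H G (core_colouring S G)"
  proof
    assume "has_mono_copy H G (core_colouring S G)"
    moreover have "verts G = {..<n}" using G by (simp add: typical_def)
    ultimately obtain \<phi> k where phi: "\<phi> \<in> embeddings n (verts H)" "img \<phi> (edges H) \<subseteq> edges G"
      "\<And>e. e \<in> img \<phi> (edges H) \<Longrightarrow> core_colouring S G e = k" by (rule mono_copy_embedding) blast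
    obtain g where g: "g \<in> edges F" using f_edge by blast
    then have "part g \<subseteq> edges H" by (auto simp: edges_H)
    then show False by (intro core_colouring_part[OF G phi(1) g, of k]) (use phi in blast)+
  qed
  moreover have "edge_colouring r G (core_colouring S G)"
    unfolding edge_colouring_def using core_colouring_less r by (meson less_le_trans)
  ultimately show ?thesis by (simp add: good_colouring_def)
qed

text \<open>In an extension of the colouring every monochromatic copy of \<open>H\<close> uses a new edge in each of its
  attached copies of \<open>F\<close>.\<close>

lemma mixed_copy:
  assumes G: "G \<in> typical S p n" and G': "verts G' = {..<n}"
    and ext: "\<And>e. e \<in> edges G \<Longrightarrow> \<kappa> e = core_colouring S G e"
    and mono: "has_mono_copy H (graph_union G G') \<kappa>"
  obtains \<phi> k J where "\<phi> \<in> placements n J G" "J \<in> sparse_missing" "\<And>h. h \<in> edges H \<Longrightarrow> \<kappa> (\<phi> ` h) = k"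
    "\<And>h. h \<in> edges H - J \<Longrightarrow> \<phi> ` h \<in> edges G' - edges G" "\<phi> \<in> embeddings n (verts H)" "J \<subseteq> edges H"
proof -
  have "verts (graph_union G G') = {..<n}" using G G' by (simp add: typical_def graph_union_def)
  with mono obtain \<phi> k where phi: "\<phi> \<in> embeddings n (verts H)" "img \<phi> (edges H) \<subseteq> edges (graph_union G G')"
    "\<And>e. e \<in> img \<phi> (edges H) \<Longrightarrow> \<kappa> e = k" by (rule mono_copy_embedding) blast
  define J where "J = {h \<in> edges H. \<phi> ` h \<in> edges G}"
  have JE: "J \<subseteq> edges H" by (auto simp: J_def)
  have "J \<in> sparse_missing"
  proof (rule missing_edge_count[OF JE], rule notI)
    fix g assume g: "g \<in> edges F" "part g \<subseteq> J"
    then have "img \<phi> (part g) \<subseteq> edges G" by (auto simp: J_def)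
    moreover have "core_colouring S G e = k" if "e \<in> img \<phi> (part g)" for e
    proof -
      have "e \<in> img \<phi> (edges H)" "e \<in> edges G" using that g(2) JE by (auto simp: J_def)
      then show ?thesis using ext phi(3) by metis
    qed
    ultimately show False by (rule core_colouring_part[OF G phi(1) g(1)])
  qed
  moreover have "\<phi> \<in> placements n J G" using phi(1) by (auto simp: placements_def J_def)
  moreover have "\<phi> ` h \<in> edges G' - edges G" if "h \<in> edges H - J" for h
  proof -
    have "\<phi> ` h \<in> edges (graph_union G G')" using phi(2) that by blast
    then show ?thesis using that by (auto simp: graph_union_def J_def)
  qed
  moreover have "\<kappa> (\<phi> ` h) = k" if "h \<in> edges H" for h using phi(3) that by blast
  ultimately show ?thesis using that phi(1) JE by blast
qed

text \<open>New edges get the colour 1.\<close>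

lemma extend_two_colours:
  assumes n1: "1 \<le> n" and c: "0 < c" "c \<le> 1" and p: "p = c * real n powr (- 1 / d)"
    and G: "G \<in> typical S p n" and q: "0 \<le> q" "q \<le> 1" "q \<le> p"
  shows "1 - 2 ^ (card (edges H) + 1) * (real n ^ card (verts F) * q ^ card (edges F))
    \<le> bg_prob n q {G'. extendable 2 H G (core_colouring S G) G'}"
proof -
  let ?I = "Sigma sparse_missing (\<lambda>J. placements n J G)"
  let ?S = "\<lambda>(J, \<phi>). img \<phi> (edges H - J)"
  have fpl: "finite (placements n J G)" for J using finite_embeddings[OF fin_H] by (simp add: placements_def)
  have fI: "finite ?I" using finite_sparse_missing fpl by auto
  have "bg_prob n q (- {G'. extendable 2 H G (core_colouring S G) G'}) \<le> bg_prob n q {G'. \<exists>x\<in>?I. ?S x \<subseteq> edges G'}"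
  proof (rule bg_prob_mono)
    fix G' :: "nat ugraph" assume G': "verts G' = {..<n}" "G' \<in> - {G'. extendable 2 H G (core_colouring S G) G'}"
    define \<kappa> where "\<kappa> e = (if e \<in> edges G then core_colouring S G e else 1)" for e
    have "edge_colouring 2 (graph_union G G') \<kappa>" by (auto simp: edge_colouring_def \<kappa>_def core_colouring_less)
    then have "has_mono_copy H (graph_union G G') \<kappa>"
      using G'(2) unfolding extendable_def good_colouring_def \<kappa>_def by auto
    then obtain \<phi> k J where phi: "\<phi> \<in> placements n J G" "J \<in> sparse_missing" "\<And>h. h \<in> edges H - J \<Longrightarrow> \<phi> ` h \<in> edges G' - edges G"
      by (rule mixed_copy[OF G G'(1), of \<kappa>, rotated]) (auto simp: \<kappa>_def)
    then have "(J, \<phi>) \<in> ?I" "?S (J, \<phi>) \<subseteq> edges G'" by auto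
    then show "G' \<in> {G'. \<exists>x\<in>?I. ?S x \<subseteq> edges G'}" by (intro CollectI bexI[of _ "(J, \<phi>)"])
  qed
  also have "\<dots> \<le> (\<Sum>x\<in>?I. q ^ card (?S x))"
  proof (rule union_prob[OF fI _ q(1,2)])
    fix x assume "x \<in> ?I"
    then obtain J \<phi> where x: "x = (J, \<phi>)" "\<phi> \<in> embeddings n (verts H)" by (auto simp: placements_def)
    show "?S x \<subseteq> all_pairs n" unfolding x prod.case
      by (rule img_all_pairs[OF x(2)]) (use edge_H in auto)
  qed
  also have "\<dots> = (\<Sum>(J, \<phi>)\<in>?I. q ^ card (edges H - J))"
  proof (rule sum.cong[OF refl], clarify)
    fix J \<phi> assume "\<phi> \<in> placements n J G"
    then show "q ^ card (img \<phi> (edges H - J)) = q ^ card (edges H - J)"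
      using Union_sub_H[of "edges H - J"] by (subst card_img[of _ "verts H"]) (auto simp: placements_def embeddings_def)
  qed
  also have "\<dots> = (\<Sum>J\<in>sparse_missing. \<Sum>\<phi>\<in>placements n J G. q ^ card (edges H - J))"
    using finite_sparse_missing fpl by (subst sum.Sigma) auto
  also have "\<dots> \<le> 2 ^ (card (edges H) + 1) * (real n ^ card (verts F) * q ^ card (edges F))"
    using G q by (intro placements_weight[OF n1 c p]) (auto simp: typical_def)
  finally have "bg_prob n q (- {G'. extendable 2 H G (core_colouring S G) G'}) \<le> 2 ^ (card (edges H) + 1) * (real n ^ card (verts F) * q ^ card (edges F))" .
  moreover have "bg_prob n q (- {G'. extendable 2 H G (core_colouring S G) G'}) = 1 - bg_prob n q {G'. extendable 2 H G (core_colouring S G) G'}"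
    using measure_pmf.prob_compl[of "{G'. extendable 2 H G (core_colouring S G) G'}" "binomial_graph n q"] by (simp add: Compl_eq_Diff_UNIV)
  ultimately show ?thesis by linarith
qed

end

section \<open>The densest part of \<open>H\<close> and three colours\<close>

text \<open>Dropping isolated vertices turns a subgraph of maximum density into an edge set; one
  with the fewest edges is strictly balanced.\<close>

lemma densest_part:
  obtains T where "T \<subseteq> edges H" "T \<noteq> {}" "0 < max_density H" "real (card T) = max_density H * real (card (\<Union>T))"
    "\<And>T'. T' \<subset> T \<Longrightarrow> T' \<noteq> {} \<Longrightarrow> real (card T') < max_density H * real (card (\<Union>T'))"
proof -
  let ?r = "\<lambda>K :: ('a + ('a set \<times> 'a)) ugraph. real (card (edges K)) / real (card (verts K))"
  let ?X = "{K \<in> subgraphs H. verts K \<noteq> {}}"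
  let ?m = "max_density H"
  have fX: "finite (?r ` ?X)" using finite_subgraphs[OF graph_H] by simp
  have vH: "verts H \<noteq> {}" using size_F(2) by (auto simp: verts_H)
  then have HX: "H \<in> ?X" using self_in_subgraphs[OF graph_H] by simp
  have m: "?m = Max (?r ` ?X)" by (simp add: max_density_def)
  have le: "?r K \<le> ?m" if "K \<in> ?X" for K unfolding m using fX that by (intro Max_ge) auto
  have "0 < ?r H" using vH fin_H size_F(1) by (simp add: card_edges_H card_gt_0_iff)
  then have m0: "0 < ?m" using le[OF HX] by linarith
  have dens: "real (card T) \<le> ?m * real (card (\<Union>T)) \<and> 0 < card (\<Union>T)" if T: "T \<subseteq> edges H" "T \<noteq> {}" for T
  proof -
    have fU: "finite (\<Union>T)" using Union_sub_H[OF T(1)] fin_H finite_subset by blast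
    have "\<Union>T \<noteq> {}" using T edge_H(1) by fastforce
    moreover have "(\<Union>T, T) \<in> subgraphs H"
      using T fU edge_H Union_sub_H[OF T(1)] by (auto simp: subgraphs_def is_graph_def)
    ultimately have "?r (\<Union>T, T) \<le> ?m" by (intro le) auto
    moreover have "0 < card (\<Union>T)" using fU \<open>\<Union>T \<noteq> {}\<close> by (simp add: card_gt_0_iff)
    ultimately show ?thesis by (simp add: pos_divide_le_eq)
  qed
  have "?r ` ?X \<noteq> {}" using HX by blast
  then have "?m \<in> ?r ` ?X" unfolding m by (rule Max_in[OF fX])
  then obtain K where K: "K \<in> ?X" "?m = ?r K" by blast
  have KE: "edges K \<subseteq> edges H" "edges K \<noteq> {}" using K m0 by (auto simp: subgraphs_def)
  have gK: "finite (verts K)" "\<Union>(edges K) \<subseteq> verts K" using K(1) by (auto simp: subgraphs_def is_graph_def)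
  have "card (verts K) \<noteq> 0" using K(1) gK by auto
  then have "real (card (edges K)) = ?m * real (card (verts K))" using K(2) by simp
  moreover have "?m * real (card (\<Union>(edges K))) \<le> ?m * real (card (verts K))"
    using gK m0 by (intro mult_left_mono) (auto intro: card_mono)
  ultimately have eqK: "real (card (edges K)) = ?m * real (card (\<Union>(edges K)))" using dens[OF KE] by linarith
  define Q where "Q T \<longleftrightarrow> T \<subseteq> edges H \<and> T \<noteq> {} \<and> real (card T) = ?m * real (card (\<Union>T))" for T
  have "Q (edges K)" using KE eqK by (simp add: Q_def)
  then have "\<exists>T. Q T \<and> (\<forall>T'. Q T' \<longrightarrow> card T \<le> card T')" by (rule ex_has_least_nat)
  then obtain T where T: "Q T" and least: "\<forall>T'. Q T' \<longrightarrow> card T \<le> card T'" by (elim exE conjE)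
  have "real (card T') < ?m * real (card (\<Union>T'))" if T': "T' \<subset> T" "T' \<noteq> {}" for T'
  proof -
    have "finite T" using T finite_edges_H finite_subset by (auto simp: Q_def)
    then have "card T' < card T" using T'(1) by (rule psubset_card_mono)
    then have "\<not> Q T'" using least by (meson leD)
    moreover have "T' \<subseteq> edges H" using T T'(1) by (auto simp: Q_def)
    ultimately show ?thesis using T'(2) dens[of T'] by (auto simp: Q_def)
  qed
  then show ?thesis using that[of T] T m0 by (simp add: Q_def)
qed

context
  fixes S T m
  assumes S: "S \<subseteq> edges F" "sb_graph S d"
    and T: "T \<subseteq> edges H" "T \<noteq> {}" and m0: "0 < m" and T_tight: "real (card T) = m * real (card (\<Union>T))"
    and T_strict: "\<forall>T'. T' \<subset> T \<longrightarrow> T' \<noteq> {} \<longrightarrow> real (card T') < m * real (card (\<Union>T'))"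
begin

lemma fin_T: "finite T" "finite (\<Union>T)" "\<Union>T \<subseteq> verts H"
proof -
  show "finite T" using T finite_edges_H finite_subset by blast
  show sub: "\<Union>T \<subseteq> verts H" using Union_sub_H[OF T(1)] .
  show "finite (\<Union>T)" using finite_subset[OF sub fin_H] .
qed

lemma card_UT: "2 \<le> card (\<Union>T)"
proof -
  obtain f where f: "f \<in> T" using T by blast
  then have "card f \<le> card (\<Union>T)" using fin_T by (intro card_mono) auto
  then show ?thesis using edge_H(1) f T by auto
qed

lemma embedding_T:
  assumes "\<psi> \<in> embeddings n (\<Union>T)"
  shows "inj_on \<psi> (\<Union>T)" "card (img \<psi> T) = card T" "img \<psi> T \<subseteq> all_pairs n"
proof -
  show inj: "inj_on \<psi> (\<Union>T)" using assms by (simp add: embeddings_def)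
  then show "card (img \<psi> T) = card T" by (rule card_img) simp
  show "img \<psi> T \<subseteq> all_pairs n" using T edge_H(1) by (intro img_all_pairs[OF assms]) auto
qed

definition overlapping :: "nat \<Rightarrow> nat ugraph set" where
  "overlapping n = {G. \<exists>\<psi>\<in>embeddings n (\<Union>T). \<exists>\<psi>'\<in>embeddings n (\<Union>T). img \<psi> T \<noteq> img \<psi>' T \<and>
     \<psi> ` \<Union>T \<inter> \<psi>' ` \<Union>T \<noteq> {} \<and> img \<psi> T \<union> img \<psi>' T \<subseteq> edges G}"

text \<open>Expected number of pairs. Since \<open>card T / m = card (\<Union>T)\<close>, each copy
  contributes at most \<open>n powr (\<delta> * card T)\<close> up to constants, and the overlap of
  the second with the first gains \<open>n powr (- \<eta>)\<close>: by strictness if edges are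
  shared, and by the shared vertex alone if not.\<close>

lemma overlapping_prob:
  assumes n1: "1 \<le> n" and q: "0 \<le> q" "q \<le> 1" "q \<le> real n powr (- 1 / m + \<delta>)" and del: "0 \<le> \<delta>"
    and eta: "\<And>a b. a \<le> card (\<Union>T) \<Longrightarrow> b \<le> card T \<Longrightarrow> 0 < real a - real b / m \<Longrightarrow> \<eta> \<le> real a - real b / m"
  shows "bg_prob n q (overlapping n) \<le> (2 * real (card (\<Union>T))) ^ card (\<Union>T) * real n powr (2 * \<delta> * real (card T) - \<eta>)"
proof -
  let ?V = "\<Union>T"
  let ?A = "embeddings n ?V"
  let ?a = "card ?V" and ?b = "card T"
  let ?B = "\<lambda>\<psi>. {\<psi>' \<in> ?A. img \<psi> T \<noteq> img \<psi>' T \<and> \<psi> ` ?V \<inter> \<psi>' ` ?V \<noteq> {}}"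
  let ?I = "Sigma ?A ?B"
  let ?S = "\<lambda>(\<psi>, \<psi>'). img \<psi> T \<union> img \<psi>' T"
  let ?\<beta> = "real n powr (\<delta> * real ?b - \<eta>)"
  have fA: "finite ?A" using finite_embeddings[OF fin_T(2)] .
  have np: "1 \<le> real n" using n1 by simp
  have qpow: "q ^ k \<le> real n powr (- (real k / m) + \<delta> * real k)" for k
  proof -
    have "q ^ k \<le> (real n powr (- 1 / m + \<delta>)) ^ k" using q by (intro power_mono) auto
    also have "\<dots> = real n powr ((- 1 / m + \<delta>) * real k)" using np by (simp flip: powr_realpow add: powr_powr)
    also have "(- 1 / m + \<delta>) * real k = - (real k / m) + \<delta> * real k" by (simp add: algebra_simps)
    finally show ?thesis .
  qed
  have b_m: "real ?b / m = real ?a" using T_tight m0 by simp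
  have inner: "(\<Sum>\<psi>'\<in>?B \<psi>. q ^ card (img \<psi>' T - img \<psi> T)) \<le> 2 ^ ?a * real ?a ^ ?a * ?\<beta>" if psi: "\<psi> \<in> ?A" for \<psi>
  proof -
    have cW: "card (\<psi> ` ?V) = ?a" using card_image[OF embedding_T(1)[OF psi]] .
    have "(\<Sum>\<psi>'\<in>?B \<psi>. q ^ card (img \<psi>' T - img \<psi> T)) \<le> 2 ^ ?a * real (card (\<psi> ` ?V)) ^ ?a * ?\<beta>"
    proof (rule extension_sum[OF fin_T(2) _ _ n1 q(1)])
      show "finite (\<psi> ` ?V)" using fin_T by simp
      show "1 \<le> card (\<psi> ` ?V)" using cW card_UT by simp
      fix \<psi>' assume p': "\<psi>' \<in> ?B \<psi>"
      then have emb': "\<psi>' \<in> ?A" by simp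
      define I where "I = {f \<in> T. \<psi>' ` f \<in> img \<psi> T}"
      define U where "U = {u \<in> ?V. \<psi>' u \<in> \<psi> ` ?V}"
      have ci: "card (img \<psi>' T - img \<psi> T) = ?b - card I"
        unfolding I_def by (rule card_img_diff[OF embedding_T(1)[OF emb'] _ fin_T(1)]) simp
      have UV: "U \<subseteq> ?V" unfolding U_def by blast
      have fU: "finite U" using finite_subset[OF UV fin_T(2)] .
      have cU: "card U \<le> ?a" using card_mono[OF fin_T(2) UV] .
      have IT: "I \<subseteq> T" by (auto simp: I_def)
      have cI: "card I \<le> ?b" using card_mono[OF fin_T(1) IT] .
      have "U \<noteq> {}"
      proof -
        have "\<psi> ` ?V \<inter> \<psi>' ` ?V \<noteq> {}" using p' by simp
        then obtain x where "x \<in> \<psi> ` ?V" "x \<in> \<psi>' ` ?V" by (meson Int_iff ex_in_conv)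
        then obtain u where "u \<in> ?V" "\<psi>' u \<in> \<psi> ` ?V" by (metis imageE)
        then have "u \<in> U" by (simp add: U_def)
        then show ?thesis by (metis empty_iff)
      qed
      then have U1: "1 \<le> card U" using fU by (simp add: Suc_le_eq card_gt_0_iff)
      have "I \<noteq> T"
      proof
        assume "I = T"
        then have "\<forall>f\<in>T. \<psi>' ` f \<in> img \<psi> T" unfolding I_def by blast
        then have "img \<psi>' T \<subseteq> img \<psi> T" by (simp only: image_subset_iff)
        moreover have "finite (img \<psi> T)" using fin_T by simp
        ultimately have "img \<psi>' T = img \<psi> T"
          using embedding_T(2)[OF psi] embedding_T(2)[OF emb'] by (intro card_subset_eq) auto
        then show False using p' by simp
      qed
      have IU: "\<Union>I \<subseteq> U"
      proof
        fix u assume "u \<in> \<Union>I"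
        then obtain f where f: "f \<in> T" "u \<in> f" "\<psi>' ` f \<in> img \<psi> T" by (auto simp: I_def)
        obtain f' where f': "f' \<in> T" "\<psi>' ` f = \<psi> ` f'" using f(3) by (rule imageE)
        have "\<psi>' u \<in> \<psi> ` f'" using f(2) unfolding f'(2)[symmetric] by (rule imageI)
        then have "\<psi>' u \<in> \<psi> ` ?V" using f'(1) by auto
        then show "u \<in> U" using f by (auto simp: U_def)
      qed
      have pos: "0 < real (card U) - real (card I) / m"
      proof (cases "I = {}")
        case True
        then show ?thesis using U1 by simp
      next
        case False
        have "real (card I) < m * real (card (\<Union>I))" using T_strict[rule_format, of I] IT \<open>I \<noteq> T\<close> False by blast
        also have "\<dots> \<le> m * real (card U)" using card_mono[OF fU IU] m0 by (intro mult_left_mono) auto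
        finally show ?thesis using m0 by (simp add: pos_divide_less_eq mult.commute)
      qed
      have "real n ^ (?a - card U) * q ^ (?b - card I)
          \<le> real n powr real (?a - card U) * real n powr (- (real (?b - card I) / m) + \<delta> * real (?b - card I))"
        using qpow[of "?b - card I"] np q by (intro mult_mono) (auto simp: powr_realpow)
      also have "\<dots> = real n powr (real (?a - card U) - real (?b - card I) / m + \<delta> * real (?b - card I))"
        by (simp add: algebra_simps flip: powr_add)
      also have "\<dots> \<le> ?\<beta>"
      proof (rule powr_mono)
        have "real (?a - card U) - real (?b - card I) / m = - (real (card U) - real (card I) / m)"
          using cU cI b_m by (simp add: of_nat_diff diff_divide_distrib)
        moreover have "\<eta> \<le> real (card U) - real (card I) / m" using eta[OF cU cI pos] .
        moreover have "\<delta> * real (?b - card I) \<le> \<delta> * real ?b" using del by (intro mult_left_mono) auto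
        ultimately show "real (?a - card U) - real (?b - card I) / m + \<delta> * real (?b - card I) \<le> \<delta> * real ?b - \<eta>" by linarith
      qed (use np in simp)
      finally show "real n ^ (?a - card {u \<in> ?V. \<psi>' u \<in> \<psi> ` ?V}) * q ^ card (img \<psi>' T - img \<psi> T) \<le> ?\<beta>"
        unfolding ci U_def[symmetric] .
    qed auto
    then show ?thesis unfolding cW .
  qed
  have fB: "finite (?B \<psi>)" for \<psi> using fA by simp
  have fI: "finite ?I" using fA fB by (intro finite_SigmaI)
  have "bg_prob n q (overlapping n) \<le> bg_prob n q {G. \<exists>x\<in>?I. ?S x \<subseteq> edges G}"
  proof (rule bg_prob_mono)
    fix G :: "nat ugraph" assume "G \<in> overlapping n"
    then obtain \<psi> \<psi>' where x: "\<psi> \<in> ?A" "\<psi>' \<in> ?A" "img \<psi> T \<noteq> img \<psi>' T" "\<psi> ` ?V \<inter> \<psi>' ` ?V \<noteq> {}"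
      "img \<psi> T \<union> img \<psi>' T \<subseteq> edges G"
      unfolding overlapping_def by (elim CollectE bexE conjE)
    then have "(\<psi>, \<psi>') \<in> ?I" by simp
    moreover have "?S (\<psi>, \<psi>') \<subseteq> edges G" using x(5) by simp
    ultimately show "G \<in> {G. \<exists>x\<in>?I. ?S x \<subseteq> edges G}" by (intro CollectI bexI[of _ "(\<psi>, \<psi>')"])
  qed
  also have "\<dots> \<le> (\<Sum>x\<in>?I. q ^ card (?S x))"
  proof (rule union_prob[OF fI _ q(1,2)])
    fix x assume "x \<in> ?I"
    then obtain \<psi> \<psi>' where x: "x = (\<psi>, \<psi>')" "\<psi> \<in> ?A" "\<psi>' \<in> ?A" by blast
    then show "?S x \<subseteq> all_pairs n" using embedding_T(3)[OF x(2)] embedding_T(3)[OF x(3)] by simp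
  qed
  also have "\<dots> = (\<Sum>\<psi>\<in>?A. \<Sum>\<psi>'\<in>?B \<psi>. q ^ card (img \<psi> T \<union> img \<psi>' T))"
    using fA fB by (subst sum.Sigma) (auto intro!: sum.cong)
  also have "\<dots> \<le> (\<Sum>\<psi>\<in>?A. q ^ ?b * (2 ^ ?a * real ?a ^ ?a * ?\<beta>))"
  proof (rule sum_mono)
    fix \<psi> assume psi: "\<psi> \<in> ?A"
    have "q ^ card (img \<psi> T \<union> img \<psi>' T) = q ^ ?b * q ^ card (img \<psi>' T - img \<psi> T)" for \<psi>'
    proof -
      have "card (img \<psi> T \<union> (img \<psi>' T - img \<psi> T)) = card (img \<psi> T) + card (img \<psi>' T - img \<psi> T)"
        using fin_T by (intro card_Un_disjoint) auto
      then show ?thesis unfolding Un_Diff_cancel embedding_T(2)[OF psi] by (simp only: power_add)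
    qed
    then have "(\<Sum>\<psi>'\<in>?B \<psi>. q ^ card (img \<psi> T \<union> img \<psi>' T)) = q ^ ?b * (\<Sum>\<psi>'\<in>?B \<psi>. q ^ card (img \<psi>' T - img \<psi> T))"
      by (simp add: sum_distrib_left)
    also have "\<dots> \<le> q ^ ?b * (2 ^ ?a * real ?a ^ ?a * ?\<beta>)" using inner[OF psi] q by (intro mult_left_mono) auto
    finally show "(\<Sum>\<psi>'\<in>?B \<psi>. q ^ card (img \<psi> T \<union> img \<psi>' T)) \<le> q ^ ?b * (2 ^ ?a * real ?a ^ ?a * ?\<beta>)" .
  qed
  also have "\<dots> = real (card ?A) * q ^ ?b * (2 ^ ?a * real ?a ^ ?a * ?\<beta>)" by simp
  also have "\<dots> \<le> real n powr (\<delta> * real ?b) * (2 ^ ?a * real ?a ^ ?a * ?\<beta>)"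
  proof (rule mult_right_mono)
    have "real (card ?A) * q ^ ?b \<le> real n ^ ?a * real n powr (- (real ?b / m) + \<delta> * real ?b)"
      using card_embeddings[OF fin_T(2), of n] qpow[of ?b] q by (intro mult_mono) (simp_all flip: of_nat_power)
    also have "\<dots> = real n powr (\<delta> * real ?b)"
      using np unfolding b_m by (simp flip: powr_realpow powr_add)
    finally show "real (card ?A) * q ^ ?b \<le> real n powr (\<delta> * real ?b)" .
  qed auto
  also have "\<dots> = (2 * real ?a) ^ ?a * (real n powr (\<delta> * real ?b) * ?\<beta>)" by (simp add: power_mult_distrib)
  also have "real n powr (\<delta> * real ?b) * ?\<beta> = real n powr (2 * \<delta> * real ?b - \<eta>)" by (simp add: algebra_simps flip: powr_add)
  finally show ?thesis .
qed

definition covers :: "nat \<Rightarrow> nat set \<Rightarrow> (('a + ('a set \<times> 'a)) \<Rightarrow> nat) set" where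
  "covers n g = {\<psi> \<in> embeddings n (\<Union>T). g \<in> img \<psi> T}"

lemma finite_covers: "finite (covers n g)"
  using finite_embeddings[OF fin_T(2)] by (simp add: covers_def)

text \<open>Pure counting by \<open>extension_sum\<close> with weight 1: both ends of
  \<open>g\<close> are images of vertices of \<open>T\<close>, which leaves
  \<open>card (\<Union>T) - 2\<close> free vertices.\<close>

lemma card_covers:
  assumes n1: "1 \<le> n" and g: "card g = 2"
  shows "real (card (covers n g)) \<le> 4 ^ card (\<Union>T) * real n ^ (card (\<Union>T) - 2)"
proof -
  have fg: "finite g" using g by (metis card.infinite zero_neq_numeral)
  have "(\<Sum>\<psi>\<in>covers n g. 1 ^ card (img \<psi> T - {})) \<le> 2 ^ card (\<Union>T) * real (card g) ^ card (\<Union>T) * real n ^ (card (\<Union>T) - 2)"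
  proof (rule extension_sum[OF fin_T(2) fg _ n1])
    show "covers n g \<subseteq> embeddings n (\<Union>T)" by (auto simp: covers_def)
    fix \<psi> assume psi: "\<psi> \<in> covers n g"
    then have emb: "\<psi> \<in> embeddings n (\<Union>T)" and "g \<in> img \<psi> T" by (auto simp: covers_def)
    then obtain f where f: "f \<in> T" "g = \<psi> ` f" by blast
    have "{u \<in> \<Union>T. \<psi> u \<in> g} = f" using embedding_T(1)[OF emb] f by (auto dest: inj_onD)
    then have "card {u \<in> \<Union>T. \<psi> u \<in> g} = 2" using f(1) T(1) edge_H(1) by auto
    then show "real n ^ (card (\<Union>T) - card {u \<in> \<Union>T. \<psi> u \<in> g}) * 1 ^ card (img \<psi> T - {}) \<le> real n ^ (card (\<Union>T) - 2)" by simp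
  qed (use g in auto)
  also have "2 ^ card (\<Union>T) * real (card g) ^ card (\<Union>T) = (4 :: real) ^ card (\<Union>T)"
    unfolding g by (simp flip: power_mult_distrib)
  finally show ?thesis by simp
qed

text \<open>New edges get the colour 2, except that every copy of \<open>T\<close> formed by new edges has one edge of colour 1.
  A copy of \<open>H\<close> of colour 1 is therefore accompanied by disjoint copies of \<open>T\<close>, one through each of its
  new edges, unless two copies of \<open>T\<close> overlap.\<close>

lemma extend_three_colours:
  assumes n1: "1 \<le> n" and c: "0 < c" "c \<le> 1" and p: "p = c * real n powr (- 1 / d)"
    and G: "G \<in> typical S p n" and q: "0 \<le> q" "q \<le> 1"
    and theta: "4 ^ card (\<Union>T) * real n ^ (card (\<Union>T) - 2) * q ^ card T \<le> \<theta>" "\<theta> \<le> p"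
  shows "1 - bg_prob n q (overlapping n) - 2 ^ (card (edges H) + 1) * (real n ^ card (verts F) * \<theta> ^ card (edges F))
    \<le> bg_prob n q {G'. extendable 3 H G (core_colouring S G) G'}"
proof -
  let ?V = "\<Union>T"
  let ?A = "embeddings n ?V"
  \<comment> \<open>One copy of \<open>T\<close> for each new edge of the copy of \<open>H\<close>.
    Edge-disjointness makes the number of required edges exactly
    \<open>card (edges H - J) * card T\<close>.\<close>
  define D where "D J \<phi> = {\<Psi> \<in> PiE (edges H - J) (\<lambda>h. covers n (\<phi> ` h)).
    \<forall>h\<in>edges H - J. \<forall>h'\<in>edges H - J. h \<noteq> h' \<longrightarrow> img (\<Psi> h) T \<inter> img (\<Psi> h') T = {}}" for J \<phi>
  let ?Base = "Sigma sparse_missing (\<lambda>J. placements n J G)"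
  let ?I = "Sigma ?Base (\<lambda>(J, \<phi>). D J \<phi>)"
  let ?S = "\<lambda>((J, \<phi>), \<Psi>). \<Union>h\<in>edges H - J. img (\<Psi> h) T"
  have fpl: "finite (placements n J G)" for J using finite_embeddings[OF fin_H] by (simp add: placements_def)
  have fI0: "finite ?Base" using finite_sparse_missing fpl by auto
  have fE: "finite (edges H - J)" for J using finite_edges_H by simp
  have fPi: "finite (PiE (edges H - J) (\<lambda>h. covers n (\<phi> ` h)))" for J \<phi> using finite_covers fE by (intro finite_PiE) auto
  have fD: "finite (D J \<phi>)" for J \<phi> unfolding D_def using fPi by simp
  have fI: "finite ?I" by (rule finite_SigmaI[OF fI0]) (auto intro: fD)
  have th0: "0 \<le> \<theta>"
  proof -
    have "0 \<le> 4 ^ card ?V * real n ^ (card ?V - 2) * q ^ card T" using q by simp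
    then show ?thesis using theta(1) by linarith
  qed
  have covemb: "\<psi> \<in> ?A" if "\<psi> \<in> covers n g" for \<psi> g using that by (simp add: covers_def)
  have main: "G' \<in> overlapping n \<union> {G'. \<exists>x\<in>?I. ?S x \<subseteq> edges G'}"
    if G': "verts G' = {..<n}" "edges G' \<subseteq> all_pairs n" "\<not> extendable 3 H G (core_colouring S G) G'" for G'
  proof (cases "G' \<in> overlapping n")
    case False
    define N where "N = edges G' - edges G"
    define QQ where "QQ = {img \<psi> T |\<psi>. \<psi> \<in> ?A \<and> img \<psi> T \<subseteq> N}"
    define rep where "rep Q = (SOME f. f \<in> Q)" for Q :: "nat set set"
    have rep: "rep Q \<in> Q" if "Q \<in> QQ" for Q
    proof -
      have "Q \<noteq> {}" using that T(2) by (auto simp: QQ_def)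
      then show ?thesis unfolding rep_def by (simp add: some_in_eq)
    qed
    define \<kappa> where "\<kappa> e = (if e \<in> edges G then core_colouring S G e else if e \<in> rep ` QQ then 1 else 2)" for e
    have c3: "core_colouring S G e < 3" for e using core_colouring_less[of S G e] by simp
    have "edge_colouring 3 (graph_union G G') \<kappa>" by (auto simp: edge_colouring_def \<kappa>_def c3)
    then have "has_mono_copy H (graph_union G G') \<kappa>"
      using G'(3) unfolding extendable_def good_colouring_def \<kappa>_def by auto
    then obtain \<phi> k J where phi: "\<phi> \<in> placements n J G" "J \<in> sparse_missing" "\<And>h. h \<in> edges H \<Longrightarrow> \<kappa> (\<phi> ` h) = k"
      "\<And>h. h \<in> edges H - J \<Longrightarrow> \<phi> ` h \<in> N" "\<phi> \<in> embeddings n (verts H)" "J \<subseteq> edges H"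
      unfolding N_def by (rule mixed_copy[OF S G G'(1), of \<kappa>, rotated]) (auto simp: \<kappa>_def)
    have "edges H - J \<noteq> {}" using phi(2) size_F(1) unfolding sparse_missing_def by force
    then obtain h0 where h0: "h0 \<in> edges H - J" by blast
    \<comment> \<open>New edges have colour 1 or 2. In colour 2 the whole copy of \<open>H\<close>
      would be new, as old edges have colours 0 and 1; it would contain a new copy of
      \<open>T\<close>, whose representative has colour 1.\<close>
    have k1: "k = 1"
    proof (rule ccontr)
      assume "k \<noteq> 1"
      moreover have "\<kappa> (\<phi> ` h0) \<in> {1, 2}" using phi(4)[OF h0] by (auto simp: \<kappa>_def N_def)
      ultimately have k2: "k = 2" using phi(3)[of h0] h0 by auto
      have new: "\<phi> ` h \<in> N - rep ` QQ" if "h \<in> edges H" for h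
      proof -
        have k2': "\<kappa> (\<phi> ` h) = 2" using phi(3)[OF that] k2 by simp
        then have "\<phi> ` h \<notin> edges G" using core_colouring_less[of S G "\<phi> ` h"] by (auto simp: \<kappa>_def)
        moreover have "h \<notin> J" using phi(1) calculation by (auto simp: placements_def)
        then have "\<phi> ` h \<in> N" using phi(4) that by blast
        ultimately show ?thesis using k2' by (auto simp: \<kappa>_def)
      qed
      define \<psi> where "\<psi> = restrict \<phi> ?V"
      have "\<psi> \<in> ?A"
        using phi(5) fin_T(3) by (auto simp: embeddings_def \<psi>_def inj_on_def subset_iff)
      moreover have im: "img \<psi> T = img \<phi> T"
        by (intro image_cong refl) (auto simp: \<psi>_def intro!: image_cong)
      moreover have "img \<phi> T \<subseteq> N" using new T(1) by blast
      ultimately have Q: "img \<phi> T \<in> QQ" unfolding QQ_def by (metis (mono_tags, lifting) mem_Collect_eq)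
      then obtain f where "f \<in> T" "rep (img \<phi> T) = \<phi> ` f" using rep[OF Q] by blast
      then show False using new[of f] T(1) Q by auto
    qed
    have "\<exists>\<psi>. \<psi> \<in> covers n (\<phi> ` h) \<and> img \<psi> T \<subseteq> N \<and> \<phi> ` h = rep (img \<psi> T)" if h: "h \<in> edges H - J" for h
    proof -
      have "\<kappa> (\<phi> ` h) = 1" "\<phi> ` h \<notin> edges G" using phi(3)[of h] phi(4)[OF h] h k1 by (auto simp: N_def)
      then have "\<phi> ` h \<in> rep ` QQ" by (auto simp: \<kappa>_def split: if_splits)
      then obtain Q where Q: "Q \<in> QQ" "\<phi> ` h = rep Q" by blast
      then obtain \<psi> where psi: "Q = img \<psi> T" "\<psi> \<in> ?A" "img \<psi> T \<subseteq> N" unfolding QQ_def by blast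
      then show ?thesis using rep[OF Q(1)] Q(2) unfolding covers_def by (intro exI[of _ \<psi>]) simp
    qed
    then obtain \<Psi>0 where P0: "\<And>h. h \<in> edges H - J \<Longrightarrow> \<Psi>0 h \<in> covers n (\<phi> ` h) \<and> img (\<Psi>0 h) T \<subseteq> N \<and> \<phi> ` h = rep (img (\<Psi>0 h) T)"
      by metis
    define \<Psi> where "\<Psi> = restrict \<Psi>0 (edges H - J)"
    \<comment> \<open>Different new edges represent different copies of \<open>T\<close>, and
      outside \<open>overlapping n\<close> these share no vertex.\<close>
    have dis: "img (\<Psi>0 h) T \<inter> img (\<Psi>0 h') T = {}" if h: "h \<in> edges H - J" "h' \<in> edges H - J" "h \<noteq> h'" for h h'
    proof -
      have inj: "inj_on \<phi> (verts H)" using phi(5) by (simp add: embeddings_def)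
      have "\<phi> ` h \<noteq> \<phi> ` h'" using h inj_on_image_eq_iff[OF inj, of h h'] edge_H(2) by auto
      then have ne: "img (\<Psi>0 h) T \<noteq> img (\<Psi>0 h') T" using P0[OF h(1)] P0[OF h(2)] by metis
      have "img (\<Psi>0 h) T \<union> img (\<Psi>0 h') T \<subseteq> edges G'" using P0[OF h(1)] P0[OF h(2)] by (auto simp: N_def)
      then have vd: "\<Psi>0 h ` ?V \<inter> \<Psi>0 h' ` ?V = {}"
      proof -
        have "\<Psi>0 h \<in> ?A" "\<Psi>0 h' \<in> ?A" using covemb P0[OF h(1)] P0[OF h(2)] by metis+
        then show ?thesis using False ne \<open>img (\<Psi>0 h) T \<union> img (\<Psi>0 h') T \<subseteq> edges G'\<close>
          unfolding overlapping_def mem_Collect_eq by (metis (no_types, lifting))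
      qed
      show ?thesis
      proof (rule ccontr)
        assume "\<not> ?thesis"
        then obtain g where g: "g \<in> img (\<Psi>0 h) T" "g \<in> img (\<Psi>0 h') T" by (meson disjoint_iff)
        then have "card g = 2" using embedding_T(3)[of "\<Psi>0 h" n] covemb P0[OF h(1)] by (auto simp: all_pairs_def)
        then obtain x where "x \<in> g" by fastforce
        then have "x \<in> \<Psi>0 h ` ?V" "x \<in> \<Psi>0 h' ` ?V" using g by auto
        then show False using vd by blast
      qed
    qed
    have "\<Psi> \<in> D J \<phi>" unfolding D_def \<Psi>_def using P0 dis by auto
    then have inI: "((J, \<phi>), \<Psi>) \<in> ?I" using phi(1,2) by auto
    have "img (\<Psi> h) T \<subseteq> edges G'" if "h \<in> edges H - J" for h
    proof -
      have "img (\<Psi>0 h) T \<subseteq> N" using P0[OF that] by simp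
      also have "N \<subseteq> edges G'" by (simp add: N_def)
      finally show ?thesis using that by (simp add: \<Psi>_def)
    qed
    then have "?S ((J, \<phi>), \<Psi>) \<subseteq> edges G'" by (simp add: UN_subset_iff)
    then have "G' \<in> {G'. \<exists>x\<in>?I. ?S x \<subseteq> edges G'}" using inI by (intro CollectI bexI[of _ "((J, \<phi>), \<Psi>)"])
    then show ?thesis by (rule UnI2)
  qed simp
  have card_S: "card (?S ((J, \<phi>), \<Psi>)) = card (edges H - J) * card T" if "\<Psi> \<in> D J \<phi>" for J \<phi> \<Psi>
  proof -
    have "card (\<Union>h\<in>edges H - J. img (\<Psi> h) T) = (\<Sum>h\<in>edges H - J. card (img (\<Psi> h) T))"
      using that fE fin_T(1) unfolding D_def by (intro card_UN_disjoint) auto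
    also have "\<dots> = (\<Sum>h\<in>edges H - J. card T)"
    proof (rule sum.cong[OF refl])
      fix h assume "h \<in> edges H - J"
      then have "\<Psi> h \<in> covers n (\<phi> ` h)" using that by (auto simp: D_def)
      then show "card (img (\<Psi> h) T) = card T" by (rule embedding_T(2)[OF covemb])
    qed
    finally show ?thesis by simp
  qed
  have "bg_prob n q (- {G'. extendable 3 H G (core_colouring S G) G'}) \<le> bg_prob n q (overlapping n \<union> {G'. \<exists>x\<in>?I. ?S x \<subseteq> edges G'})"
    using main by (intro bg_prob_mono) blast
  also have "\<dots> \<le> bg_prob n q (overlapping n) + bg_prob n q {G'. \<exists>x\<in>?I. ?S x \<subseteq> edges G'}"
    by (rule measure_Un_le) auto
  also have "bg_prob n q {G'. \<exists>x\<in>?I. ?S x \<subseteq> edges G'} \<le> (\<Sum>x\<in>?I. q ^ card (?S x))"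
  proof (rule union_prob[OF fI _ q])
    fix x assume "x \<in> ?I"
    then obtain J \<phi> \<Psi> where x: "x = ((J, \<phi>), \<Psi>)" "\<Psi> \<in> D J \<phi>" by auto
    have "img (\<Psi> h) T \<subseteq> all_pairs n" if "h \<in> edges H - J" for h
    proof -
      have "\<Psi> h \<in> covers n (\<phi> ` h)" using that x(2) by (auto simp: D_def)
      then show ?thesis by (rule embedding_T(3)[OF covemb])
    qed
    then show "?S x \<subseteq> all_pairs n" unfolding x(1) prod.case by (rule UN_least)
  qed
  also have "\<dots> = (\<Sum>x\<in>?Base. \<Sum>\<Psi>\<in>(case x of (J, \<phi>) \<Rightarrow> D J \<phi>). q ^ card (?S (x, \<Psi>)))"
    using fI0 fD by (subst sum.Sigma) (auto simp: case_prod_unfold)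
  also have "\<dots> \<le> (\<Sum>x\<in>?Base. \<theta> ^ card (edges H - fst x))"
  proof (rule sum_mono)
    fix x assume x0: "x \<in> ?Base"
    then obtain J \<phi> where x: "x = (J, \<phi>)" "J \<in> sparse_missing" "\<phi> \<in> placements n J G" by auto
    let ?s = "card (edges H - J)"
    have inj: "inj_on \<phi> (verts H)" using x(3) by (simp add: placements_def embeddings_def)
    have c2: "card (\<phi> ` h) = 2" if "h \<in> edges H" for h
      using card_image[OF inj_on_subset[OF inj edge_H(2)[OF that]]] edge_H(1)[OF that] by simp
    have "(\<Sum>\<Psi>\<in>D J \<phi>. q ^ card (?S ((J, \<phi>), \<Psi>))) = (\<Sum>\<Psi>\<in>D J \<phi>. q ^ (?s * card T))"
      by (rule sum.cong[OF refl]) (simp only: card_S)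
    also have "\<dots> = real (card (D J \<phi>)) * (q ^ card T) ^ ?s" by (simp add: mult.commute flip: power_mult)
    \<comment> \<open>The choices and the probability combine to at most \<open>\<theta>\<close> per
      new edge, so \<open>\<theta>\<close> takes over the role that \<open>q\<close> has with two
      colours.\<close>
    also have "\<dots> \<le> (4 ^ card ?V * real n ^ (card ?V - 2)) ^ ?s * (q ^ card T) ^ ?s"
    proof (rule mult_right_mono)
      have "card (D J \<phi>) \<le> card (PiE (edges H - J) (\<lambda>h. covers n (\<phi> ` h)))"
        using fPi by (rule card_mono) (auto simp: D_def)
      then have "real (card (D J \<phi>)) \<le> (\<Prod>h\<in>edges H - J. real (card (covers n (\<phi> ` h))))"
        using fE by (simp add: card_PiE flip: of_nat_prod)
      also have "\<dots> \<le> (\<Prod>h\<in>edges H - J. 4 ^ card ?V * real n ^ (card ?V - 2))"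
        using card_covers[OF n1 c2] by (intro prod_mono) auto
      finally show "real (card (D J \<phi>)) \<le> (4 ^ card ?V * real n ^ (card ?V - 2)) ^ ?s" by simp
    qed (use q in simp)
    also have "\<dots> = (4 ^ card ?V * real n ^ (card ?V - 2) * q ^ card T) ^ ?s" by (simp add: power_mult_distrib)
    also have "\<dots> \<le> \<theta> ^ ?s" using theta(1) q by (intro power_mono) auto
    finally show "(\<Sum>\<Psi>\<in>(case x of (J, \<phi>) \<Rightarrow> D J \<phi>). q ^ card (?S (x, \<Psi>))) \<le> \<theta> ^ card (edges H - fst x)"
      unfolding x(1) by simp
  qed
  also have "\<dots> = (\<Sum>J\<in>sparse_missing. \<Sum>\<phi>\<in>placements n J G. \<theta> ^ card (edges H - J))"
    using finite_sparse_missing fpl by (subst sum.Sigma) (auto simp: case_prod_unfold)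
  also have "\<dots> \<le> 2 ^ (card (edges H) + 1) * (real n ^ card (verts F) * \<theta> ^ card (edges F))"
    using G th0 theta by (intro placements_weight[OF n1 c p]) (auto simp: typical_def)
  finally have "bg_prob n q (- {G'. extendable 3 H G (core_colouring S G) G'}) \<le> bg_prob n q (overlapping n) +
     2 ^ (card (edges H) + 1) * (real n ^ card (verts F) * \<theta> ^ card (edges F))" by simp
  moreover have "bg_prob n q (- {G'. extendable 3 H G (core_colouring S G) G'}) = 1 - bg_prob n q {G'. extendable 3 H G (core_colouring S G) G'}"
    using measure_pmf.prob_compl[of "{G'. extendable 3 H G (core_colouring S G) G'}" "binomial_graph n q"] by (simp add: Compl_eq_Diff_UNIV)
  ultimately show ?thesis by linarith
qed

end

section \<open>Choice of the constants\<close>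

lemma edges_ge_verts: "card (verts F) \<le> card (edges F)"
proof -
  have "1 * (real (card (verts F)) - 2) < d * (real (card (verts F)) - 2)"
    using size_F(2,3) by (intro mult_strict_right_mono) auto
  then have "real (card (verts F)) < real (card (edges F)) + 1" using tight_F by simp
  then show ?thesis by linarith
qed

lemma whp_extendable_2:
  assumes S: "S \<subseteq> edges F" "sb_graph S d" and c: "0 < c" "c \<le> 1"
  shows "whp_extendable_colouring 2 H (\<lambda>n. typical S (c * real n powr (- 1 / d)) n)
         (\<lambda>n. real n powr (- real (card (verts F)) / real (card (edges F))))"
  unfolding whp_extendable_colouring_def
proof (intro exI[of _ "core_colouring S"] conjI allI impI ballI)
  fix n G assume "G \<in> typical S (c * real n powr (- 1 / d)) n"
  then show "good_colouring 2 H G (core_colouring S G)" by (rule core_colouring_good[OF S]) simp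
next
  let ?v = "card (verts F)" and ?e = "card (edges F)"
  fix q :: "nat \<Rightarrow> real" and \<epsilon> :: real
  assume q: "(\<forall>n. 0 \<le> q n \<and> q n \<le> 1) \<and> q \<in> o(\<lambda>n. real n powr (- real ?v / real ?e))" and eps: "0 < \<epsilon>"
  \<comment> \<open>\<open>k \<le> c\<close> gives \<open>q n \<le> p\<close>, because
    \<open>1 / d \<le> ?v / ?e\<close>; the second bound makes the failure probability, of order
    \<open>k\<close>, at most \<open>\<epsilon>\<close>.\<close>
  define k where "k = min c (\<epsilon> / 2 ^ (card (edges H) + 1))"
  have k: "0 < k" "k \<le> c" "2 ^ (card (edges H) + 1) * k \<le> \<epsilon>"
    using c eps by (auto simp: k_def min_def field_simps)
  have "\<forall>\<^sub>F n in sequentially. norm (q n) \<le> k * norm (real n powr (- real ?v / real ?e))"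
    using q k(1) by (intro landau_o.smallD) auto
  then show "\<forall>\<^sub>F n in sequentially. \<forall>G\<in>typical S (c * real n powr (- 1 / d)) n.
      1 - \<epsilon> \<le> bg_prob n (q n) {G'. extendable 2 H G (core_colouring S G) G'}"
    using eventually_ge_at_top[of 1]
  proof eventually_elim
    case (elim n)
    have n1: "1 \<le> n" and np: "1 \<le> real n" using elim by simp_all
    have qk: "q n \<le> k * real n powr (- real ?v / real ?e)" using elim(1) q by simp
    have e0: "0 < real ?e" using size_F(1) by simp
    have "real ?e \<le> d * real ?v" using tight_F size_F(3) by (simp add: algebra_simps)
    then have "1 / d \<le> real ?v / real ?e" using size_F(3) e0 by (simp add: field_simps)
    then have "real n powr (- real ?v / real ?e) \<le> real n powr (- 1 / d)" using np by (intro powr_mono) auto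
    then have "k * real n powr (- real ?v / real ?e) \<le> c * real n powr (- 1 / d)" using k c by (intro mult_mono) auto
    then have qp: "q n \<le> c * real n powr (- 1 / d)" using qk by linarith
    have "real n ^ ?v * q n ^ ?e \<le> real n ^ ?v * (k * real n powr (- real ?v / real ?e)) ^ ?e"
      using qk q by (intro mult_left_mono power_mono) auto
    also have "\<dots> = k ^ ?e * (real n powr real ?v * real n powr (- real ?v))"
      using np e0 by (simp add: power_mult_distrib powr_powr flip: powr_realpow)
    also have "\<dots> = k ^ ?e" using np by (simp flip: powr_add)
    also have "\<dots> \<le> k ^ 1" using k c size_F(1) by (intro power_decreasing) auto
    finally have "2 ^ (card (edges H) + 1) * (real n ^ ?v * q n ^ ?e) \<le> 2 ^ (card (edges H) + 1) * k"
      by (intro mult_left_mono) auto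
    then have le: "2 ^ (card (edges H) + 1) * (real n ^ ?v * q n ^ ?e) \<le> \<epsilon>" using k(3) by linarith
    show ?case
    proof
      fix G assume G: "G \<in> typical S (c * real n powr (- 1 / d)) n"
      have "1 - 2 ^ (card (edges H) + 1) * (real n ^ ?v * q n ^ ?e) \<le> bg_prob n (q n) {G'. extendable 2 H G (core_colouring S G) G'}"
        using q by (intro extend_two_colours[OF S n1 c refl G _ _ qp]) auto
      then show "1 - \<epsilon> \<le> bg_prob n (q n) {G'. extendable 2 H G (core_colouring S G) G'}" using le by linarith
    qed
  qed
qed

lemma whp_extendable_3:
  assumes S: "S \<subseteq> edges F" "sb_graph S d"
  shows "\<exists>\<delta>>0. \<forall>c. 0 < c \<and> c \<le> 1 \<longrightarrow> whp_extendable_colouring 3 H (\<lambda>n. typical S (c * real n powr (- 1 / d)) n)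
         (\<lambda>n. real n powr (- 1 / max_density H + \<delta>))"
proof -
  let ?v = "card (verts F)" and ?e = "card (edges F)" and ?m = "max_density H"
  obtain T where T: "T \<subseteq> edges H" "T \<noteq> {}" "0 < ?m" "real (card T) = ?m * real (card (\<Union>T))"
    and Ts': "\<And>T'. T' \<subset> T \<Longrightarrow> T' \<noteq> {} \<Longrightarrow> real (card T') < ?m * real (card (\<Union>T'))"
    using densest_part by blast
  then have Ts: "\<forall>T'. T' \<subset> T \<longrightarrow> T' \<noteq> {} \<longrightarrow> real (card T') < ?m * real (card (\<Union>T'))" by blast
  let ?a = "card (\<Union>T)" and ?b = "card T"
  obtain \<eta> where eta0: "0 < \<eta>" and eta: "\<forall>a\<le>?a. \<forall>b\<le>?b. 0 < real a - real b / ?m \<longrightarrow> \<eta> \<le> real a - real b / ?m"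
    using positive_gap[of ?a ?b "\<lambda>a b. real a - real b / ?m"] by blast
  have "finite T" using T(1) finite_edges_H finite_subset by blast
  then have b0: "0 < real ?b" using T(2) by (simp add: card_gt_0_iff)
  \<comment> \<open>\<open>\<delta> * ?b \<le> 1 / 2\<close> brings the density
    \<open>n powr (\<delta> * ?b - 2)\<close> of exceptional edges below
    \<open>n powr (- (3 / 2))\<close>, and \<open>2 * \<delta> * ?b < \<eta>\<close> makes
    overlapping copies unlikely. The choice precedes that of \<open>c\<close>.\<close>
  define \<delta> where "\<delta> = min (1 / (2 * real ?b)) (\<eta> / (4 * real ?b))"
  have del: "0 < \<delta>" "\<delta> * real ?b \<le> 1 / 2" "2 * \<delta> * real ?b - \<eta> < 0"
  proof -
    show "0 < \<delta>" using b0 eta0 by (simp add: \<delta>_def)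
    have "\<delta> \<le> 1 / (2 * real ?b)" "\<delta> \<le> \<eta> / (4 * real ?b)" by (auto simp: \<delta>_def)
    then have "\<delta> * real ?b \<le> 1 / (2 * real ?b) * real ?b" "\<delta> * real ?b \<le> \<eta> / (4 * real ?b) * real ?b"
      by (intro mult_right_mono; simp)+
    then have "\<delta> * real ?b \<le> 1 / 2" "\<delta> * real ?b \<le> \<eta> / 4" using b0 by simp_all
    then show "\<delta> * real ?b \<le> 1 / 2" "2 * \<delta> * real ?b - \<eta> < 0" using eta0 by simp_all
  qed
  have a2: "2 \<le> ?a" by (rule card_UT[OF S T(1-4) Ts])
  have "whp_extendable_colouring 3 H (\<lambda>n. typical S (c * real n powr (- 1 / d)) n)
         (\<lambda>n. real n powr (- 1 / ?m + \<delta>))" if c: "0 < c" "c \<le> 1" for c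
    unfolding whp_extendable_colouring_def
  proof (intro exI[of _ "core_colouring S"] conjI allI impI ballI)
    fix n G assume "G \<in> typical S (c * real n powr (- 1 / d)) n"
    then show "good_colouring 3 H G (core_colouring S G)" by (rule core_colouring_good[OF S]) simp
  next
    fix q :: "nat \<Rightarrow> real" and \<epsilon> :: real
    assume q: "(\<forall>n. 0 \<le> q n \<and> q n \<le> 1) \<and> q \<in> o(\<lambda>n. real n powr (- 1 / ?m + \<delta>))" and eps: "0 < \<epsilon>"
    \<comment> \<open>The exponent \<open>3 / 2\<close> exceeds \<open>1 / d\<close>, so
      \<open>\<theta> n\<close> is eventually below \<open>p\<close>; and as
      \<open>?v \<le> ?e\<close>, it makes \<open>n ^ ?v * \<theta> n ^ ?e\<close> tend to
      0.\<close>
    define \<theta> where "\<theta> n = 4 ^ ?a * real n powr (- (3 / 2))" for n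
    define r where "r n = (2 * real ?a) ^ ?a * real n powr (2 * \<delta> * real ?b - \<eta>)
      + 2 ^ (card (edges H) + 1) * (4 ^ (?a * ?e) * real n powr (real ?v - 3 / 2 * real ?e))" for n
    have "real ?v - 3 / 2 * real ?e < 0" using edges_ge_verts size_F(1) by simp
    then have "r \<longlonglongrightarrow> (2 * real ?a) ^ ?a * 0 + 2 ^ (card (edges H) + 1) * (4 ^ (?a * ?e) * 0)"
      unfolding r_def using del(3) by (intro tendsto_intros powr_neg_tendsto_0)
    then have "r \<longlonglongrightarrow> 0" by simp
    then have ev_r: "\<forall>\<^sub>F n in sequentially. r n < \<epsilon>" using eps by (rule order_tendstoD)
    have "1 / d < 1" using size_F(3) by simp
    then have "(\<lambda>n. 4 ^ ?a * real n powr (1 / d - 3 / 2)) \<longlonglongrightarrow> 4 ^ ?a * 0"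
      by (intro tendsto_intros powr_neg_tendsto_0) simp
    then have ev_t: "\<forall>\<^sub>F n in sequentially. 4 ^ ?a * real n powr (1 / d - 3 / 2) < c"
      using c(1) by (intro order_tendstoD[of _ "4 ^ ?a * 0"]) auto
    have "\<forall>\<^sub>F n in sequentially. norm (q n) \<le> 1 * norm (real n powr (- 1 / ?m + \<delta>))"
      using q by (intro landau_o.smallD) auto
    then show "\<forall>\<^sub>F n in sequentially. \<forall>G\<in>typical S (c * real n powr (- 1 / d)) n.
        1 - \<epsilon> \<le> bg_prob n (q n) {G'. extendable 3 H G (core_colouring S G) G'}"
      using eventually_ge_at_top[of 1] ev_r ev_t
    proof eventually_elim
      case (elim n)
      have n1: "1 \<le> n" and np: "1 \<le> real n" using elim by simp_all
      have qn: "q n \<le> real n powr (- 1 / ?m + \<delta>)" "0 \<le> q n" "q n \<le> 1" using elim(1) q by simp_all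
      have "q n ^ ?b \<le> (real n powr (- 1 / ?m + \<delta>)) ^ ?b" using qn by (intro power_mono) auto
      also have "\<dots> = real n powr ((- 1 / ?m + \<delta>) * real ?b)" using np by (simp add: powr_powr flip: powr_realpow)
      also have "(- 1 / ?m + \<delta>) * real ?b = \<delta> * real ?b - real ?a"
        using T(3,4) by (simp add: algebra_simps)
      finally have "real n ^ (?a - 2) * q n ^ ?b \<le> real n ^ (?a - 2) * real n powr (\<delta> * real ?b - real ?a)"
        by (intro mult_left_mono) auto
      also have "\<dots> = real n powr (\<delta> * real ?b - 2)"
        using np a2 by (simp add: of_nat_diff flip: powr_realpow powr_add)
      also have "\<dots> \<le> real n powr (- (3 / 2))" using del(2) np by (intro powr_mono) auto
      finally have th1: "4 ^ ?a * real n ^ (?a - 2) * q n ^ ?b \<le> \<theta> n" by (simp add: \<theta>_def mult.assoc)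
      have th2: "\<theta> n \<le> c * real n powr (- 1 / d)"
      proof -
        have "\<theta> n = (4 ^ ?a * real n powr (1 / d - 3 / 2)) * real n powr (- 1 / d)"
          by (simp add: \<theta>_def mult.assoc flip: powr_add)
        also have "\<dots> \<le> c * real n powr (- 1 / d)" using elim(4) by (intro mult_right_mono) auto
        finally show ?thesis .
      qed
      have weight: "real n ^ ?v * \<theta> n ^ ?e = 4 ^ (?a * ?e) * real n powr (real ?v - 3 / 2 * real ?e)"
      proof -
        have "(real n powr (- (3 / 2))) ^ ?e = real n powr (- (3 / 2) * real ?e)"
          using np by (simp add: powr_powr flip: powr_realpow)
        then have w1: "\<theta> n ^ ?e = 4 ^ (?a * ?e) * real n powr (- (3 / 2) * real ?e)"
          by (simp add: \<theta>_def power_mult_distrib power_mult)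
        have w2: "real n ^ ?v = real n powr real ?v" using np by (simp add: powr_realpow)
        have w3: "real n powr real ?v * real n powr (- (3 / 2) * real ?e) = real n powr (real ?v - 3 / 2 * real ?e)"
          by (simp flip: powr_add)
        show ?thesis unfolding w1 w2 w3[symmetric] by (rule mult.left_commute)
      qed
      have ov: "bg_prob n (q n) (overlapping T n) \<le> (2 * real ?a) ^ ?a * real n powr (2 * \<delta> * real ?b - \<eta>)"
        by (rule overlapping_prob[OF S T(1-4) Ts n1 qn(2,3,1)]) (use del eta in auto)
      show ?case
      proof
        fix G assume G: "G \<in> typical S (c * real n powr (- 1 / d)) n"
        have "1 - bg_prob n (q n) (overlapping T n) - 2 ^ (card (edges H) + 1) * (real n ^ ?v * \<theta> n ^ ?e)
           \<le> bg_prob n (q n) {G'. extendable 3 H G (core_colouring S G) G'}"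
          by (rule extend_three_colours[OF S T(1-4) Ts n1 c refl G qn(2,3) th1 th2])
        then show "1 - \<epsilon> \<le> bg_prob n (q n) {G'. extendable 3 H G (core_colouring S G) G'}"
          using ov elim(3) unfolding r_def weight by linarith
      qed
    qed
  qed
  then show ?thesis using del(1) by blast
qed

end

theorem theorem2p4:
  fixes F :: "'a ugraph" and f :: "'a set" and \<tau> :: "'a set \<Rightarrow> 'a \<Rightarrow> 'a"
    and H :: "('a + ('a set \<times> 'a)) ugraph"
  assumes "is_graph F" and "two_balanced F" and "contains_cycle F"
    and "f \<in> edges F"
    and "\<And>g. g \<in> edges F \<Longrightarrow> bij_betw (\<tau> g) f g"
    and "H = otimes1 F F f \<tau>"
  shows "\<exists>\<delta>>0. \<exists>c0>0. \<forall>c. 0 < c \<and> c < c0 \<longrightarrow>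
    (\<exists>\<G> :: nat \<Rightarrow> nat ugraph set.
       (\<lambda>n. measure_pmf.prob (binomial_graph n (c * real n powr (- 1 / m2 H))) (\<G> n))
          \<longlonglongrightarrow> 1 \<and>
       whp_extendable_colouring 2 H \<G>
         (\<lambda>n. real n powr (- real (card (verts F)) / real (card (edges F)))) \<and>
       whp_extendable_colouring 3 H \<G>
         (\<lambda>n. real n powr (- 1 / max_density H + \<delta>)))"
proof -
  define d where "d = (real (card (edges F)) - 1) / (real (card (verts F)) - 2)"
  interpret attached_graph F d f \<tau> H
    using assms by unfold_locales (auto simp: d_def)
  obtain S where S: "S \<subseteq> edges F" "sb_graph S d" by (rule strict_core)
  obtain \<delta> where del: "0 < \<delta>" and three: "\<And>c. 0 < c \<Longrightarrow> c \<le> 1 \<Longrightarrow>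
     whp_extendable_colouring 3 H (\<lambda>n. typical S (c * real n powr (- 1 / d)) n) (\<lambda>n. real n powr (- 1 / max_density H + \<delta>))"
    using whp_extendable_3[OF S] by blast
  obtain c0 where c0: "0 < c0" "c0 \<le> 1" and whp: "\<And>c. 0 < c \<Longrightarrow> c < c0 \<Longrightarrow>
    (\<lambda>n. bg_prob n (c * real n powr (- 1 / d)) (typical S (c * real n powr (- 1 / d)) n)) \<longlonglongrightarrow> 1"
    using typical_whp[OF S(2)] by blast
  have main: "\<exists>\<G>. (\<lambda>n. bg_prob n (c * real n powr (- 1 / d)) (\<G> n)) \<longlonglongrightarrow> 1 \<and>
       whp_extendable_colouring 2 H \<G> (\<lambda>n. real n powr (- real (card (verts F)) / real (card (edges F)))) \<and>
       whp_extendable_colouring 3 H \<G> (\<lambda>n. real n powr (- 1 / max_density H + \<delta>))" if c: "0 < c \<and> c < c0" for c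
  proof -
    have "c \<le> 1" using c c0 by simp
    then show ?thesis using whp whp_extendable_2[OF S] three c
      by (intro exI[of _ "\<lambda>n. typical S (c * real n powr (- 1 / d)) n"]) auto
  qed
  show ?thesis
    unfolding m2_H by (rule exI[of _ \<delta>], rule conjI[OF del], rule exI[of _ c0], rule conjI[OF c0(1)]) (intro allI impI main)
qed

end
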